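(* The following problem can be solved in $O((n+m)\log n)$ time and $O(n+m)$ space: given an integer $k$ and an undirected $k$-core graph $G=(V,E)$ with $n=|V|$ and $m=|E|$, find all MinRSs of $G$, i.e. all inclusion-wise minimal nonempty subsets $Y\subseteq V$ such that $G-Y$ is a $k$-core graph.
   Context: An undirected graph is a $k$-core graph if its minimum degree is at least $k$; the null graph (no vertices) is regarded as a $k$-core graph. For $Y\subseteq V$, $G-Y$ is the subgraph of $G$ induced by $V\setminus Y$. *)

theory Defs
  imports Complex_Main
begin

section \<open>Graphs, cores and minimal removable sets\<close>

record 'a ugraph =
  verts :: "'a set"
  edges :: "'a set set"

definition simple_graph :: "'a ugraph \<Rightarrow> bool" where
  "simple_graph G \<longleftrightarrow> finite (verts G) \<and> (\<forall>e \<in> edges G. e \<subseteq> verts G \<and> card e = 2)"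

definition degree :: "'a ugraph \<Rightarrow> 'a \<Rightarrow> nat" where
  "degree G v = card {e \<in> edges G. v \<in> e}"

definition min_degree :: "'a ugraph \<Rightarrow> nat" where
  "min_degree G = Min (degree G ` verts G)"

definition k_core :: "int \<Rightarrow> 'a ugraph \<Rightarrow> bool" where
  "k_core k G \<longleftrightarrow> verts G = {} \<or> k \<le> int (min_degree G)"

definition delete_verts :: "'a ugraph \<Rightarrow> 'a set \<Rightarrow> 'a ugraph" where
  "delete_verts G Y =
     \<lparr>verts = verts G - Y, edges = {e \<in> edges G. e \<subseteq> verts G - Y}\<rparr>"

definition removable :: "int \<Rightarrow> 'a ugraph \<Rightarrow> 'a set \<Rightarrow> bool" where
  "removable k G Y \<longleftrightarrow> Y \<noteq> {} \<and> Y \<subseteq> verts G \<and> k_core k (delete_verts G Y)"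

definition MinRSs :: "int \<Rightarrow> 'a ugraph \<Rightarrow> 'a set set" where
  "MinRSs k G = {Y. removable k G Y \<and> (\<forall>Z. removable k G Z \<and> Z \<subseteq> Y \<longrightarrow> Z = Y)}"


section \<open>A word RAM\<close>

text \<open>
  A program works on registers, of which it mentions only finitely many, and on a
  random-access memory. Registers and memory cells hold words. The basic instructions are those of
  the unit-cost RAM with addition and subtraction; control flow is structured. Operands
  are register names, and \<open>If r s\<close> and \<open>While r s\<close> test whether the content of
  register \<open>r\<close> is less than that of register \<open>s\<close>.
\<close>

datatype prog =
    Skip
  | Const nat int
  | Add nat nat nat
  | Sub nat nat nat
  | Load nat nat
  | Store nat nat
  | Seq prog prog
  | If nat nat prog prog
  | While nat nat prog

text \<open>Register contents and memory contents.\<close>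

type_synonym state = "(nat \<Rightarrow> int) \<times> (nat \<Rightarrow> int)"

definition is_word :: "nat \<Rightarrow> int \<Rightarrow> bool" where
  "is_word w x \<longleftrightarrow> - (2 ^ w) \<le> x \<and> x < 2 ^ w"

text \<open>
  \<open>exec w S p s t s'\<close>: on a machine with word length \<open>w\<close> (plus sign bit) and \<open>S\<close> memory cells,
  program \<open>p\<close> started in \<open>s\<close> halts in \<open>s'\<close> after \<open>t\<close> unit-cost steps (instructions and
  tests). There is no rule for a word overflow or for an address outside \<open>{0..<S}\<close>, so a run
  committing either fault does not halt in this sense.
\<close>

inductive exec :: "nat \<Rightarrow> nat \<Rightarrow> prog \<Rightarrow> state \<Rightarrow> nat \<Rightarrow> state \<Rightarrow> bool"
  for w S :: nat
where
  Skip: "exec w S Skip s 1 s"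
| Const: "is_word w i \<Longrightarrow> exec w S (Const r i) (R, M) 1 (R(r := i), M)"
| Add: "is_word w (R a + R b) \<Longrightarrow> exec w S (Add r a b) (R, M) 1 (R(r := R a + R b), M)"
| Sub: "is_word w (R a - R b) \<Longrightarrow> exec w S (Sub r a b) (R, M) 1 (R(r := R a - R b), M)"
| Load: "0 \<le> R a \<Longrightarrow> R a < int S \<Longrightarrow>
    exec w S (Load r a) (R, M) 1 (R(r := M (nat (R a))), M)"
| Store: "0 \<le> R a \<Longrightarrow> R a < int S \<Longrightarrow>
    exec w S (Store a r) (R, M) 1 (R, M(nat (R a) := R r))"
| Seq: "exec w S p s t s' \<Longrightarrow> exec w S q s' u s'' \<Longrightarrow> exec w S (Seq p q) s (t + u) s''"
| IfTrue: "fst s a < fst s b \<Longrightarrow> exec w S p s t s' \<Longrightarrow> exec w S (If a b p q) s (t + 1) s'"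
| IfFalse: "\<not> fst s a < fst s b \<Longrightarrow> exec w S q s t s' \<Longrightarrow> exec w S (If a b p q) s (t + 1) s'"
| WhileFalse: "\<not> fst s a < fst s b \<Longrightarrow> exec w S (While a b p) s 1 s"
| WhileTrue: "fst s a < fst s b \<Longrightarrow> exec w S p s t s' \<Longrightarrow> exec w S (While a b p) s' u s'' \<Longrightarrow>
    exec w S (While a b p) s (t + u + 1) s''"

text \<open>Execution is deterministic, so the existence of a halting run describes the run.\<close>

lemma exec_deterministic:
  "exec w S p s t s' \<Longrightarrow> exec w S p s u s'' \<Longrightarrow> u = t \<and> s'' = s'"
proof (induction arbitrary: u s'' rule: exec.induct)
  case (Skip s)
  then show ?case by cases auto
next
  case (Const i r R M)
  from Const.prems show ?case by cases auto
next
  case (Add R a b r M)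
  from Add.prems show ?case by cases auto
next
  case (Sub R a b r M)
  from Sub.prems show ?case by cases auto
next
  case (Load R a r M)
  from Load.prems show ?case by cases auto
next
  case (Store R a r M)
  from Store.prems show ?case by cases auto
next
  case (Seq p s t s' q v s1)
  note IH = Seq.IH
  from Seq.prems show ?case
  proof cases
    case (Seq t2 s2 u2)
    with IH(1)[of t2 s2] IH(2)[of u2 s''] show ?thesis by simp
  qed
next
  case (IfTrue s a b p t s' q)
  from IfTrue.prems IfTrue.hyps show ?case by cases (auto dest: IfTrue.IH)
next
  case (IfFalse s a b q t s' p)
  from IfFalse.prems IfFalse.hyps show ?case by cases (auto dest: IfFalse.IH)
next
  case (WhileFalse s a b p)
  from WhileFalse.prems WhileFalse.hyps show ?case by cases auto
next
  case (WhileTrue s a b p t s' v s1)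
  note IH = WhileTrue.IH and hyps = WhileTrue.hyps
  from WhileTrue.prems show ?case
  proof cases
    case WhileFalse
    with hyps show ?thesis by simp
  next
    case (WhileTrue t2 s2 u2)
    with IH(1)[of t2 s2] IH(2)[of u2 s''] show ?thesis by simp
  qed
qed


section \<open>Input and output conventions\<close>

text \<open>
  A graph with vertices \<open>{0..<n}\<close> is given as an edge list: each edge occurs exactly once, in
  arbitrary order and orientation.
\<close>

definition edge_list :: "nat ugraph \<Rightarrow> (nat \<times> nat) list \<Rightarrow> bool" where
  "edge_list G es \<longleftrightarrow>
     distinct (map (\<lambda>(u, v). {u, v}) es) \<and> set (map (\<lambda>(u, v). {u, v}) es) = edges G"

definition input_words :: "int \<Rightarrow> nat \<Rightarrow> (nat \<times> nat) list \<Rightarrow> int list" where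
  "input_words k n es =
     [k, int n, int (length es)] @ concat (map (\<lambda>(u, v). [int u, int v]) es)"

definition initial_state :: "int list \<Rightarrow> state" where
  "initial_state xs = ((\<lambda>_. 0), (\<lambda>a. if a < length xs then xs ! a else 0))"

text \<open>
  A family of vertex sets is output as the number of its members followed by the members, each
  being listed without repetition and preceded by its size. Register \<open>0\<close> points to the output.
\<close>

definition output_words :: "nat list list \<Rightarrow> int list" where
  "output_words Yss =
     int (length Yss) # concat (map (\<lambda>Ys. int (length Ys) # map int Ys) Yss)"

definition outputs :: "nat \<Rightarrow> state \<Rightarrow> nat set set \<Rightarrow> bool" where
  "outputs S s \<Y> \<longleftrightarrow>
     (\<exists>Yss p. distinct (map set Yss) \<and> set (map set Yss) = \<Y> \<and> (\<forall>Ys \<in> set Yss. distinct Ys) \<and>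
        fst s 0 = int p \<and> p + length (output_words Yss) \<le> S \<and>
        (\<forall>i < length (output_words Yss). snd s (p + i) = output_words Yss ! i))"

end

(*
  Vertex v reaches u if every removable set containing v contains u. MinRSs are the
  sets that are closed and strongly connected under reachability, that is, the terminal strong
  components, and they are found by a path-based depth-first search. The search keeps a stack of
  vertices cut into consecutive clusters; a cluster is strongly connected and reaches all
  clusters above it. A vertex u of degree d is forced by the top cluster once more than d - k of
  its neighbours lie in it. A forced u is pushed as a new cluster if it is new; if it is on
  the stack, all clusters above it are merged into its own; if it was already discarded, then the
  whole stack reaches a known MinRS and is discarded. If no further vertex is forced, the top cluster is
  a MinRS, and the stack is discarded.

  To find forced vertices, u records the stack positions of its neighbours. Let q(u) be the
  (d - k + 1)-th largest of them; then u is forced by the top cluster iff q(u) is not below its base.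
  While u's neighbours stay on the stack q(u) only grows, and each time it is set, an entry for u
  is filed under the cluster containing q(u), which is found by binary search in the list of bases: this is the
  logarithm in the running time. All entries form one linked list, top cluster first, in which
  the base vertex of each cluster closes the section of that cluster; hence merging two clusters
  costs no list operation at all. Each half-edge makes at most one entry.
*)
theory Submission
  imports Defs
begin

section \<open>A small language with thirteen arrays\<close>

text \<open>Clusters enter the argument only through stack positions: a merge changes the list of
  bases but no position, so no count of neighbours is ever redone. A pushed vertex has the largest
  position, hence each queue is an ascending array and its (d - k + 1)-th largest element is one
  access away. The stack is only discarded as a whole, so positions never shift; this is legitimate
  because all of it reaches the MinRS at hand. Superseded entries stay in the list: what they assert
  remains true, and removing one costs constant time.

  Correctness has two sides. Every entry must be justified by reachability
  (\<open>sound_inv\<close>), and every forced vertex must be found on the stack or in the list,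
  high enough in either (\<open>cover_inv\<close>). The first keeps clusters strongly connected, the
  second makes an exhausted top cluster removable.

  As the bound concerns machine steps, the program is executed symbolically with a clock; the lists
  and sets of the argument are ghost values quantified in the loop invariants. A credit of
  \<open>250 + 9 * L\<close> per vertex and half-edge, where \<open>n \<le> 2 ^ L\<close>, pays for
  the depth-first search.\<close>

datatype cmd =
    Nop
  | Con nat int
  | Ad nat nat nat
  | Su nat nat nat
  | Ld nat nat nat
  | St nat nat nat
  | Sq cmd cmd (infixr ";;" 60)
  | Ite nat nat cmd cmd
  | Whl nat nat cmd

text \<open>
  Array \<open>a < 13\<close> occupies the addresses from \<open>a * N\<close> on, and register \<open>a\<close> holds that base address.
  Register \<open>13\<close> is scratch space for addresses, and variable \<open>r\<close> of a command lives in register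
  \<open>r + 14\<close>.
\<close>

primrec compile :: "cmd \<Rightarrow> prog" where
  "compile Nop = Skip"
| "compile (Con r i) = Const (r + 14) i"
| "compile (Ad r a b) = Add (r + 14) (a + 14) (b + 14)"
| "compile (Su r a b) = Sub (r + 14) (a + 14) (b + 14)"
| "compile (Ld r a i) = Seq (Add 13 a (i + 14)) (Load (r + 14) 13)"
| "compile (St a i r) = Seq (Add 13 a (i + 14)) (Store 13 (r + 14))"
| "compile (Sq c d) = Seq (compile c) (compile d)"
| "compile (Ite a b c d) = If (a + 14) (b + 14) (compile c) (compile d)"
| "compile (Whl a b c) = While (a + 14) (b + 14) (compile c)"

type_synonym vars = "nat \<Rightarrow> int"
type_synonym arrs = "nat \<Rightarrow> int \<Rightarrow> int"
type_synonym pred = "vars \<Rightarrow> arrs \<Rightarrow> int \<Rightarrow> bool"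

locale layout =
  fixes N BD :: int and w S :: nat
  assumes N_nonneg: "0 \<le> N"
    and N_space: "13 * N \<le> int S"
    and N_BD: "13 * N \<le> BD"
    and BD_word: "BD < 2 ^ w"
begin

section \<open>Symbolic execution and its soundness on the word RAM\<close>

definition wd :: "int \<Rightarrow> bool" where
  "wd x \<longleftrightarrow> - BD \<le> x \<and> x \<le> BD"

text \<open>Cells outside the arrays read as \<open>0\<close>, so the abstract arrays are a function
  of the memory alone and a store becomes a plain function update (\<open>view_upd\<close>).\<close>

definition view :: "(nat \<Rightarrow> int) \<Rightarrow> arrs" where
  "view M = (\<lambda>a i. if a < 13 \<and> 0 \<le> i \<and> i < N then M (nat (int a * N + i)) else 0)"

definition rel :: "state \<Rightarrow> vars \<Rightarrow> arrs \<Rightarrow> bool" where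
  "rel s V A \<longleftrightarrow> (\<forall>a<13. fst s a = int a * N) \<and> (\<forall>r. fst s (r + 14) = V r) \<and> view (snd s) = A"

text \<open>
  Symbolic execution with a clock. A loop invariant has to bound the clock by a constant; since
  every iteration advances the clock, this already implies termination.
\<close>

primrec vc :: "cmd \<Rightarrow> pred \<Rightarrow> pred" where
  "vc Nop Q V A t = Q V A (t + 1)"
| "vc (Con r i) Q V A t = (wd i \<and> Q (V(r := i)) A (t + 1))"
| "vc (Ad r a b) Q V A t = (wd (V a + V b) \<and> Q (V(r := V a + V b)) A (t + 1))"
| "vc (Su r a b) Q V A t = (wd (V a - V b) \<and> Q (V(r := V a - V b)) A (t + 1))"
| "vc (Ld r a i) Q V A t = (a < 13 \<and> 0 \<le> V i \<and> V i < N \<and> Q (V(r := A a (V i))) A (t + 2))"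
| "vc (St a i r) Q V A t = (a < 13 \<and> 0 \<le> V i \<and> V i < N \<and> Q V (A(a := (A a)(V i := V r))) (t + 2))"
| "vc (Sq c d) Q V A t = vc c (vc d Q) V A t"
| "vc (Ite a b c d) Q V A t = (if V a < V b then vc c Q V A (t + 1) else vc d Q V A (t + 1))"
| "vc (Whl a b c) Q V A t =
    (\<exists>I T. I V A t \<and> (\<forall>V A t. I V A t \<longrightarrow> t \<le> (T :: int) \<and>
      (if V a < V b then vc c I V A (t + 1) else Q V A (t + 1))))"

lemma wd_word: "wd x \<Longrightarrow> is_word w x"
  using BD_word by (auto simp: wd_def is_word_def)

lemma addr_range:
  assumes "a < 13" "0 \<le> i" "i < N"
  shows "0 \<le> int a * N + i" "int a * N + i < 13 * N"
proof -
  have "int a * N \<le> 12 * N" using assms by (intro mult_right_mono) auto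
  then show "int a * N + i < 13 * N" using assms by linarith
  show "0 \<le> int a * N + i" using assms N_nonneg by simp
qed

lemma addr_inj:
  assumes "a * N + i = b * N + j" "0 \<le> i" "i < N" "0 \<le> j" "j < N"
  shows "a = b \<and> i = j"
proof -
  have False if "a < b" "a * N + i = b * N + j" "i < N" "0 \<le> j" for a b i j :: int
    using that mult_right_mono[of "a + 1" b N] N_nonneg by (simp add: distrib_right)
  from this[of a b i j] this[of b a j i] assms have "a = b" by (cases a b rule: linorder_cases) auto
  with assms(1) show ?thesis by simp
qed

lemma view_upd:
  assumes "a < 13" "0 \<le> i" "i < N"
  shows "view (M(nat (int a * N + i) := x)) = (view M)(a := (view M a)(i := x))"
proof (intro ext)
  fix b j
  have "nat (int b * N + j) = nat (int a * N + i) \<longleftrightarrow> a = b \<and> i = j"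
    if "b < 13" "0 \<le> j" "j < N"
  proof -
    have "nat (int b * N + j) = nat (int a * N + i) \<longleftrightarrow> int b * N + j = int a * N + i"
      using addr_range(1)[OF that] addr_range(1)[OF assms] by (rule eq_nat_nat_iff)
    then show ?thesis using addr_inj[of "int b" j "int a" i] that assms by auto
  qed
  then show "view (M(nat (int a * N + i) := x)) b j = ((view M)(a := (view M a)(i := x))) b j"
    using assms by (cases "b = a"; cases "j = i") (simp_all add: view_def)
qed

text \<open>The clock of \<open>vc\<close> counts the steps of \<open>exec\<close> exactly; an array
  access takes two of them, since its address is first added up in register
  \<open>13\<close>.\<close>

lemma vc_sound:
  "vc c Q V A t \<Longrightarrow> rel s V A \<Longrightarrow>
    \<exists>u s' V' A'. exec w S (compile c) s u s' \<and> rel s' V' A' \<and> Q V' A' (t + int u)"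
proof (induction c arbitrary: Q V A t s)
  case Nop
  then show ?case using exec.Skip[of w S s] by (metis compile.simps(1) vc.simps(1) of_nat_1)
next
  case (Con r i)
  obtain R M where s: "s = (R, M)" by force
  have "rel (R(r + 14 := i), M) (V(r := i)) A" using Con s by (auto simp: rel_def)
  moreover have "exec w S (compile (Con r i)) s 1 (R(r + 14 := i), M)"
    unfolding s compile.simps by (rule exec.Const) (use Con in \<open>auto intro!: wd_word\<close>)
  ultimately show ?case using Con by force
next
  case (Ad r a b)
  obtain R M where s: "s = (R, M)" by force
  have R: "R (a + 14) = V a" "R (b + 14) = V b" using Ad s by (auto simp: rel_def)
  have "rel (R(r + 14 := R (a + 14) + R (b + 14)), M) (V(r := V a + V b)) A"
    using Ad s by (auto simp: rel_def)
  moreover have "exec w S (compile (Ad r a b)) s 1 (R(r + 14 := R (a + 14) + R (b + 14)), M)"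
    unfolding s compile.simps by (rule exec.Add) (use Ad R in \<open>auto intro!: wd_word\<close>)
  ultimately show ?case using Ad by force
next
  case (Su r a b)
  obtain R M where s: "s = (R, M)" by force
  have R: "R (a + 14) = V a" "R (b + 14) = V b" using Su s by (auto simp: rel_def)
  have "rel (R(r + 14 := R (a + 14) - R (b + 14)), M) (V(r := V a - V b)) A"
    using Su s by (auto simp: rel_def)
  moreover have "exec w S (compile (Su r a b)) s 1 (R(r + 14 := R (a + 14) - R (b + 14)), M)"
    unfolding s compile.simps by (rule exec.Sub) (use Su R in \<open>auto intro!: wd_word\<close>)
  ultimately show ?case using Su by force
next
  case (Ld r a i)
  obtain R M where s: "s = (R, M)" by force
  from Ld have ai: "a < 13" "0 \<le> V i" "V i < N" by auto
  have R: "R a = int a * N" "R (i + 14) = V i" "view M = A" using Ld s by (auto simp: rel_def)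
  note ar = addr_range[OF ai]
  let ?x = "int a * N + V i"
  let ?R = "R(13 := ?x)"
  have "wd ?x" using ar N_BD by (simp add: wd_def)
  from wd_word[OF this] have 1: "exec w S (Add 13 a (i + 14)) s 1 (?R, M)"
    using exec.Add[of w R a "i + 14" S 13 M] R by (auto simp: s)
  have 2: "exec w S (Load (r + 14) 13) (?R, M) 1 (?R(r + 14 := M (nat ?x)), M)"
    using exec.Load[of ?R 13 S w "r + 14" M] ar N_space by auto
  have "M (nat ?x) = A a (V i)" using ai R(3) by (auto simp: view_def)
  then have "rel (?R(r + 14 := M (nat ?x)), M) (V(r := A a (V i))) A"
    using Ld s by (auto simp: rel_def)
  moreover have "exec w S (compile (Ld r a i)) s 2 (?R(r + 14 := M (nat ?x)), M)"
    using exec.Seq[OF 1 2] by (simp add: numeral_2_eq_2)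
  ultimately show ?case using Ld by force
next
  case (St a i r)
  obtain R M where s: "s = (R, M)" by force
  from St have ai: "a < 13" "0 \<le> V i" "V i < N" by auto
  have R: "R a = int a * N" "R (i + 14) = V i" "view M = A" "R (r + 14) = V r"
    using St s by (auto simp: rel_def)
  note ar = addr_range[OF ai]
  let ?x = "int a * N + V i"
  let ?R = "R(13 := ?x)" and ?M = "M(nat (int a * N + V i) := V r)"
  have "wd ?x" using ar N_BD by (simp add: wd_def)
  from wd_word[OF this] have 1: "exec w S (Add 13 a (i + 14)) s 1 (?R, M)"
    using exec.Add[of w R a "i + 14" S 13 M] R by (auto simp: s)
  have 2: "exec w S (Store 13 (r + 14)) (?R, M) 1 (?R, ?M)"
    using exec.Store[of ?R 13 S w "r + 14" M] ar N_space R by auto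
  have "rel (?R, ?M) V (A(a := (A a)(V i := V r)))"
    using St s ai by (auto simp: rel_def view_upd)
  moreover have "exec w S (compile (St a i r)) s 2 (?R, ?M)"
    using exec.Seq[OF 1 2] by (simp add: numeral_2_eq_2)
  ultimately show ?case using St by force
next
  case (Sq c d)
  from Sq.prems have "vc c (vc d Q) V A t" by simp
  from Sq.IH(1)[OF this Sq.prems(2)] obtain u s' V' A'
    where 1: "exec w S (compile c) s u s'" "rel s' V' A'" "vc d Q V' A' (t + int u)" by blast
  from Sq.IH(2)[OF 1(3,2)] obtain u' s'' V'' A''
    where 2: "exec w S (compile d) s' u' s''" "rel s'' V'' A''" "Q V'' A'' (t + int u + int u')" by blast
  have "exec w S (compile (c ;; d)) s (u + u') s''" using exec.Seq[OF 1(1) 2(1)] by simp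
  then show ?case using 2 by (metis add.assoc of_nat_add)
next
  case (Ite a b c d)
  have R: "fst s (a + 14) = V a" "fst s (b + 14) = V b" using Ite.prems by (auto simp: rel_def)
  show ?case
  proof (cases "V a < V b")
    case True
    with Ite.prems Ite.IH(1)[of Q V A "t + 1" s] obtain u s' V' A'
      where 1: "exec w S (compile c) s u s'" "rel s' V' A'" "Q V' A' (t + 1 + int u)" by auto
    have "exec w S (compile (Ite a b c d)) s (u + 1) s'"
      unfolding compile.simps by (rule exec.IfTrue) (use 1 True R in auto)
    moreover have "t + int (u + 1) = t + 1 + int u" by simp
    ultimately show ?thesis using 1 by metis
  next
    case False
    with Ite.prems Ite.IH(2)[of Q V A "t + 1" s] obtain u s' V' A'
      where 1: "exec w S (compile d) s u s'" "rel s' V' A'" "Q V' A' (t + 1 + int u)" by auto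
    have "exec w S (compile (Ite a b c d)) s (u + 1) s'"
      unfolding compile.simps by (rule exec.IfFalse) (use 1 False R in auto)
    moreover have "t + int (u + 1) = t + 1 + int u" by simp
    ultimately show ?thesis using 1 by metis
  qed
next
  case (Whl a b c)
  from Whl.prems obtain I T where I: "I V A t"
    and step: "\<And>V A t. I V A t \<Longrightarrow> t \<le> (T :: int) \<and>
      (if V a < V b then vc c I V A (t + 1) else Q V A (t + 1))" by auto
  from I Whl.prems(2) show ?case
  proof (induction "nat (T - t)" arbitrary: V A t s rule: less_induct)
    case less
    have R: "fst s (a + 14) = V a" "fst s (b + 14) = V b" using less.prems by (auto simp: rel_def)
    show ?case
    proof (cases "V a < V b")
      case True
      with step[OF less.prems(1)] have "t \<le> T" "vc c I V A (t + 1)" by auto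
      from Whl.IH[OF this(2) less.prems(2)] obtain u s' V' A'
        where 1: "exec w S (compile c) s u s'" "rel s' V' A'" "I V' A' (t + 1 + int u)" by blast
      from step[OF 1(3)] have "t + 1 + int u \<le> T" by blast
      then have "nat (T - (t + 1 + int u)) < nat (T - t)" by simp
      from less.hyps[OF this 1(3,2)] obtain u' s'' V'' A'' where
        2: "exec w S (compile (Whl a b c)) s' u' s''" "rel s'' V'' A''" "Q V'' A'' (t + 1 + int u + int u')"
        by blast
      have "exec w S (compile (Whl a b c)) s (u + u' + 1) s''"
        using exec.WhileTrue[of s "a + 14" "b + 14" w S "compile c" u s' u' s''] 1 2 True R by auto
      moreover have "t + int (u + u' + 1) = t + 1 + int u + int u'" by simp
      ultimately show ?thesis using 2 by metis
    next
      case False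
      with step[OF less.prems(1)] have "Q V A (t + 1)" by auto
      moreover have "exec w S (compile (Whl a b c)) s 1 s"
        unfolding compile.simps by (rule exec.WhileFalse) (use False R in auto)
      ultimately show ?thesis using less.prems by (metis of_nat_1)
    qed
  qed
qed

text \<open>Unfolding the rule for loops would leave an invariant to be guessed; loops go through
  \<open>vc_while\<close> instead.\<close>

declare vc.simps(9) [simp del]

lemma vc_while:
  assumes "I V A t"
    and "\<And>V A t. I V A t \<Longrightarrow> t \<le> (T :: int)"
    and "\<And>V A t. I V A t \<Longrightarrow> V a < V b \<Longrightarrow> vc c I V A (t + 1)"
    and "\<And>V A t. I V A t \<Longrightarrow> \<not> V a < V b \<Longrightarrow> Q V A (t + 1)"
  shows "vc (Whl a b c) Q V A t"
  using assms by (simp only: vc.simps) (intro exI[of _ I] exI[of _ T], auto)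

end

section \<open>Reachability between vertices\<close>

text \<open>Neighbours appear in the order of the edge list, so a prefix of the edge list yields a
  prefix of each neighbour list. The loops that read the input have this as their invariant.\<close>

definition nbrs :: "(nat \<times> nat) list \<Rightarrow> nat \<Rightarrow> nat list" where
  "nbrs es u = concat (map (\<lambda>(a, b). (if a = u then [b] else []) @ (if b = u then [a] else [])) es)"

lemma nbrs_simps [simp]:
  "nbrs [] u = []"
  "nbrs (es @ [(a, b)]) u = nbrs es u @ (if a = u then [b] else []) @ (if b = u then [a] else [])"
  by (auto simp: nbrs_def)

lemma nbrs_append: "nbrs (es @ fs) u = nbrs es u @ nbrs fs u"
  by (simp add: nbrs_def)

locale core_graph =
  fixes k :: int and G :: "nat ugraph" and n m :: nat and es :: "(nat \<times> nat) list"
  assumes simple: "simple_graph G" and core: "k_core k G" and verts: "verts G = {0..<n}"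
    and m: "m = card (edges G)" and es: "edge_list G es"
begin

abbreviation nb :: "nat \<Rightarrow> nat list" where "nb \<equiv> nbrs es"
abbreviation dg :: "nat \<Rightarrow> nat" where "dg u \<equiv> length (nb u)"

section \<open>Neighbour lists, degrees and removable sets\<close>

lemma edge_props:
  assumes "(a, b) \<in> set es"
  shows "a \<noteq> b" "a < n" "b < n" "{a, b} \<in> edges G"
proof -
  show e: "{a, b} \<in> edges G" using es assms by (force simp: edge_list_def)
  with simple verts have "card {a, b} = 2" "{a, b} \<subseteq> {0..<n}" by (auto simp: simple_graph_def)
  then show "a \<noteq> b" "a < n" "b < n" by (auto simp: card_insert_if split: if_splits)
qed

lemma length_es: "length es = m"
proof -
  have "card (set (map (\<lambda>(u, v). {u, v}) es)) = length es"
    using es distinct_card[of "map (\<lambda>(u, v). {u, v}) es"] by (auto simp: edge_list_def)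
  then show ?thesis using es m by (auto simp: edge_list_def)
qed

lemma set_nb: "set (nb u) = {v. {u, v} \<in> edges G}"
proof -
  have "v \<in> set (nb u) \<longleftrightarrow> {u, v} \<in> edges G" for v
  proof -
    have "v \<in> set (nb u) \<longleftrightarrow> (u, v) \<in> set es \<or> (v, u) \<in> set es"
      by (auto simp: nbrs_def split: if_splits)
    also have "\<dots> \<longleftrightarrow> {u, v} \<in> set (map (\<lambda>(u, v). {u, v}) es)"
      by (auto simp: doubleton_eq_iff)
    finally show ?thesis using es by (auto simp: edge_list_def)
  qed
  then show ?thesis by auto
qed

lemma nb_sym: "v \<in> set (nb u) \<longleftrightarrow> u \<in> set (nb v)"
  by (auto simp: set_nb insert_commute)

lemma edge_nb: "{u, v} \<in> edges G \<Longrightarrow> u \<noteq> v \<and> u < n \<and> v < n"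
  using simple verts by (auto simp: simple_graph_def card_insert_if split: if_splits)

lemma nb_props: "v \<in> set (nb u) \<Longrightarrow> u \<noteq> v \<and> u < n \<and> v < n"
  using edge_nb by (auto simp: set_nb)

lemma distinct_nbrs:
  "distinct (map (\<lambda>(u, v). {u, v}) fs) \<Longrightarrow> (\<forall>(a, b) \<in> set fs. a \<noteq> b) \<Longrightarrow> distinct (nbrs fs u)"
proof (induction fs rule: rev_induct)
  case (snoc e fs)
  obtain a b where e: "e = (a, b)" by force
  have *: "v \<in> set (nbrs fs u) \<Longrightarrow> {u, v} \<in> (\<lambda>(u, v). {u, v}) ` set fs" for v
    by (auto simp: nbrs_def insert_commute split: if_splits; force simp: insert_commute)
  from snoc.prems have "{a, b} \<notin> (\<lambda>(u, v). {u, v}) ` set fs" "a \<noteq> b" by (auto simp: e)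
  with snoc * show ?case by (auto simp: e insert_commute)
qed simp

lemma distinct_nb: "distinct (nb u)"
  using es edge_props by (intro distinct_nbrs) (auto simp: edge_list_def)

lemma sum_dg: "(\<Sum>u<n. dg u) = 2 * m"
proof -
  have "(\<forall>(a, b) \<in> set fs. a < n \<and> b < n) \<Longrightarrow> (\<Sum>u<n. length (nbrs fs u)) = 2 * length fs" for fs
  proof (induction fs rule: rev_induct)
    case (snoc e fs)
    obtain a b where e: "e = (a, b)" by force
    have "(\<Sum>u<n. length (nbrs (fs @ [e]) u)) =
      (\<Sum>u<n. length (nbrs fs u)) + (\<Sum>u<n. if u = a then 1 else 0) + (\<Sum>u<n. if u = b then 1 else 0)"
      unfolding sum.distrib[symmetric] by (rule sum.cong) (auto simp: e)
    then show ?case using snoc by (simp add: e)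
  qed simp
  then show ?thesis using edge_props length_es by fastforce
qed

lemma degree_delete:
  assumes "u < n" "u \<notin> Y"
  shows "degree (delete_verts G Y) u = card {v \<in> set (nb u). v \<notin> Y}"
proof -
  have "bij_betw (\<lambda>v. {u, v}) {v \<in> set (nb u). v \<notin> Y} {e \<in> edges (delete_verts G Y). u \<in> e}"
  proof (rule bij_betwI')
    fix x y show "({u, x} = {u, y}) = (x = y)" by (auto simp: doubleton_eq_iff)
  next
    fix v assume "v \<in> {v \<in> set (nb u). v \<notin> Y}"
    then show "{u, v} \<in> {e \<in> edges (delete_verts G Y). u \<in> e}"
      using assms nb_props[of v u] by (auto simp: delete_verts_def set_nb verts)
  next
    fix e assume e: "e \<in> {e \<in> edges (delete_verts G Y). u \<in> e}"
    then have "card e = 2" "u \<in> e" "e \<in> edges G" "e \<inter> Y = {}"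
      using simple by (auto simp: delete_verts_def simple_graph_def)
    moreover from \<open>card e = 2\<close> obtain a b where "e = {a, b}" by (meson card_2_iff)
    ultimately obtain v where "e = {u, v}" "v \<notin> Y" by (auto simp: insert_commute)
    then show "\<exists>v\<in>{v \<in> set (nb u). v \<notin> Y}. e = {u, v}" using \<open>e \<in> edges G\<close> by (auto simp: set_nb)
  qed
  then show ?thesis by (auto simp: degree_def dest: bij_betw_same_card)
qed

lemma removable_iff:
  "removable k G Z \<longleftrightarrow> Z \<noteq> {} \<and> Z \<subseteq> {..<n} \<and>
     (\<forall>u<n. u \<notin> Z \<longrightarrow> k \<le> int (card {v \<in> set (nb u). v \<notin> Z}))"
proof -
  have v: "verts (delete_verts G Z) = {..<n} - Z" by (auto simp: delete_verts_def verts)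
  \<comment> \<open>\<open>Min\<close> is meaningful only if a vertex is left; otherwise the null
    graph is a core and the right-hand side is vacuous.\<close>
  have "k_core k (delete_verts G Z) \<longleftrightarrow> (\<forall>u<n. u \<notin> Z \<longrightarrow> k \<le> int (degree (delete_verts G Z) u))"
  proof (cases "{..<n} - Z = {}")
    case False
    let ?D = "degree (delete_verts G Z) ` ({..<n} - Z)"
    have f: "finite ?D" "?D \<noteq> {}" using False by auto
    have "k \<le> int (Min ?D) \<longleftrightarrow> (\<forall>d \<in> ?D. k \<le> int d)"
    proof
      assume "k \<le> int (Min ?D)"
      then show "\<forall>d \<in> ?D. k \<le> int d"
        using Min_le[OF f(1)] by (meson of_nat_le_iff order_trans)
    next
      assume "\<forall>d \<in> ?D. k \<le> int d"
      then show "k \<le> int (Min ?D)" using Min_in[OF f] by blast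
    qed
    with False show ?thesis unfolding k_core_def min_degree_def v by auto
  qed (auto simp: k_core_def v)
  then show ?thesis using degree_delete by (auto simp: removable_def verts lessThan_atLeast0)
qed

lemma k_le_dg: "u < n \<Longrightarrow> k \<le> int (dg u)"
proof -
  assume u: "u < n"
  have "{e \<in> edges G. e \<subseteq> verts G} = edges G" using simple by (auto simp: simple_graph_def)
  then have "delete_verts G {} = G" by (simp add: delete_verts_def)
  then have d: "degree G u = dg u"
    using degree_delete[of u "{}"] u distinct_card[OF distinct_nb[of u]] by simp
  from u have "Min (degree G ` {0..<n}) \<le> degree G u" by (intro Min_le) auto
  with core u d show ?thesis by (auto simp: k_core_def verts min_degree_def)
qed

text \<open>Unions of vertex sets inducing k-cores induce k-cores, so there is a smallest removable
  set containing \<open>v\<close>; the relation says that \<open>u\<close> lies in it.\<close>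

definition reach :: "nat \<Rightarrow> nat \<Rightarrow> bool" where
  "reach v u \<longleftrightarrow> (\<forall>Z. removable k G Z \<and> v \<in> Z \<longrightarrow> u \<in> Z)"

lemma reach_refl [simp]: "reach v v"
  by (simp add: reach_def)

lemma reach_trans: "reach a b \<Longrightarrow> reach b c \<Longrightarrow> reach a c"
  by (auto simp: reach_def)

text \<open>A removable set containing \<open>v\<close> contains \<open>C\<close>; if it missed
  \<open>u\<close>, then \<open>u\<close> would keep at most \<open>dg u - card C < k\<close>
  neighbours.\<close>

lemma reach_infected:
  assumes "\<forall>c\<in>C. reach v c" "C \<subseteq> set (nb u)" "int (dg u) - k < int (card C)" "u < n"
  shows "reach v u"
  unfolding reach_def
proof (intro allI impI)
  fix Z assume Z: "removable k G Z \<and> v \<in> Z"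
  show "u \<in> Z"
  proof (rule ccontr)
    assume "u \<notin> Z"
    with Z assms(4) have "k \<le> int (card {v \<in> set (nb u). v \<notin> Z})" by (auto simp: removable_iff)
    also have "card {v \<in> set (nb u). v \<notin> Z} \<le> card (set (nb u) - C)"
      using Z assms(1) by (intro card_mono) (auto simp: reach_def)
    also have "card (set (nb u) - C) = dg u - card C"
      using assms(2) by (simp add: card_Diff_subset finite_subset distinct_card distinct_nb)
    finally show False using assms(3) card_mono[OF _ assms(2)] distinct_card[OF distinct_nb[of u]]
      by simp
  qed
qed

text \<open>The last premise says that no outside vertex is forced by \<open>C\<close>, which makes
  \<open>C\<close> removable. A removable subset contains some \<open>v\<close> of \<open>C\<close>,
  hence everything that \<open>v\<close> reaches, which is all of \<open>C\<close>.\<close>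

lemma MinRS_I:
  assumes "C \<noteq> {}" "C \<subseteq> {..<n}" "\<forall>v\<in>C. \<forall>u\<in>C. reach v u"
    and "\<And>u. u < n \<Longrightarrow> u \<notin> C \<Longrightarrow> int (card (set (nb u) \<inter> C)) \<le> int (dg u) - k"
  shows "C \<in> MinRSs k G"
proof -
  have "removable k G C"
    unfolding removable_iff
  proof (intro conjI allI impI assms(1,2))
    fix u assume u: "u < n" "u \<notin> C"
    have "{v \<in> set (nb u). v \<notin> C} = set (nb u) - (set (nb u) \<inter> C)" by auto
    then have "card {v \<in> set (nb u). v \<notin> C} = dg u - card (set (nb u) \<inter> C)"
      by (simp add: card_Diff_subset distinct_card distinct_nb)
    moreover have "card (set (nb u) \<inter> C) \<le> dg u"
      using card_mono[of "set (nb u)" "set (nb u) \<inter> C"] by (simp add: distinct_card distinct_nb)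
    ultimately show "k \<le> int (card {v \<in> set (nb u). v \<notin> C})" using assms(4)[OF u] by simp
  qed
  moreover have "Z = C" if "removable k G Z" "Z \<subseteq> C" for Z
  proof
    from that(1) have "Z \<noteq> {}" by (simp add: removable_def)
    then obtain v where "v \<in> Z" by blast
    then have "reach v u" if "u \<in> C" for u using that assms(3) \<open>Z \<subseteq> C\<close> by blast
    then show "C \<subseteq> Z" using \<open>v \<in> Z\<close> that(1) unfolding reach_def by blast
  qed (fact that(2))
  ultimately show ?thesis by (auto simp: MinRSs_def)
qed

text \<open>Completeness of the output reduces to every vertex reaching some output set: a MinRS
  through \<open>v\<close> includes the set reached from \<open>v\<close> and equals it by
  minimality.\<close>

lemma MinRSs_eqI:
  assumes "\<Y> \<subseteq> MinRSs k G" "\<And>v. v < n \<Longrightarrow> \<exists>Y\<in>\<Y>. \<forall>y\<in>Y. reach v y"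
  shows "MinRSs k G = \<Y>"
proof
  show "MinRSs k G \<subseteq> \<Y>"
  proof
    fix Z assume Z: "Z \<in> MinRSs k G"
    then obtain v where v: "v \<in> Z" "v < n" by (auto simp: MinRSs_def removable_iff)
    with assms(2) obtain Y where Y: "Y \<in> \<Y>" "\<forall>y\<in>Y. reach v y" by blast
    then have "Y \<subseteq> Z" using Z v by (auto simp: MinRSs_def reach_def)
    then show "Z \<in> \<Y>" using Y assms(1) Z by (auto simp: MinRSs_def)
  qed
qed (fact assms(1))

lemma MinRSs_nonempty: "Y \<in> MinRSs k G \<Longrightarrow> Y \<noteq> {} \<and> Y \<subseteq> {..<n}"
  by (auto simp: MinRSs_def removable_iff)

text \<open>
  The nodes of the linked list are the vertices \<open>0..<n\<close> and, from \<open>n\<close> on, the half-edges grouped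
  by source; a half-edge node stands for an entry of its target.
\<close>

definition targets :: "nat list" where "targets = [0..<n] @ concat (map nb [0..<n])"
definition target :: "nat \<Rightarrow> nat" where "target x = targets ! x"
definition offset :: "nat \<Rightarrow> nat" where "offset u = n + (\<Sum>v<u. dg v)"

lemma offset_Suc [simp]: "offset (Suc u) = offset u + dg u"
  by (simp add: offset_def)

lemma offset_0 [simp]: "offset 0 = n"
  by (simp add: offset_def)

lemma offset_n: "offset n = n + 2 * m"
  by (simp add: offset_def sum_dg)

lemma offset_mono: "u \<le> v \<Longrightarrow> offset u \<le> offset v"
  unfolding offset_def by (intro add_left_mono sum_mono2) auto

lemma offset_le: "u < n \<Longrightarrow> offset u + dg u \<le> n + 2 * m"
  using offset_mono[of "Suc u" n] by (simp add: offset_n)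

lemma offset_ge: "n \<le> offset u"
  by (simp add: offset_def)

lemma offset_inj: "offset u + i = offset v + j \<Longrightarrow> i < dg u \<Longrightarrow> j < dg v \<Longrightarrow> u = v \<and> i = j"
  using offset_mono[of "Suc u" v] offset_mono[of "Suc v" u] by (cases u v rule: linorder_cases) auto

lemma length_concat_nb: "length (concat (map nb [0..<u])) = (\<Sum>v<u. dg v)"
  by (induction u) auto

lemma target_vertex [simp]: "u < n \<Longrightarrow> target u = u"
  by (simp add: target_def targets_def nth_append)

lemma target_edge: "u < n \<Longrightarrow> j < dg u \<Longrightarrow> target (offset u + j) = nb u ! j"
proof -
  assume u: "u < n" "j < dg u"
  have "[0..<n] = [0..<u] @ u # [Suc u..<n]" using u upt_add_eq_append[of 0 u "n - u"] by (simp add: upt_conv_Cons)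
  then have "targets = [0..<n] @ concat (map nb [0..<u]) @ nb u @ concat (map nb [Suc u..<n])"
    by (simp add: targets_def)
  then show ?thesis using u by (simp add: target_def offset_def nth_append length_concat_nb)
qed

lemma length_targets: "length targets = n + 2 * m"
  by (simp add: targets_def length_concat_nb sum_dg)

lemma target_less: "x < n + 2 * m \<Longrightarrow> target x < n"
proof -
  assume "x < n + 2 * m"
  then have "target x \<in> set targets" by (simp add: target_def length_targets)
  then show ?thesis using nb_props by (auto simp: targets_def)
qed

end

section \<open>Invariants of the search\<close>

text \<open>If \<open>d\<close> does not occur, this is all of \<open>set xs\<close>;
  \<open>sep_inv\<close> excludes that case for base vertices.\<close>

definition before :: "'a list \<Rightarrow> 'a \<Rightarrow> 'a set" where
  "before xs d = set (takeWhile (\<lambda>y. y \<noteq> d) xs)"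

lemma before_Cons: "before (x # xs) d = (if x = d then {} else insert x (before xs d))"
  by (cases "x = d") (auto simp add: before_def)

lemma before_Nil: "before [] d = {}"
  by (simp add: before_def)

lemma before_subset: "before xs d \<subseteq> set xs"
  by (auto simp: before_def dest: set_takeWhileD)

lemma before_append: "before (xs @ ys) d = (if d \<in> set xs then before xs d else set xs \<union> before ys d)"
  by (induction xs) (auto simp: before_Cons before_Nil)

text \<open>A node spliced in directly behind \<open>y\<close> precedes \<open>d\<close> exactly
  when \<open>y\<close> does; for \<open>d = y\<close> neither does.\<close>

lemma before_insert:
  assumes "distinct (as @ y # bs)" "d \<in> set (as @ y # bs)" "z \<noteq> d"
  shows "before (as @ y # z # bs) d =
    (if y \<in> before (as @ y # bs) d then insert z (before (as @ y # bs) d) else before (as @ y # bs) d)"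
  using assms before_subset[of as d] before_subset[of bs d]
  by (auto simp: before_append before_Cons)

context core_graph
begin

text \<open>
  In the following invariants, \<open>ss\<close> is the stack (bottom first), \<open>bs\<close> the list of cluster bases
  (positions in \<open>ss\<close>), \<open>xs\<close> the linked list of entries, \<open>D\<close> the set of discarded vertices and
  \<open>Q u\<close> the recorded positions of the neighbours of \<open>u\<close>. The premise \<open>\<forall>b\<in>set bs. b \<le> i \<longrightarrow> b \<le> j\<close>
  says that position \<open>j\<close> is in the cluster of position \<open>i\<close> or in a higher one, and
  \<open>x \<in> before xs (ss ! b)\<close> that entry \<open>x\<close> is filed under the cluster with base \<open>b\<close> or a higher one.
  Dropping a base in a merge only relaxes these conditions: this trivially preserves
  \<open>cover_inv\<close>, whereas \<open>stack_inv\<close> and \<open>sound_inv\<close> then claim more, which is where the reason for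
  the merge is used.
\<close>

definition slack :: "nat \<Rightarrow> nat" where "slack u = nat (int (dg u) - k)"

definition stack_inv :: "nat list \<Rightarrow> nat list \<Rightarrow> nat set \<Rightarrow> bool" where
  "stack_inv ss bs D \<longleftrightarrow> distinct ss \<and> set ss \<union> D \<subseteq> {..<n} \<and> set ss \<inter> D = {} \<and>
     sorted_wrt (<) bs \<and> (\<forall>b\<in>set bs. b < length ss) \<and> (ss \<noteq> [] \<longrightarrow> bs \<noteq> [] \<and> hd bs = 0) \<and>
     (\<forall>i<length ss. \<forall>j<length ss. (\<forall>b\<in>set bs. b \<le> i \<longrightarrow> b \<le> j) \<longrightarrow> reach (ss ! i) (ss ! j))"

definition sep_inv :: "nat list \<Rightarrow> nat list \<Rightarrow> nat list \<Rightarrow> bool" where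
  "sep_inv ss bs xs \<longleftrightarrow> distinct xs \<and> (\<forall>b\<in>set bs. ss ! b \<in> set xs) \<and>
     (\<forall>b\<in>set bs. \<forall>b'\<in>set bs. b < b' \<longrightarrow> ss ! b' \<in> before xs (ss ! b))"

definition sound_inv :: "nat list \<Rightarrow> nat list \<Rightarrow> nat list \<Rightarrow> bool" where
  "sound_inv ss bs xs \<longleftrightarrow> (\<forall>x\<in>set xs. \<forall>i<length ss.
     (\<forall>b\<in>set bs. b \<le> i \<longrightarrow> x \<in> before xs (ss ! b)) \<longrightarrow> reach (ss ! i) (target x))"

text \<open>As \<open>Q u\<close> is ascending, the index \<open>length (Q u) - 1 - slack u\<close>
  selects its (slack + 1)-th largest element. The set \<open>E\<close> exempts a vertex whose entry
  has just been taken out but which is not yet dealt with.\<close>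

definition cover_inv :: "nat list \<Rightarrow> nat list \<Rightarrow> nat list \<Rightarrow> (nat \<Rightarrow> nat list) \<Rightarrow> nat set \<Rightarrow> bool" where
  "cover_inv ss bs xs Q E \<longleftrightarrow> (\<forall>u<n. u \<notin> E \<longrightarrow> slack u < length (Q u) \<longrightarrow>
     (\<forall>b\<in>set bs. b \<le> Q u ! (length (Q u) - 1 - slack u) \<longrightarrow>
        u \<in> set (drop b ss) \<or> (\<exists>x\<in>before xs (ss ! b). target x = u)))"

text \<open>Weaker than equality with \<open>queue ss\<close>, since it must also hold while the
  neighbours of a freshly pushed vertex are being informed one at a time.\<close>

definition queue_inv :: "nat list \<Rightarrow> (nat \<Rightarrow> nat list) \<Rightarrow> bool" where
  "queue_inv ss Q \<longleftrightarrow> (\<forall>u<n. sorted_wrt (<) (Q u) \<and>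
     (\<forall>p\<in>set (Q u). p < length ss \<and> ss ! p \<in> set (nb u)))"

definition queue :: "nat list \<Rightarrow> nat \<Rightarrow> nat list" where
  "queue ss u = filter (\<lambda>p. ss ! p \<in> set (nb u)) [0..<length ss]"

lemma queue_Nil [simp]: "queue [] u = []"
  by (simp add: queue_def)

lemma queue_snoc: "queue (ss @ [v]) u = queue ss u @ (if v \<in> set (nb u) then [length ss] else [])"
  by (auto simp: queue_def nth_append intro!: filter_cong)

lemma queue_inv_queue: "queue_inv ss (queue ss)"
  by (auto simp: queue_inv_def queue_def intro!: sorted_wrt_filter)

lemma last_greatest: "sorted_wrt (<) bs \<Longrightarrow> b \<in> set bs \<Longrightarrow> b \<le> (last bs :: nat)"
  by (induction bs) (auto simp: less_imp_le)

lemma stack_inv_last_reach: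
  assumes "stack_inv ss bs D" "i < length ss" "last bs \<le> j" "j < length ss"
  shows "reach (ss ! i) (ss ! j)"
  using assms last_greatest[of bs] unfolding stack_inv_def by (meson le_trans)

text \<open>The base vertex of the top cluster precedes all other base vertices in the list. If the
  head is not that vertex, it is no base vertex at all and precedes all of them, so it is filed
  under the top cluster and \<open>sound_inv\<close> applies to every stack position. Only its own
  target can lose its cover.\<close>

lemma pop_entry:
  assumes "stack_inv ss bs D" "ss \<noteq> []" "sep_inv ss bs (x # xs)" "sound_inv ss bs (x # xs)"
    and "cover_inv ss bs (x # xs) Q {}" "x \<noteq> ss ! last bs"
  shows "sep_inv ss bs xs" "sound_inv ss bs xs" "cover_inv ss bs xs Q {target x}"
    and "\<And>i. i < length ss \<Longrightarrow> reach (ss ! i) (target x)"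
proof -
  have bs: "bs \<noteq> []" using assms(1,2) by (auto simp: stack_inv_def)
  have x: "x \<noteq> ss ! b" if b: "b \<in> set bs" for b
  proof
    assume eq: "x = ss ! b"
    then have "b \<noteq> last bs" using assms(6) by auto
    then have "b < last bs" using last_greatest[of bs b] assms(1) b by (auto simp: stack_inv_def)
    then have "ss ! last bs \<in> before (x # xs) (ss ! b)"
      using assms(3) b bs by (auto simp: sep_inv_def)
    then show False using eq by (simp add: before_Cons)
  qed
  have bf: "before (x # xs) (ss ! b) = insert x (before xs (ss ! b))" if "b \<in> set bs" for b
    using x[OF that] by (simp add: before_Cons)
  have nx: "x \<notin> set xs" "distinct xs" using assms(3) by (auto simp: sep_inv_def)
  show "sep_inv ss bs xs"
    unfolding sep_inv_def
  proof (intro conjI ballI impI nx(2))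
    fix b assume "b \<in> set bs"
    then show "ss ! b \<in> set xs" using assms(3) x by (force simp: sep_inv_def)
  next
    fix b b' assume b: "b \<in> set bs" "b' \<in> set bs" "b < b'"
    then have "ss ! b' \<in> before (x # xs) (ss ! b)" using assms(3) by (auto simp: sep_inv_def)
    then show "ss ! b' \<in> before xs (ss ! b)" using bf[OF b(1)] x[OF b(2)] by auto
  qed
  show "sound_inv ss bs xs"
    unfolding sound_inv_def
  proof (intro ballI allI impI)
    fix y i assume y: "y \<in> set xs" "i < length ss" "\<forall>b\<in>set bs. b \<le> i \<longrightarrow> y \<in> before xs (ss ! b)"
    then have "\<forall>b\<in>set bs. b \<le> i \<longrightarrow> y \<in> before (x # xs) (ss ! b)" using bf by auto
    with y(1,2) show "reach (ss ! i) (target y)" using assms(4) by (simp add: sound_inv_def)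
  qed
  show "cover_inv ss bs xs Q {target x}"
    unfolding cover_inv_def
  proof (intro allI ballI impI)
    fix u b assume *: "u < n" "u \<notin> {target x}" "slack u < length (Q u)" "b \<in> set bs"
      "b \<le> Q u ! (length (Q u) - 1 - slack u)"
    then have "u \<in> set (drop b ss) \<or> (\<exists>y\<in>before (x # xs) (ss ! b). target y = u)"
      using assms(5) by (simp add: cover_inv_def)
    then show "u \<in> set (drop b ss) \<or> (\<exists>y\<in>before xs (ss ! b). target y = u)"
      using bf[OF *(4)] *(2) by auto
  qed
  show "reach (ss ! i) (target x)" if "i < length ss" for i
    using assms(4) that bf by (simp add: sound_inv_def)
qed

text \<open>The bases at or below \<open>p\<close> survive the removal of the last one. Hence what
  the shorter base list claims for a position in the old top cluster was already true for
  \<open>p\<close>, and that position reaches \<open>ss ! p\<close>.\<close>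

lemma merge_top:
  assumes "stack_inv ss bs D" "sep_inv ss bs xs" "sound_inv ss bs xs" "cover_inv ss bs xs Q E"
    and p: "p < last bs" "p < length ss" "\<And>i. i < length ss \<Longrightarrow> reach (ss ! i) (ss ! p)"
  shows "stack_inv ss (butlast bs) D" "sep_inv ss (butlast bs) xs" "sound_inv ss (butlast bs) xs"
    "cover_inv ss (butlast bs) xs Q E" "butlast bs \<noteq> []"
proof -
  have bs: "bs \<noteq> []" "hd bs = 0" "sorted_wrt (<) bs" using assms(1) p(2) by (auto simp: stack_inv_def)
  obtain cs where cs: "bs = cs @ [last bs]" using bs(1) by (metis append_butlast_last_id)
  have cs_eq: "butlast bs = cs" by (metis butlast_snoc cs)
  have "cs \<noteq> []" using cs bs(2) p(1) by (metis append_Nil gr_implies_not0 list.sel(1))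
  then have hd: "hd cs = 0" using cs bs(2) by (metis hd_append2)
  show "butlast bs \<noteq> []" using \<open>cs \<noteq> []\<close> cs_eq by simp
  have mem: "b \<in> set bs \<longleftrightarrow> b \<in> set cs \<or> b = last bs" for b by (subst cs) auto
  have srt: "sorted_wrt (<) cs" using bs(3) by (subst (asm) cs) (simp add: sorted_wrt_append)
  have via: "\<forall>b\<in>set bs. b \<le> p \<longrightarrow> P b" if "\<forall>b\<in>set cs. b \<le> i \<longrightarrow> P b" "last bs \<le> i" for P i
    using that p(1) mem by auto
  show "stack_inv ss (butlast bs) D"
    unfolding stack_inv_def cs_eq
  proof (intro conjI allI impI)
    fix i j assume ij: "i < length ss" "j < length ss" "\<forall>b\<in>set cs. b \<le> i \<longrightarrow> b \<le> j"
    show "reach (ss ! i) (ss ! j)"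
    proof (cases "last bs \<le> i")
      case True
      then have "reach (ss ! p) (ss ! j)"
        using assms(1) via[OF ij(3)] p(2) ij(2) by (simp add: stack_inv_def)
      then show ?thesis using reach_trans p(3) ij(1) by blast
    next
      case False
      then have "\<forall>b\<in>set bs. b \<le> i \<longrightarrow> b \<le> j" using ij(3) mem by auto
      then show ?thesis using assms(1) ij by (simp add: stack_inv_def)
    qed
  qed (use assms(1) mem srt hd \<open>cs \<noteq> []\<close> in \<open>auto simp: stack_inv_def\<close>)
  show "sep_inv ss (butlast bs) xs" using assms(2) mem by (simp add: sep_inv_def cs_eq)
  show "cover_inv ss (butlast bs) xs Q E" using assms(4) mem by (simp add: cover_inv_def cs_eq)
  show "sound_inv ss (butlast bs) xs"
    unfolding sound_inv_def cs_eq
  proof (intro ballI allI impI)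
    fix x i assume x: "x \<in> set xs" "i < length ss" "\<forall>b\<in>set cs. b \<le> i \<longrightarrow> x \<in> before xs (ss ! b)"
    show "reach (ss ! i) (target x)"
    proof (cases "last bs \<le> i")
      case True
      then have "reach (ss ! p) (target x)"
        using assms(3) via[OF x(3)] p(2) x(1) by (simp add: sound_inv_def)
      then show ?thesis using reach_trans p(3) x(2) by blast
    next
      case False
      then have "\<forall>b\<in>set bs. b \<le> i \<longrightarrow> x \<in> before xs (ss ! b)" using x(3) mem by auto
      then show ?thesis using assms(3) x by (simp add: sound_inv_def)
    qed
  qed
qed

text \<open>A vertex inside the top cluster lies at or above every base, so its exemption can be
  lifted.\<close>

lemma cover_inv_on_stack:
  assumes "cover_inv ss bs xs Q {ss ! p}" "last bs \<le> p" "p < length ss" "sorted_wrt (<) bs"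
  shows "cover_inv ss bs xs Q {}"
proof -
  have "ss ! p \<in> set (drop b ss)" if "b \<in> set bs" for b
  proof -
    have "b \<le> p" using last_greatest[OF assms(4) that] assms(2) by simp
    then show ?thesis using assms(3) by (auto simp: in_set_conv_nth intro!: exI[of _ "p - b"])
  qed
  then show ?thesis using assms(1) unfolding cover_inv_def by blast
qed

text \<open>The new vertex is put at the head of the list, where it closes the still empty section
  of its own cluster; all older entries remain filed where they were.\<close>

lemma push_vertex:
  assumes st: "stack_inv ss bs D" and "sep_inv ss bs xs" "sound_inv ss bs xs"
    and cov: "cover_inv ss bs xs Q {v}" and q: "queue_inv ss Q"
    and v: "v < n" "v \<notin> D" "v \<notin> set ss" "v \<notin> set xs"
    and r: "\<And>i. i < length ss \<Longrightarrow> reach (ss ! i) v"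
  shows "stack_inv (ss @ [v]) (bs @ [length ss]) D" "sep_inv (ss @ [v]) (bs @ [length ss]) (v # xs)"
    "sound_inv (ss @ [v]) (bs @ [length ss]) (v # xs)"
    "cover_inv (ss @ [v]) (bs @ [length ss]) (v # xs) Q {}" "queue_inv (ss @ [v]) Q"
proof -
  have bl: "b < length ss" if "b \<in> set bs" for b using st that by (auto simp: stack_inv_def)
  have nb: "(ss @ [v]) ! b = ss ! b" if "b \<in> set bs" for b using bl[OF that] by (simp add: nth_append)
  have vb: "ss ! b \<noteq> v" if "b \<in> set bs" for b using bl[OF that] v(3) by (metis nth_mem)
  have bf: "before (v # xs) ((ss @ [v]) ! b) = insert v (before xs (ss ! b))" if "b \<in> set bs" for b
    using nb[OF that] vb[OF that] by (auto simp: before_Cons)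
  have bv: "before (v # xs) v = {}" by (simp add: before_Cons)
  show "stack_inv (ss @ [v]) (bs @ [length ss]) D"
    unfolding stack_inv_def
  proof (intro conjI allI impI)
    fix i j assume ij: "i < length (ss @ [v])" "j < length (ss @ [v])"
      "\<forall>b\<in>set (bs @ [length ss]). b \<le> i \<longrightarrow> b \<le> j"
    show "reach ((ss @ [v]) ! i) ((ss @ [v]) ! j)"
    proof (cases "i < length ss")
      case True
      show ?thesis
      proof (cases "j < length ss")
        case j: True
        with True ij st show ?thesis by (simp add: stack_inv_def nth_append)
      next
        case False
        with ij True r show ?thesis by (simp add: nth_append)
      qed
    next
      case False
      with ij show ?thesis by (auto simp: nth_append)
    qed
  next
    show "hd (bs @ [length ss]) = 0" using st by (cases "ss = []"; cases bs) (auto simp: stack_inv_def)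
  qed (use st v bl in \<open>auto simp: stack_inv_def sorted_wrt_append less_Suc_eq\<close>)
  show "sep_inv (ss @ [v]) (bs @ [length ss]) (v # xs)"
    using assms(2) v(4) bl bf nb by (auto simp: sep_inv_def dest: less_asym)
  show "sound_inv (ss @ [v]) (bs @ [length ss]) (v # xs)"
    unfolding sound_inv_def
  proof (intro ballI allI impI)
    fix x i assume x: "x \<in> set (v # xs)" "i < length (ss @ [v])"
      "\<forall>b\<in>set (bs @ [length ss]). b \<le> i \<longrightarrow> x \<in> before (v # xs) ((ss @ [v]) ! b)"
    then have i: "i < length ss" by (auto simp: bv less_Suc_eq)
    show "reach ((ss @ [v]) ! i) (target x)"
    proof (cases "x = v")
      case True
      then show ?thesis using r i v(1) by (simp add: nth_append)
    next
      case False
      with x bf have "x \<in> set xs" "\<forall>b\<in>set bs. b \<le> i \<longrightarrow> x \<in> before xs (ss ! b)" by auto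
      with assms(3) i show ?thesis by (simp add: sound_inv_def nth_append)
    qed
  qed
  show "queue_inv (ss @ [v]) Q"
    using q by (force simp: queue_inv_def nth_append)
  show "cover_inv (ss @ [v]) (bs @ [length ss]) (v # xs) Q {}"
    unfolding cover_inv_def
  proof (intro allI ballI impI)
    fix u b assume *: "u < n" "u \<notin> {}" "slack u < length (Q u)" "b \<in> set (bs @ [length ss])"
      "b \<le> Q u ! (length (Q u) - 1 - slack u)"
    \<comment> \<open>Every recorded position is below the new base \<open>length ss\<close>, so the
      new cluster brings no obligation.\<close>
    have "Q u ! (length (Q u) - 1 - slack u) \<in> set (Q u)" using *(3) by (intro nth_mem) auto
    with q *(1) have "Q u ! (length (Q u) - 1 - slack u) < length ss" by (auto simp: queue_inv_def)
    with *(5) have "b < length ss" by simp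
    with *(4) have b: "b \<in> set bs" by auto
    show "u \<in> set (drop b (ss @ [v])) \<or> (\<exists>x\<in>before (v # xs) ((ss @ [v]) ! b). target x = u)"
    proof (cases "u = v")
      case True
      then show ?thesis using \<open>b < length ss\<close> by auto
    next
      case False
      with cov * b have "u \<in> set (drop b ss) \<or> (\<exists>x\<in>before xs (ss ! b). target x = u)"
        by (simp add: cover_inv_def)
      then show ?thesis using bf[OF b] \<open>b < length ss\<close> by auto
    qed
  qed
qed

section \<open>Recording a position and filing an entry\<close>

lemma sorted_wrt_nth_mono: "sorted_wrt (<) (q :: nat list) \<Longrightarrow> i \<le> j \<Longrightarrow> j < length q \<Longrightarrow> q ! i \<le> q ! j"
  by (cases "i = j") (auto simp: sorted_wrt_iff_nth_less less_imp_le)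

lemma queue_inv_upd:
  assumes "queue_inv ss Q" "\<forall>p\<in>set (Q u). p < s" "s < length ss" "ss ! s \<in> set (nb u)"
  shows "queue_inv ss (Q(u := Q u @ [s]))"
  using assms by (auto simp: queue_inv_def sorted_wrt_append)

lemma cover_inv_short:
  assumes "cover_inv ss bs xs Q E" "length q \<le> slack u"
  shows "cover_inv ss bs xs (Q(u := q)) E"
  using assms by (auto simp: cover_inv_def)

text \<open>The assumption on \<open>before\<close> is all that the rest needs to know about the
  splice: \<open>z\<close> is filed under the cluster of \<open>p\<close>. A position whose bases
  are all at most \<open>p\<close> reaches the \<open>slack u + 1\<close> recorded neighbours at or
  above \<open>p\<close>, and these force \<open>u\<close>.\<close>

lemma insert_entry:
  assumes st: "stack_inv ss bs D" and sep: "sep_inv ss bs xs" and snd: "sound_inv ss bs xs"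
    and cov: "cover_inv ss bs xs Q E" and qi: "queue_inv ss (Q(u := q))"
    and u: "u < n" "slack u < length q" "target z = u" "z \<notin> set xs"
    and p: "p = q ! (length q - 1 - slack u)"
    and xs': "distinct xs'" "set xs' = insert z (set xs)"
    and bf: "\<And>b. b \<in> set bs \<Longrightarrow>
      before xs' (ss ! b) = (if b \<le> p then insert z (before xs (ss ! b)) else before xs (ss ! b))"
  shows "sep_inv ss bs xs'" "sound_inv ss bs xs'" "cover_inv ss bs xs' (Q(u := q)) E"
proof -
  show "sep_inv ss bs xs'" using sep xs' bf by (simp add: sep_inv_def)
  show "cover_inv ss bs xs' (Q(u := q)) E"
    using cov bf u(3) p by (auto simp: cover_inv_def)
  show "sound_inv ss bs xs'"
    unfolding sound_inv_def
  proof (intro ballI allI impI)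
    fix x i assume x: "x \<in> set xs'" "i < length ss" "\<forall>b\<in>set bs. b \<le> i \<longrightarrow> x \<in> before xs' (ss ! b)"
    show "reach (ss ! i) (target x)"
    proof (cases "x = z")
      case False
      then have "\<forall>b\<in>set bs. b \<le> i \<longrightarrow> x \<in> before xs (ss ! b)" using x(3) bf by (auto split: if_splits)
      with x(1,2) False xs'(2) snd show ?thesis by (simp add: sound_inv_def)
    next
      case True
      have ip: "b \<le> p" if "b \<in> set bs" "b \<le> i" for b
        using x(3) that bf[OF that(1)] True u(4) before_subset[of xs "ss ! b"]
        by (auto split: if_splits)
      \<comment> \<open>Dropping \<open>?l\<close> elements leaves exactly the
        \<open>slack u + 1\<close> largest positions, one neighbour more than \<open>u\<close> can
        lose.\<close>
      let ?l = "length q - 1 - slack u"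
      let ?C = "(!) ss ` set (drop ?l q)"
      have q: "sorted_wrt (<) q" "\<forall>p\<in>set q. p < length ss \<and> ss ! p \<in> set (nb u)"
        using qi u(1) by (auto simp: queue_inv_def)
      have ge: "p \<le> j" if j: "j \<in> set (drop ?l q)" for j
      proof -
        from j obtain a where "a < length q - ?l" "j = q ! (?l + a)"
          by (auto simp: in_set_conv_nth)
        then show ?thesis using sorted_wrt_nth_mono[OF q(1), of ?l "?l + a"] by (simp add: p)
      qed
      have "reach (ss ! i) u"
      proof (rule reach_infected)
        show "\<forall>c\<in>?C. reach (ss ! i) c"
        proof
          fix c assume "c \<in> ?C"
          then obtain j where j: "j \<in> set (drop ?l q)" "c = ss ! j" by auto
          then have "j < length ss" using q(2) by (meson in_set_dropD)
          moreover have "\<forall>b\<in>set bs. b \<le> i \<longrightarrow> b \<le> j" using ip ge[OF j(1)] by (meson le_trans)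
          ultimately show "reach (ss ! i) c" using st x(2) j(2) by (simp add: stack_inv_def)
        qed
        show "?C \<subseteq> set (nb u)" using q(2) by (auto dest: in_set_dropD)
        have "inj_on ((!) ss) (set (drop ?l q))"
          using st q(2) by (intro inj_on_nth) (auto simp: stack_inv_def dest: in_set_dropD)
        then have "card ?C = card (set (drop ?l q))" by (rule card_image)
        also have "\<dots> = length (drop ?l q)"
          using q(1) by (intro distinct_card distinct_drop) (simp add: strict_sorted_iff)
        also have "\<dots> = slack u + 1" using u(2) by simp
        finally show "int (dg u) - k < int (card ?C)" by (simp add: slack_def)
      qed (fact u(1))
      then show ?thesis using True u(3) by simp
    qed
  qed
qed

text \<open>Nothing precedes the top base vertex at the head of the list. So by
  \<open>cover_inv\<close> the threshold position of a vertex outside the top cluster lies below the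
  base, and such a vertex has at most \<open>slack u\<close> neighbours in the cluster.\<close>

lemma closed_MinRS:
  assumes st: "stack_inv ss bs D" and ne: "ss \<noteq> []"
    and cov: "cover_inv ss bs (ss ! last bs # xs) (queue ss) {}"
  shows "set (drop (last bs) ss) \<in> MinRSs k G"
proof (rule MinRS_I)
  let ?b = "last bs"
  have bs: "?b \<in> set bs" "?b < length ss" using st ne by (auto simp: stack_inv_def)
  show "set (drop ?b ss) \<noteq> {}" using bs by simp
  show "set (drop ?b ss) \<subseteq> {..<n}" using st by (auto simp: stack_inv_def dest: in_set_dropD)
  show "\<forall>v\<in>set (drop ?b ss). \<forall>u\<in>set (drop ?b ss). reach v u"
  proof (intro ballI)
    fix v u assume "v \<in> set (drop ?b ss)" "u \<in> set (drop ?b ss)"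
    then obtain i j where "v = ss ! (?b + i)" "?b + i < length ss" "u = ss ! (?b + j)" "?b + j < length ss"
      by (auto simp: in_set_conv_nth less_diff_conv add.commute)
    then show "reach v u" using stack_inv_last_reach[OF st] by simp
  qed
  fix u assume u: "u < n" "u \<notin> set (drop ?b ss)"
  let ?Q = "queue ss u"
  have sub: "set (nb u) \<inter> set (drop ?b ss) \<subseteq> (!) ss ` {p \<in> set ?Q. ?b \<le> p}"
  proof
    fix v assume v: "v \<in> set (nb u) \<inter> set (drop ?b ss)"
    then have "v \<in> set (drop ?b ss)" by simp
    then obtain i where "v = ss ! (?b + i)" "?b + i < length ss"
      by (auto simp: in_set_conv_nth less_diff_conv add.commute)
    then show "v \<in> (!) ss ` {p \<in> set ?Q. ?b \<le> p}" using v by (auto simp: queue_def)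
  qed
  have srt: "sorted_wrt (<) ?Q" using queue_inv_queue[of ss] u by (auto simp: queue_inv_def)
  have "card {p \<in> set ?Q. ?b \<le> p} \<le> slack u"
  proof (cases "slack u < length ?Q")
    case False
    have "card {p \<in> set ?Q. ?b \<le> p} \<le> card (set ?Q)" by (intro card_mono) auto
    then show ?thesis using False card_length[of ?Q] by simp
  next
    case True
    let ?l = "length ?Q - 1 - slack u"
    have lt: "?Q ! ?l < ?b"
    proof (rule ccontr)
      assume "\<not> ?thesis"
      then have "?b \<le> ?Q ! ?l" by simp
      with cov True u bs have "\<exists>x\<in>before (ss ! ?b # xs) (ss ! ?b). target x = u"
        unfolding cover_inv_def by blast
      then show False by (simp add: before_Cons)
    qed
    \<comment> \<open>The queue is ascending and its entry at \<open>?l\<close> is below the base,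
      so only the last \<open>slack u\<close> entries can lie in the cluster.\<close>
    have "{p \<in> set ?Q. ?b \<le> p} \<subseteq> (!) ?Q ` {Suc ?l..<length ?Q}"
    proof
      fix p assume "p \<in> {p \<in> set ?Q. ?b \<le> p}"
      then obtain i where i: "i < length ?Q" "p = ?Q ! i" "?b \<le> ?Q ! i" by (auto simp: in_set_conv_nth)
      then have "\<not> i \<le> ?l" using sorted_wrt_nth_mono[OF srt, of i ?l] lt True by force
      then show "p \<in> (!) ?Q ` {Suc ?l..<length ?Q}" using i by auto
    qed
    then have "card {p \<in> set ?Q. ?b \<le> p} \<le> card {Suc ?l..<length ?Q}"
      by (rule surj_card_le[rotated]) simp
    then show ?thesis using True by simp
  qed
  moreover have "card (set (nb u) \<inter> set (drop ?b ss)) \<le> card {p \<in> set ?Q. ?b \<le> p}"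
    using sub by (rule surj_card_le[rotated]) simp
  ultimately show "int (card (set (nb u) \<inter> set (drop ?b ss))) \<le> int (dg u) - k"
    using k_le_dg[OF u(1)] by (simp add: slack_def)
qed

end

section \<open>Building the adjacency arrays\<close>

text \<open>
  Variables: 0 and 1 hold the constants one and zero, 2 holds \<open>k\<close>, 3 holds \<open>n\<close>, 4 the list header
  \<open>n + 2 * m\<close>, 5 the current start vertex, 6 the next output index, 7 the number of sets output,
  8 the stack height, 9 the number of clusters; the others are temporary.

  Arrays: 0 is the input, 1 the degrees, 2 and 3 the start and end of each vertex's block of
  half-edges, 4 the target of each list node, 5 the successor links of the list, 6 and 7
  the lengths and contents of the queues of recorded positions (with the offsets of array 2), 8 the
  stack position of each vertex (\<open>-1\<close> if new, \<open>n\<close> if discarded), 9 the stack, 10 the cluster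
  bases, 11 a table of \<open>j div 2\<close> (the machine cannot halve), and 12 the output.
\<close>

definition setup_consts :: cmd where
  "setup_consts = Con 0 1 ;; Con 1 0 ;; Ld 2 0 1 ;; Ld 3 0 0 ;; Ad 11 0 0 ;; Ld 10 0 11 ;;
     Ad 4 3 10 ;; Ad 4 4 10"

definition setup_degrees :: cmd where
  "setup_degrees = Con 11 0 ;; Con 12 3 ;; Whl 11 10 (Ld 13 0 12 ;; Ad 12 12 0 ;; Ld 14 0 12 ;;
     Ad 12 12 0 ;; Ld 15 1 13 ;; Ad 15 15 0 ;; St 1 13 15 ;; Ld 15 1 14 ;; Ad 15 15 0 ;;
     St 1 14 15 ;; Ad 11 11 0)"

definition setup_offsets :: cmd where
  "setup_offsets = Con 11 0 ;; Con 13 (-1) ;; Ad 12 3 1 ;; Whl 11 3 (St 2 11 12 ;; St 3 11 12 ;;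
     St 4 11 11 ;; St 8 11 13 ;; Ld 15 1 11 ;; Ad 12 12 15 ;; Ad 11 11 0)"

definition setup_adjacency :: cmd where
  "setup_adjacency = Con 11 0 ;; Con 12 3 ;; Whl 11 10 (Ld 13 0 12 ;; Ad 12 12 0 ;; Ld 14 0 12 ;;
     Ad 12 12 0 ;; Ld 15 3 13 ;; St 4 15 14 ;; Ad 15 15 0 ;; St 3 13 15 ;; Ld 15 3 14 ;;
     St 4 15 13 ;; Ad 15 15 0 ;; St 3 14 15 ;; Ad 11 11 0)"

definition setup_halves :: cmd where
  "setup_halves = Con 11 0 ;; Ad 12 0 0 ;; Whl 11 3 (Ld 15 11 11 ;; Ad 15 15 0 ;; St 11 12 15 ;;
     Ad 11 11 0 ;; Ad 12 12 0)"

definition setup_prog :: cmd where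
  "setup_prog = setup_consts ;; setup_degrees ;; setup_offsets ;; setup_adjacency ;; setup_halves"

definition same_except :: "'a set \<Rightarrow> ('a \<Rightarrow> 'b) \<Rightarrow> ('a \<Rightarrow> 'b) \<Rightarrow> bool" where
  "same_except X A B \<longleftrightarrow> (\<forall>a. a \<notin> X \<longrightarrow> B a = A a)"

lemma same_except_refl [simp]: "same_except X A A"
  by (simp add: same_except_def)

lemma same_except_upd [simp]: "a \<in> X \<Longrightarrow> same_except X A (B(a := f)) = same_except X A B"
  by (auto simp: same_except_def)

text \<open>One common length serves all arrays: the input takes \<open>3 + 2 * m\<close> cells, the
  list with its header \<open>n + 2 * m + 1\<close>, the table of halves \<open>n + 2\<close>, the
  output at most \<open>1 + 2 * n\<close>. The term \<open>\<bar>k\<bar>\<close> in the word bound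
  is there because the program subtracts \<open>k\<close> from degrees.\<close>

locale ram_graph = core_graph k G n m es + layout N BD w S
  for k G n m es N BD w S +
  assumes N_eq: "N = 2 * int n + 2 * int m + 4" and BD_k: "13 * N + \<bar>k\<bar> \<le> BD"
begin

lemma N_ge: "2 * int n + 2 * int m + 4 \<le> N"
  using N_eq by simp

lemma wdI: "- (13 * N) - \<bar>k\<bar> \<le> x \<Longrightarrow> x \<le> 13 * N + \<bar>k\<bar> \<Longrightarrow> wd x"
  using BD_k by (simp add: wd_def)

definition const_regs :: "vars \<Rightarrow> bool" where
  "const_regs V \<longleftrightarrow> V 0 = 1 \<and> V 1 = 0 \<and> V 2 = k \<and> V 3 = int n \<and> V 4 = int n + 2 * int m"

lemma const_regs_upd [simp]: "5 \<le> r \<Longrightarrow> const_regs (V(r := x)) = const_regs V"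
  by (auto simp: const_regs_def)

lemma const_regsD:
  "const_regs V \<Longrightarrow> V 0 = 1" "const_regs V \<Longrightarrow> V (Suc 0) = 0" "const_regs V \<Longrightarrow> V 1 = 0" "const_regs V \<Longrightarrow> V 2 = k"
  "const_regs V \<Longrightarrow> V 3 = int n" "const_regs V \<Longrightarrow> V 4 = int n + 2 * int m"
  by (auto simp: const_regs_def)

definition input :: "arrs \<Rightarrow> bool" where
  "input A \<longleftrightarrow> A 0 0 = k \<and> A 0 1 = int n \<and> A 0 2 = int m \<and>
     (\<forall>i<m. A 0 (3 + 2 * int i) = int (fst (es ! i)) \<and> A 0 (4 + 2 * int i) = int (snd (es ! i)))"

lemma input_upd [simp]: "0 < a \<Longrightarrow> input (A(a := f)) = input A"
  by (auto simp: input_def)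

lemma setup_consts_spec:
  assumes "input A"
    and Q: "\<And>V t'. const_regs V \<Longrightarrow> V 10 = int m \<Longrightarrow> t' \<le> t + 12 \<Longrightarrow> Q V A t'"
  shows "vc setup_consts Q V A t"
proof -
  have "A 0 0 = k" "A 0 1 = int n" "A 0 2 = int m" using assms(1) by (auto simp: input_def)
  then show ?thesis using N_ge
    by (simp add: setup_consts_def, intro conjI wdI Q) (simp_all add: const_regs_def)
qed

lemma nth_es: "i < m \<Longrightarrow> es ! i = (a, b) \<Longrightarrow> a \<noteq> b \<and> a < n \<and> b < n"
  using edge_props length_es by (metis nth_mem)

lemma nbrs_take_Suc:
  "i < m \<Longrightarrow> es ! i = (a, b) \<Longrightarrow>
    nbrs (take (Suc i) es) u = nbrs (take i es) u @ (if a = u then [b] else []) @ (if b = u then [a] else [])"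
  using length_es by (simp add: take_Suc_conv_app_nth)

lemma nbrs_take_prefix: "nb u = nbrs (take i es) u @ nbrs (drop i es) u"
  by (simp add: nbrs_append[symmetric])

lemma length_nbrs_take: "length (nbrs (take i es) u) \<le> dg u"
  by (subst nbrs_take_prefix[of u i]) simp

lemma dg_bound: "u < n \<Longrightarrow> dg u \<le> 2 * m"
  using offset_le[of u] offset_ge[of u] by linarith

text \<open>After \<open>i\<close> edges the counters are the lengths of
  \<open>nbrs (take i es) u\<close>; a round takes 17 steps and a test.\<close>

lemma setup_degrees_spec:
  assumes ctx: "const_regs V" "V 10 = int m" "input A"
    and A: "A 1 = (\<lambda>_. 0)"
    and Q: "\<And>V' A' t'. const_regs V' \<Longrightarrow> V' 10 = int m \<Longrightarrow> same_except {1} A A' \<Longrightarrow>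
      \<forall>u<n. A' 1 (int u) = int (dg u) \<Longrightarrow> t' \<le> t + 3 + 18 * int m \<Longrightarrow> Q V' A' t'"
  shows "vc setup_degrees Q V A t"
proof -
  define I where "I = (\<lambda>V' A' t'. \<exists>i. const_regs V' \<and> V' 10 = int m \<and> same_except {1} A A' \<and> i \<le> m \<and>
    V' 11 = int i \<and> V' 12 = 3 + 2 * int i \<and> (\<forall>u<n. A' 1 (int u) = int (length (nbrs (take i es) u))) \<and>
    t' \<le> t + 2 + 18 * int i)"
  have "vc (Whl 11 10 (Ld 13 0 12 ;; Ad 12 12 0 ;; Ld 14 0 12 ;;
     Ad 12 12 0 ;; Ld 15 1 13 ;; Ad 15 15 0 ;; St 1 13 15 ;; Ld 15 1 14 ;; Ad 15 15 0 ;;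
     St 1 14 15 ;; Ad 11 11 0)) Q V' A' t'" if "I V' A' t'" for V' A' t'
    using that
  proof (rule vc_while[where I = I and T = "t + 2 + 18 * int m"])
    fix V' A' t' assume "I V' A' t'"
    then show "t' \<le> t + 2 + 18 * int m" by (auto simp: I_def)
  next
    fix V' A' t' assume I: "I V' A' t'" and "V' 11 < V' 10"
    then obtain i where i: "const_regs V'" "V' 10 = int m" "same_except {1} A A'" "i < m"
      "V' 11 = int i" "V' 12 = 3 + 2 * int i" "\<forall>u<n. A' 1 (int u) = int (length (nbrs (take i es) u))"
      "t' \<le> t + 2 + 18 * int i"
      by (auto simp: I_def)
    obtain a b where ab: "es ! i = (a, b)" by force
    note e = nth_es[OF i(4) ab]
    have inp: "A' 0 (3 + 2 * int i) = int a" "A' 0 (4 + 2 * int i) = int b"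
      using ctx(3) i(3,4) ab by (auto simp: input_def same_except_def)
    have len: "length (nbrs (take i es) u) \<le> 2 * m" if "u < n" for u
      using length_nbrs_take[of i u] dg_bound[OF that] by linarith
    show "vc (Ld 13 0 12 ;; Ad 12 12 0 ;; Ld 14 0 12 ;;
     Ad 12 12 0 ;; Ld 15 1 13 ;; Ad 15 15 0 ;; St 1 13 15 ;; Ld 15 1 14 ;; Ad 15 15 0 ;;
     St 1 14 15 ;; Ad 11 11 0) I V' A' (t' + 1)"
      using N_ge i e len[of a] len[of b] inp
      apply (simp add: const_regsD[OF i(1)])
      apply (intro conjI wdI)
      apply (simp_all)
      apply (simp add: I_def)
      apply (rule exI[of _ "Suc i"])
      apply (simp add: nbrs_take_Suc[OF i(4) ab])
      done
  next
    fix V' A' t' assume I: "I V' A' t'" and "\<not> V' 11 < V' 10"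
    then show "Q V' A' (t' + 1)"
      using length_es by (auto simp: I_def intro!: Q)
  qed
  moreover have "I (V(11 := 0, 12 := 3)) A (2 + t)"
    using ctx A by (auto simp: I_def)
  ultimately show ?thesis
    using N_ge by (auto simp: setup_degrees_def intro!: wdI)
qed

lemma setup_offsets_spec:
  assumes ctx: "const_regs V" "V 10 = int m" and A: "\<forall>u<n. A 1 (int u) = int (dg u)"
    and Q: "\<And>V' A' t'. const_regs V' \<Longrightarrow> V' 10 = int m \<Longrightarrow> same_except {2, 3, 4, 8} A A' \<Longrightarrow>
      (\<forall>u<n. A' 2 (int u) = int (offset u) \<and> A' 3 (int u) = int (offset u) \<and> A' 4 (int u) = int u \<and>
        A' 8 (int u) = -1) \<Longrightarrow> t' \<le> t + 4 + 13 * int n \<Longrightarrow> Q V' A' t'"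
  shows "vc setup_offsets Q V A t"
proof -
  define I where "I = (\<lambda>V' A' t'. \<exists>i. const_regs V' \<and> V' 10 = int m \<and>
    same_except {2, 3, 4, 8} A A' \<and> i \<le> n \<and>
    V' 11 = int i \<and> V' 12 = int (offset i) \<and> V' 13 = -1 \<and>
    (\<forall>u<i. A' 2 (int u) = int (offset u) \<and> A' 3 (int u) = int (offset u) \<and> A' 4 (int u) = int u \<and>
        A' 8 (int u) = -1) \<and>
    t' \<le> t + 3 + 13 * int i)"
  have "vc (Whl 11 3 (St 2 11 12 ;; St 3 11 12 ;;
     St 4 11 11 ;; St 8 11 13 ;; Ld 15 1 11 ;; Ad 12 12 15 ;; Ad 11 11 0)) Q V' A' t'"
    if "I V' A' t'" for V' A' t'
    using that
  proof (rule vc_while[where I = I and T = "t + 3 + 13 * int n"])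
    fix V' A' t' assume "I V' A' t'"
    then show "t' \<le> t + 3 + 13 * int n" by (auto simp: I_def)
  next
    fix V' A' t' assume I: "I V' A' t'" and "V' 11 < V' 3"
    then obtain i where i: "const_regs V'" "V' 10 = int m" "same_except {2, 3, 4, 8} A A'" "i < n"
      "V' 11 = int i" "V' 12 = int (offset i)" "V' 13 = -1"
      "\<forall>u<i. A' 2 (int u) = int (offset u) \<and> A' 3 (int u) = int (offset u) \<and> A' 4 (int u) = int u \<and>
        A' 8 (int u) = -1"
      "t' \<le> t + 3 + 13 * int i"
      by (auto simp: I_def const_regsD)
    have d: "A' 1 (int i) = int (dg i)" using A i(3,4) by (simp add: same_except_def)
    show "vc (St 2 11 12 ;; St 3 11 12 ;;
     St 4 11 11 ;; St 8 11 13 ;; Ld 15 1 11 ;; Ad 12 12 15 ;; Ad 11 11 0) I V' A' (t' + 1)"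
      using N_ge i d offset_le[OF i(4)]
      apply (simp add: const_regsD[OF i(1)])
      apply (intro conjI wdI)
      apply (simp_all)
      apply (simp add: I_def)
      apply (rule exI[of _ "Suc i"])
      apply (auto simp: less_Suc_eq)
      done
  next
    fix V' A' t' assume I: "I V' A' t'" and "\<not> V' 11 < V' 3"
    then show "Q V' A' (t' + 1)"
      by (auto simp: I_def const_regsD intro!: Q)
  qed
  moreover have "I (V(11 := 0, 13 := -1, 12 := int n)) A (3 + t)"
    using ctx by (auto simp: I_def)
  ultimately show ?thesis
    using N_ge by (auto simp: setup_offsets_def const_regsD[OF ctx(1)] intro!: wdI)
qed

text \<open>Array 3 is a write cursor for each block: it starts at \<open>offset u\<close>, moves by
  one per incident edge and thus finishes as the end of the block. The filled part of a block is a
  prefix of \<open>nb u\<close>.\<close>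

lemma setup_adjacency_spec:
  assumes ctx: "const_regs V" "V 10 = int m" "input A" and A: "\<forall>u<n. A 3 (int u) = int (offset u)"
    "\<forall>u<n. A 4 (int u) = int u"
    and Q: "\<And>V' A' t'. const_regs V' \<Longrightarrow> V' 10 = int m \<Longrightarrow> same_except {3, 4} A A' \<Longrightarrow>
      (\<forall>u<n. A' 3 (int u) = int (offset u + dg u) \<and> A' 4 (int u) = int u \<and>
        (\<forall>j<dg u. A' 4 (int (offset u + j)) = int (nb u ! j))) \<Longrightarrow> t' \<le> t + 3 + 22 * int m \<Longrightarrow> Q V' A' t'"
  shows "vc setup_adjacency Q V A t"
proof -
  define pre where "pre = (\<lambda>i u. nbrs (take i es) u)"
  define I where "I = (\<lambda>V' A' t'. \<exists>i. const_regs V' \<and> V' 10 = int m \<and> same_except {3, 4} A A' \<and> i \<le> m \<and>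
    V' 11 = int i \<and> V' 12 = 3 + 2 * int i \<and>
    (\<forall>u<n. A' 3 (int u) = int (offset u + length (pre i u)) \<and> A' 4 (int u) = int u \<and>
        (\<forall>j<length (pre i u). A' 4 (int (offset u + j)) = int (pre i u ! j))) \<and>
    t' \<le> t + 2 + 22 * int i)"
  have "vc (Whl 11 10 (Ld 13 0 12 ;; Ad 12 12 0 ;; Ld 14 0 12 ;;
     Ad 12 12 0 ;; Ld 15 3 13 ;; St 4 15 14 ;; Ad 15 15 0 ;; St 3 13 15 ;; Ld 15 3 14 ;;
     St 4 15 13 ;; Ad 15 15 0 ;; St 3 14 15 ;; Ad 11 11 0)) Q V' A' t'" if "I V' A' t'" for V' A' t'
    using that
  proof (rule vc_while[where I = I and T = "t + 2 + 22 * int m"])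
    fix V' A' t' assume "I V' A' t'"
    then show "t' \<le> t + 2 + 22 * int m" by (auto simp: I_def)
  next
    fix V' A' t' assume I: "I V' A' t'" and "V' 11 < V' 10"
    then obtain i where i: "const_regs V'" "V' 10 = int m" "same_except {3, 4} A A'" "i < m"
      "V' 11 = int i" "V' 12 = 3 + 2 * int i" 
      "\<forall>u<n. A' 3 (int u) = int (offset u + length (pre i u)) \<and> A' 4 (int u) = int u \<and>
        (\<forall>j<length (pre i u). A' 4 (int (offset u + j)) = int (pre i u ! j))"
      "t' \<le> t + 2 + 22 * int i"
      by (auto simp: I_def)
    obtain a b where ab: "es ! i = (a, b)" by force
    note e = nth_es[OF i(4) ab]
    have inp: "A' 0 (3 + 2 * int i) = int a" "A' 0 (4 + 2 * int i) = int b"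
      using ctx(3) i(3,4) ab by (auto simp: input_def same_except_def)
    have suc: "pre (Suc i) u = pre i u @ (if a = u then [b] else []) @ (if b = u then [a] else [])" for u
      by (simp add: pre_def nbrs_take_Suc[OF i(4) ab])
    have le: "length (pre (Suc i) u) \<le> dg u" for u unfolding pre_def by (rule length_nbrs_take)
    have len: "length (pre i a) < dg a" "length (pre i b) < dg b"
      using le[of a] le[of b] e by (auto simp: suc)
    \<comment> \<open>The two cells written in this round lie beyond the filled parts of all blocks,
      in different blocks as \<open>a \<noteq> b\<close>, and above the vertex nodes, so earlier
      contents survive.\<close>
    have neq: "offset u + j \<noteq> offset v + length (pre i v)"
      if "j < length (pre i u)" "v = a \<or> v = b" for u v j
    proof -
      have "j < dg u" using that(1) le[of u] by (auto simp: suc)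
      then show ?thesis using offset_inj[of u j v "length (pre i v)"] that len by auto
    qed
    have neq2: "offset a + length (pre i a) \<noteq> offset b + length (pre i b)"
      using offset_inj[OF _ len] e by auto
    have neq3: "u \<noteq> offset v + j" if "u < n" for u v j using offset_ge[of v] that by simp
    define A2 where "A2 = A'(3 := (A' 3)(int a := int (offset a + length (pre i a)) + 1,
                                 int b := int (offset b + length (pre i b)) + 1),
       4 := (A' 4)(int (offset a + length (pre i a)) := int b, int (offset b + length (pre i b)) := int a))"
    have A2: "\<forall>u<n. A2 3 (int u) = int (offset u + length (pre (Suc i) u)) \<and> A2 4 (int u) = int u \<and>
        (\<forall>j<length (pre (Suc i) u). A2 4 (int (offset u + j)) = int (pre (Suc i) u ! j))"
    proof (intro allI impI conjI)
      fix u assume u: "u < n"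
      show "A2 3 (int u) = int (offset u + length (pre (Suc i) u))"
        using i(7) u e by (simp add: A2_def suc)
      show "A2 4 (int u) = int u"
        using i(7) u neq3[OF u] by (simp add: A2_def del: of_nat_add)
      fix j assume j: "j < length (pre (Suc i) u)"
      show "A2 4 (int (offset u + j)) = int (pre (Suc i) u ! j)"
      proof (cases "j < length (pre i u)")
        case True
        then show ?thesis using i(7) u neq[OF True]
          by (simp add: A2_def suc nth_append del: of_nat_add)
      next
        case False
        then have "j = length (pre i u)" "u = a \<or> u = b" using j e by (auto simp: suc split: if_splits)
        then show ?thesis using e neq2 by (auto simp: A2_def suc nth_append simp del: of_nat_add)
      qed
    qed
    have fin: "I (V'(13 := int a, 12 := 5 + 2 * int i, 14 := int b, 15 := int (offset b + length (pre i b)) + 1,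
       11 := int i + 1)) A2 (22 + t')"
      unfolding I_def by (rule exI[of _ "Suc i"]) (use i A2 in \<open>simp add: A2_def\<close>)
    show "vc (Ld 13 0 12 ;; Ad 12 12 0 ;; Ld 14 0 12 ;;
     Ad 12 12 0 ;; Ld 15 3 13 ;; St 4 15 14 ;; Ad 15 15 0 ;; St 3 13 15 ;; Ld 15 3 14 ;;
     St 4 15 13 ;; Ad 15 15 0 ;; St 3 14 15 ;; Ad 11 11 0) I V' A' (t' + 1)"
      using N_ge i(1-6) i(7)[rule_format, of a] i(7)[rule_format, of b] e inp offset_le[of a] offset_le[of b] len
      apply (simp add: const_regsD[OF i(1)])
      apply (intro conjI wdI)
      apply (simp_all)
      using fin
      apply (simp add: A2_def fun_upd_twist[of 4 3] fun_upd_twist[of 12 13] fun_upd_twist[of 12 14] )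
      done
  next
    fix V' A' t' assume I: "I V' A' t'" and "\<not> V' 11 < V' 10"
    then show "Q V' A' (t' + 1)"
      using length_es by (auto simp: I_def pre_def intro!: Q)
  qed
  moreover have "I (V(11 := 0, 12 := 3)) A (2 + t)"
    using ctx A by (auto simp: I_def pre_def)
  ultimately show ?thesis
    using N_ge by (auto simp: setup_adjacency_def intro!: wdI)
qed

text \<open>Entry \<open>i + 2\<close> is entry \<open>i\<close> plus one; entries 0 and 1 are the
  zeros of the initial memory.\<close>

lemma setup_halves_spec:
  assumes ctx: "const_regs V" and A: "A 11 = (\<lambda>_. 0)"
    and Q: "\<And>V' A' t'. const_regs V' \<Longrightarrow> same_except {11} A A' \<Longrightarrow>
      (\<forall>j\<le>n. A' 11 (int j) = int (j div 2)) \<Longrightarrow> t' \<le> t + 3 + 8 * int n \<Longrightarrow> Q V' A' t'"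
  shows "vc setup_halves Q V A t"
proof -
  define I where "I = (\<lambda>V' A' t'. \<exists>i. const_regs V' \<and> same_except {11} A A' \<and> i \<le> n \<and>
    V' 11 = int i \<and> V' 12 = int i + 2 \<and> (\<forall>j<i+2. A' 11 (int j) = int (j div 2)) \<and>
    t' \<le> t + 2 + 8 * int i)"
  have "vc (Whl 11 3 (Ld 15 11 11 ;; Ad 15 15 0 ;; St 11 12 15 ;;
     Ad 11 11 0 ;; Ad 12 12 0)) Q V' A' t'" if "I V' A' t'" for V' A' t'
    using that
  proof (rule vc_while[where I = I and T = "t + 2 + 8 * int n"])
    fix V' A' t' assume "I V' A' t'"
    then show "t' \<le> t + 2 + 8 * int n" by (auto simp: I_def)
  next
    fix V' A' t' assume I: "I V' A' t'" and "V' 11 < V' 3"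
    then obtain i where i: "const_regs V'" "same_except {11} A A'" "i < n"
      "V' 11 = int i" "V' 12 = int i + 2" "\<forall>j<i+2. A' 11 (int j) = int (j div 2)"
      "t' \<le> t + 2 + 8 * int i"
      by (auto simp: I_def const_regsD)
    have "\<forall>j<Suc i + 2. ((A' 11)(2 + int i := int (i div 2) + 1)) (int j) = int (j div 2)"
    proof (intro allI impI)
      fix j assume "j < Suc i + 2"
      then show "((A' 11)(2 + int i := int (i div 2) + 1)) (int j) = int (j div 2)"
        using i(6) by (cases "j = i + 2") auto
    qed
    moreover define f where "f = (A' 11)(2 + int i := int (i div 2) + 1)"
    ultimately have f: "\<forall>j<Suc i + 2. f (int j) = int (j div 2)" by simp
    have "I (V'(15 := int (i div 2) + 1, 11 := int i + 1, 12 := int i + 3)) (A'(11 := f)) (8 + t')"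
      unfolding I_def by (rule exI[of _ "Suc i"]) (use i f in simp)
    then show "vc (Ld 15 11 11 ;; Ad 15 15 0 ;; St 11 12 15 ;;
     Ad 11 11 0 ;; Ad 12 12 0) I V' A' (t' + 1)"
      using N_ge i(1-5,7) i(6)[rule_format, of i]
      apply (simp add: const_regsD[OF i(1)])
      apply (intro conjI wdI)
      apply (simp_all)
      apply (simp add: f_def add.commute)
      done
  next
    fix V' A' t' assume I: "I V' A' t'" and "\<not> V' 11 < V' 3"
    then show "Q V' A' (t' + 1)"
      by (auto simp: I_def const_regsD intro!: Q)
  qed
  moreover have "I (V(11 := 0, 12 := 2)) A (2 + t)"
    using ctx A by (auto simp: I_def less_Suc_eq numeral_2_eq_2)
  ultimately show ?thesis
    using N_ge by (auto simp: setup_halves_def const_regsD[OF ctx(1)] intro!: wdI)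
qed

definition graph_arrs :: "arrs \<Rightarrow> bool" where
  "graph_arrs A \<longleftrightarrow>
     (\<forall>u<n. A 1 (int u) = int (dg u) \<and> A 2 (int u) = int (offset u) \<and> A 3 (int u) = int (offset u + dg u)) \<and>
     (\<forall>x<n + 2 * m. A 4 (int x) = int (target x)) \<and> (\<forall>j\<le>n. A 11 (int j) = int (j div 2))"

lemma graph_arrs_upd [simp]: "a \<notin> {1, 2, 3, 4, 11} \<Longrightarrow> graph_arrs (A(a := f)) = graph_arrs A"
  by (simp add: graph_arrs_def)

lemma offset_cover:
  assumes "n \<le> x" "x < offset u"
  shows "\<exists>v j. v < u \<and> j < dg v \<and> x = offset v + j"
  using assms
proof (induction u)
  case (Suc u)
  show ?case
  proof (cases "x < offset u")
    case True
    with Suc show ?thesis by (meson less_SucI)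
  next
    case False
    with Suc.prems show ?thesis
      by (intro exI[of _ u] exI[of _ "x - offset u"]) auto
  qed
qed simp

text \<open>The constants add up those of the phases: \<open>25 = 12 + 3 + 4 + 3 + 3\<close>,
  \<open>40 = 18 + 22\<close> and \<open>21 = 13 + 8\<close>.\<close>

lemma setup_prog_spec:
  assumes "input A" "\<And>a. 0 < a \<Longrightarrow> A a = (\<lambda>_. 0)"
    and Q: "\<And>V A t'. const_regs V \<Longrightarrow> graph_arrs A \<Longrightarrow> A 6 = (\<lambda>_. 0) \<Longrightarrow>
      \<forall>u<n. A 8 (int u) = -1 \<Longrightarrow> t' \<le> t + 25 + 40 * int m + 21 * int n \<Longrightarrow> Q V A t'"
  shows "vc setup_prog Q V A t"
  unfolding setup_prog_def vc.simps
proof (rule setup_consts_spec[OF assms(1)])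
  fix V1 t1 assume 1: "const_regs V1" "V1 10 = int m" "t1 \<le> t + 12"
  show "vc setup_degrees (vc setup_offsets (vc setup_adjacency (vc setup_halves Q))) V1 A t1"
  proof (rule setup_degrees_spec[OF 1(1,2) assms(1)])
    show "A 1 = (\<lambda>_. 0)" by (rule assms(2)) simp
    fix V2 A2 t2
    assume 2: "const_regs V2" "V2 10 = int m" "same_except {1} A A2" "\<forall>u<n. A2 1 (int u) = int (dg u)"
      "t2 \<le> t1 + 3 + 18 * int m"
    show "vc setup_offsets (vc setup_adjacency (vc setup_halves Q)) V2 A2 t2"
    proof (rule setup_offsets_spec[OF 2(1,2)])
      show "\<forall>u<n. A2 1 (int u) = int (dg u)" by (fact 2(4))
    next
      fix V3 A3 t3
      assume 3: "const_regs V3" "V3 10 = int m" "same_except {2, 3, 4, 8} A2 A3"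
        "\<forall>u<n. A3 2 (int u) = int (offset u) \<and> A3 3 (int u) = int (offset u) \<and> A3 4 (int u) = int u \<and>
            A3 8 (int u) = -1" "t3 \<le> t2 + 4 + 13 * int n"
      have A3: "A3 0 = A 0" "A3 1 = A2 1" "A3 6 = (\<lambda>_. 0)" "A3 11 = (\<lambda>_. 0)"
        using 2(3) 3(3) assms(2) by (auto simp: same_except_def)
  show "vc setup_adjacency (vc setup_halves Q) V3 A3 t3"
  proof (rule setup_adjacency_spec)
    show "input A3" using assms(1) A3(1) by (simp add: input_def)
    show "\<forall>u<n. A3 3 (int u) = int (offset u)" "\<forall>u<n. A3 4 (int u) = int u" using 3(4) by auto
    fix V4 A4 t4
    assume 4: "const_regs V4" "same_except {3, 4} A3 A4"
      "\<forall>u<n. A4 3 (int u) = int (offset u + dg u) \<and> A4 4 (int u) = int u \<and>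
        (\<forall>j<dg u. A4 4 (int (offset u + j)) = int (nb u ! j))" "t4 \<le> t3 + 3 + 22 * int m"
    show "vc setup_halves Q V4 A4 t4"
    proof (rule setup_halves_spec[OF 4(1)])
      show "A4 11 = (\<lambda>_. 0)" using 4(2) A3 by (simp add: same_except_def)
      fix V5 A5 t5
      assume 5: "const_regs V5" "same_except {11} A4 A5" "\<forall>j\<le>n. A5 11 (int j) = int (j div 2)"
        "t5 \<le> t4 + 3 + 8 * int n"
      have A5: "A5 1 = A2 1" "A5 2 = A3 2" "A5 3 = A4 3" "A5 4 = A4 4" "A5 6 = A3 6" "A5 8 = A3 8"
        using 4(2) 5(2) A3 by (auto simp: same_except_def)
      have "A4 4 (int x) = int (target x)" if "x < n + 2 * m" for x
      proof (cases "x < n")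
        case False
        with that offset_cover[of x n] obtain v j where "v < n" "j < dg v" "x = offset v + j"
          by (auto simp: offset_n)
        then show ?thesis using 4(3) by (simp add: target_edge)
      qed (use 4(3) in simp)
      then have "graph_arrs A5" using 2(4) 3(4) 4(3) 5(3) A5 by (simp add: graph_arrs_def)
      then show "Q V5 A5 t5"
        using 1 2 3 4 5 A3 by (intro Q) (auto simp: A5)
    qed
  qed (use 3 in auto)
    qed
  qed
qed

end

section \<open>Pushing a vertex\<close>

text \<open>The link of the last node is left unspecified: the search stops at the base vertex of
  the top cluster and never follows it.\<close>

fun linked :: "(int \<Rightarrow> int) \<Rightarrow> nat list \<Rightarrow> bool" where
  "linked f (x # y # zs) \<longleftrightarrow> f (int x) = int y \<and> linked f (y # zs)"
| "linked f _ \<longleftrightarrow> True"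

lemma linked_split: "linked f (as @ y # bs) \<longleftrightarrow> linked f (as @ [y]) \<and> linked f (y # bs)"
proof (induction as)
  case (Cons a as)
  then show ?case by (cases as) auto
qed simp

lemma linked_cong:
  "linked f xs \<Longrightarrow> \<forall>x\<in>set (butlast xs). g (int x) = f (int x) \<Longrightarrow> linked g xs"
  by (induction f xs rule: linked.induct) (auto split: if_splits)

lemma linked_insert:
  assumes "linked f (as @ y # bs)" "distinct (as @ y # bs)" "z \<notin> set (as @ y # bs)"
  shows "linked (f(int z := f (int y), int y := int z)) (as @ y # z # bs)"
proof -
  let ?g = "f(int z := f (int y), int y := int z)"
  from assms(1) have l: "linked f (as @ [y])" "linked f (y # bs)"
    using linked_split[of f as y bs] by simp_all
  have 1: "linked ?g (as @ [y])"
    by (rule linked_cong[OF l(1)]) (use assms(2,3) in auto)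
  have 2: "linked ?g (z # bs)"
  proof (cases bs)
    case (Cons b cs)
    then have "linked f (b # cs)" using l(2) by simp
    then have "linked ?g (b # cs)"
      by (rule linked_cong) (use assms(2,3) Cons in \<open>auto dest: in_set_butlastD\<close>)
    then show ?thesis using Cons assms l(2) by auto
  qed simp
  have "linked ?g (as @ y # z # bs) \<longleftrightarrow> linked ?g (as @ [y]) \<and> linked ?g (y # z # bs)"
    by (rule linked_split)
  then show ?thesis using 1 2 assms(3) by auto
qed

lemma before_irrefl: "d \<notin> before xs d"
  by (induction xs) (auto simp: before_Nil before_Cons)

lemma before_asym: "x \<in> before xs y \<Longrightarrow> y \<in> before xs x \<Longrightarrow> False"
  by (induction xs) (auto simp: before_Nil before_Cons split: if_splits)

definition find_cluster :: cmd where
  "find_cluster = Con 20 0 ;; Ad 21 9 1 ;; Whl 0 21 (Ld 22 11 21 ;; Ad 23 20 22 ;; Ld 24 10 23 ;;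
     Ite 19 24 (Ad 21 22 1) (Ad 20 23 1 ;; Su 21 21 22))"

definition insert_prog :: cmd where
  "insert_prog = find_cluster ;; Ad 20 20 0 ;; Ite 20 9 (Ld 24 10 20 ;; Ld 25 9 24) (Ad 25 4 1) ;;
     Ld 26 5 25 ;; St 5 12 26 ;; St 5 25 12"

definition push_edge :: cmd where
  "push_edge = Ld 14 4 12 ;; Ld 15 2 14 ;; Ld 16 6 14 ;; Ad 17 15 16 ;; St 7 17 11 ;; Ad 16 16 0 ;;
     St 6 14 16 ;; Ld 18 1 14 ;; Su 18 18 2 ;;
     Ite 18 16 (Su 17 17 18 ;; Ld 19 7 17 ;; insert_prog) Nop"

definition push_prog :: cmd where
  "push_prog = St 8 10 8 ;; St 9 8 10 ;; St 10 9 8 ;; Ad 11 8 1 ;; Ad 8 8 0 ;; Ad 9 9 0 ;;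
     Ld 26 5 4 ;; St 5 10 26 ;; St 5 4 10 ;; Ld 12 2 10 ;; Ld 13 3 10 ;;
     Whl 12 13 (push_edge ;; Ad 12 12 0)"

context ram_graph
begin

section \<open>Representation of the abstract state in the arrays\<close>

lemma const_regs_same: "same_except X V V' \<Longrightarrow> {0..4} \<inter> X = {} \<Longrightarrow> const_regs V \<Longrightarrow> const_regs V'"
  by (auto simp: const_regs_def same_except_def disjoint_iff)

lemma graph_arrs_same:
  "same_except X A A' \<Longrightarrow> {1, 2, 3, 4, 11} \<inter> X = {} \<Longrightarrow> graph_arrs A \<Longrightarrow> graph_arrs A'"
  by (auto simp: graph_arrs_def same_except_def disjoint_iff)

definition stack_arr :: "nat list \<Rightarrow> arrs \<Rightarrow> bool" where
  "stack_arr ss A \<longleftrightarrow> (\<forall>i<length ss. A 9 (int i) = int (ss ! i))"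

definition pos_arr :: "nat list \<Rightarrow> nat set \<Rightarrow> arrs \<Rightarrow> bool" where
  "pos_arr ss D A \<longleftrightarrow> (\<forall>i<length ss. A 8 (int (ss ! i)) = int i) \<and> (\<forall>u\<in>D. A 8 (int u) = int n) \<and>
     (\<forall>u<n. u \<notin> D \<union> set ss \<longrightarrow> A 8 (int u) = -1)"

definition base_arr :: "nat list \<Rightarrow> arrs \<Rightarrow> bool" where
  "base_arr bs A \<longleftrightarrow> (\<forall>c<length bs. A 10 (int c) = int (bs ! c))"

definition queue_arr :: "(nat \<Rightarrow> nat list) \<Rightarrow> arrs \<Rightarrow> bool" where
  "queue_arr Q A \<longleftrightarrow> (\<forall>u<n. A 6 (int u) = int (length (Q u)) \<and>
     (\<forall>i<length (Q u). A 7 (int (offset u + i)) = int (Q u ! i)))"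

definition list_arr :: "nat list \<Rightarrow> arrs \<Rightarrow> bool" where
  "list_arr xs A \<longleftrightarrow> linked (A 5) ((n + 2 * m) # xs)"

lemma arr_upd [simp]:
  "a \<noteq> 9 \<Longrightarrow> stack_arr ss (A(a := f)) = stack_arr ss A"
  "a \<noteq> 8 \<Longrightarrow> pos_arr ss D (A(a := f)) = pos_arr ss D A"
  "a \<noteq> 10 \<Longrightarrow> base_arr bs (A(a := f)) = base_arr bs A"
  "a \<noteq> 6 \<Longrightarrow> a \<noteq> 7 \<Longrightarrow> queue_arr Q (A(a := f)) = queue_arr Q A"
  "a \<noteq> 5 \<Longrightarrow> list_arr xs (A(a := f)) = list_arr xs A"
  by (auto simp: stack_arr_def pos_arr_def base_arr_def queue_arr_def list_arr_def)

lemma arr_same: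
  "same_except X A A' \<Longrightarrow> 9 \<notin> X \<Longrightarrow> stack_arr ss A' = stack_arr ss A"
  "same_except X A A' \<Longrightarrow> 8 \<notin> X \<Longrightarrow> pos_arr ss D A' = pos_arr ss D A"
  "same_except X A A' \<Longrightarrow> 10 \<notin> X \<Longrightarrow> base_arr bs A' = base_arr bs A"
  "same_except X A A' \<Longrightarrow> 6 \<notin> X \<Longrightarrow> 7 \<notin> X \<Longrightarrow> queue_arr Q A' = queue_arr Q A"
  "same_except X A A' \<Longrightarrow> 5 \<notin> X \<Longrightarrow> list_arr xs A' = list_arr xs A"
  by (auto simp: stack_arr_def pos_arr_def base_arr_def queue_arr_def list_arr_def same_except_def)

definition repr :: "nat list \<Rightarrow> nat list \<Rightarrow> nat list \<Rightarrow> nat set \<Rightarrow> (nat \<Rightarrow> nat list) \<Rightarrow> arrs \<Rightarrow> bool" where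
  "repr ss bs xs D Q A \<longleftrightarrow> stack_arr ss A \<and> pos_arr ss D A \<and> base_arr bs A \<and> queue_arr Q A \<and> list_arr xs A"

definition ghost_inv :: "nat list \<Rightarrow> nat list \<Rightarrow> nat list \<Rightarrow> nat set \<Rightarrow> (nat \<Rightarrow> nat list) \<Rightarrow> nat set \<Rightarrow> bool" where
  "ghost_inv ss bs xs D Q E \<longleftrightarrow> stack_inv ss bs D \<and> sep_inv ss bs xs \<and> sound_inv ss bs xs \<and>
     cover_inv ss bs xs Q E \<and> queue_inv ss Q \<and> set xs \<subseteq> {..<n + 2 * m}"

lemma length_ss: "stack_inv ss bs D \<Longrightarrow> length ss + card D \<le> n"
proof -
  assume s: "stack_inv ss bs D"
  then have "finite D" "set ss \<union> D \<subseteq> {..<n}" by (auto simp: stack_inv_def finite_subset)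
  then have "card (set ss) + card D \<le> n"
    using card_mono[of "{..<n}" "set ss \<union> D"] s by (auto simp: stack_inv_def card_Un_disjoint)
  then show ?thesis using s by (simp add: stack_inv_def distinct_card)
qed

lemma length_bs: "stack_inv ss bs D \<Longrightarrow> length bs \<le> length ss"
proof -
  assume s: "stack_inv ss bs D"
  then have "distinct bs" "set bs \<subseteq> {..<length ss}"
    by (auto simp: stack_inv_def strict_sorted_iff)
  then show ?thesis using card_mono[of "{..<length ss}" "set bs"] by (simp add: distinct_card)
qed

text \<open>Recorded positions stand for distinct neighbours; this keeps each queue inside the block
  of its vertex in array 7.\<close>

lemma length_queue:
  assumes "queue_inv ss Q" "distinct ss" "u < n"
  shows "length (Q u) \<le> dg u"
proof -
  have q: "sorted_wrt (<) (Q u)" "\<forall>p\<in>set (Q u). p < length ss \<and> ss ! p \<in> set (nb u)"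
    using assms by (auto simp: queue_inv_def)
  have "length (Q u) = card (set (Q u))" using q(1) by (simp add: distinct_card strict_sorted_iff)
  also have "\<dots> = card ((!) ss ` set (Q u))"
    using assms(2) q(2) by (intro card_image[symmetric] inj_on_nth) auto
  also have "\<dots> \<le> card (set (nb u))" using q(2) by (intro card_mono) auto
  also have "\<dots> \<le> dg u" by (rule card_length)
  finally show ?thesis .
qed

text \<open>The search interval consists of the \<open>d\<close> clusters from \<open>c\<close> on,
  and \<open>d \<le> 2 ^ j\<close> with \<open>j\<close> the rounds still allowed. A round costs at
  most 9 steps including the test, hence the conserved sum of clock and
  \<open>9 * j\<close>.\<close>

lemma find_cluster_spec:
  assumes ctx: "const_regs V" "graph_arrs A" "base_arr bs A" "V 9 = int (length bs)" "V 19 = int p"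
    and bs: "sorted_wrt (<) bs" "bs \<noteq> []" "hd bs = 0" "length bs \<le> n" "length bs \<le> 2 ^ L"
    and Q: "\<And>V' t' c. same_except {20..24} V V' \<Longrightarrow> V' 20 = int c \<Longrightarrow> c < length bs \<Longrightarrow>
      bs ! c \<le> p \<Longrightarrow> (Suc c < length bs \<Longrightarrow> p < bs ! Suc c) \<Longrightarrow> t' \<le> t + 3 + 9 * int L \<Longrightarrow> Q V' A t'"
  shows "vc find_cluster Q V A t"
proof -
  define I where "I = (\<lambda>V' A' t'. \<exists>c d j. same_except {20..24} V V' \<and> A' = A \<and> V' 20 = int c \<and>
    V' 21 = int d \<and> 1 \<le> d \<and> c + d \<le> length bs \<and> bs ! c \<le> p \<and> (c + d < length bs \<longrightarrow> p < bs ! (c + d)) \<and>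
    d \<le> 2 ^ j \<and> t' + 9 * int j \<le> t + 2 + 9 * int L)"
  let ?c = "Ld 22 11 21 ;; Ad 23 20 22 ;; Ld 24 10 23 ;; Ite 19 24 (Ad 21 22 1) (Ad 20 23 1 ;; Su 21 21 22)"
  have "vc (Whl 0 21 ?c) Q V' A' t'" if "I V' A' t'" for V' A' t'
    using that
  proof (rule vc_while[where I = I and T = "t + 2 + 9 * int L"])
    fix V' A' t' assume "I V' A' t'"
    then show "t' \<le> t + 2 + 9 * int L" by (auto simp: I_def)
  next
    fix V' A' t' assume I: "I V' A' t'" and lt: "V' 0 < V' 21"
    then obtain c d j where i: "same_except {20..24} V V'" "A' = A" "V' 20 = int c"
      "V' 21 = int d" "c + d \<le> length bs" "bs ! c \<le> p" "c + d < length bs \<longrightarrow> p < bs ! (c + d)"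
      "d \<le> 2 ^ j" "t' + 9 * int j \<le> t + 2 + 9 * int L"
      by (auto simp: I_def)
    have ctx': "const_regs V'" using const_regs_same[OF i(1) _ ctx(1)] by simp
    have V': "V' 9 = int (length bs)" "V' 19 = int p" using i(1) ctx by (simp_all add: same_except_def)
    have d: "1 < d" using lt i(4) ctx' by (simp add: const_regs_def)
    then obtain j' where j': "j = Suc j'" using i(8) by (cases j) auto
    define h where "h = d div 2"
    \<comment> \<open>Both the lower part of length \<open>d div 2\<close> and the upper part of
      length \<open>d - d div 2\<close> fit the next smaller power of two.\<close>
    have h: "1 \<le> h" "h < d" "h \<le> 2 ^ j'" "d - h \<le> 2 ^ j'" using d i(8) by (auto simp: h_def j')
    have hf: "A 11 (int d) = int h" using ctx(2) i(5) bs(4) by (simp add: graph_arrs_def h_def)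
    have b: "A 10 (int c + int h) = int (bs ! (c + h))"
      using ctx(3)[unfolded base_arr_def, rule_format, of "c + h"] h i(5) by simp
    have 1: "I (V'(22 := int h, 23 := int c + int h, 24 := int (bs ! (c + h)), 21 := int h)) A (8 + t')"
      if "p < bs ! (c + h)"
      unfolding I_def by (rule exI[of _ c], rule exI[of _ h], rule exI[of _ j']) (use i h that in \<open>auto simp: j'\<close>)
    have 2: "I (V'(22 := int h, 23 := int c + int h, 24 := int (bs ! (c + h)), 20 := int c + int h,
        21 := int d - int h)) A (9 + t')"
      if "\<not> p < bs ! (c + h)"
      unfolding I_def by (rule exI[of _ "c + h"], rule exI[of _ "d - h"], rule exI[of _ j']) (use i h that in \<open>auto simp: j'\<close>)
    show "vc ?c I V' A' (t' + 1)"
      using N_ge i(2-5) V' b hf h bs(4) d 1 2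
      apply (simp add: const_regsD[OF ctx'])
      apply (intro conjI impI wdI)
      apply (simp_all)
      done
  next
    fix V' A' t' assume I: "I V' A' t'" and "\<not> V' 0 < V' 21"
    then obtain c d j where i: "same_except {20..24} V V'" "A' = A" "V' 20 = int c"
      "V' 21 = int d" "1 \<le> d" "c + d \<le> length bs" "bs ! c \<le> p" "c + d < length bs \<longrightarrow> p < bs ! (c + d)"
      "t' + 9 * int j \<le> t + 2 + 9 * int L"
      by (auto simp: I_def)
    have ctx': "const_regs V'" using const_regs_same[OF i(1) _ ctx(1)] by simp
    have "d = 1" using \<open>\<not> V' 0 < V' 21\<close> i(4,5) ctx' by (simp add: const_regs_def)
    then show "Q V' A' (t' + 1)"
      using i unfolding i(2) by (intro Q[of V' c]) auto
  qed
  moreover have "I (V(20 := 0, 21 := int (length bs))) A (2 + t)"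
    unfolding I_def
    by (rule exI[of _ 0], rule exI[of _ "length bs"], rule exI[of _ L])
      (use bs in \<open>auto simp: hd_conv_nth Suc_le_eq\<close>)
  ultimately show ?thesis
    using N_ge ctx(4) bs(4) by (auto simp: find_cluster_def const_regsD[OF ctx(1)] intro!: wdI)
qed


text \<open>The entry goes to the front of the section of the cluster \<open>c\<close> that contains
  \<open>p\<close>: behind the base vertex of cluster \<open>c + 1\<close>, which closes the section
  above, or behind the header if \<open>c\<close> is the top cluster.\<close>

lemma insert_prog_spec:
  assumes ctx: "const_regs V" "graph_arrs A" "V 9 = int (length bs)" "V 19 = int p" "V 12 = int z"
    and A: "stack_arr ss A" "base_arr bs A" "list_arr xs A"
    and inv: "stack_inv ss bs D" "sep_inv ss bs xs" "set xs \<subseteq> {..<n + 2 * m}"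
    and z: "z < n + 2 * m" "z \<notin> set xs"
    and p: "p < length ss" and L: "n \<le> 2 ^ L"
    and Q: "\<And>V' A' t' xs'. same_except {20..26} V V' \<Longrightarrow> same_except {5} A A' \<Longrightarrow> list_arr xs' A' \<Longrightarrow>
      distinct xs' \<Longrightarrow> set xs' = insert z (set xs) \<Longrightarrow>
      (\<And>b. b \<in> set bs \<Longrightarrow> before xs' (ss ! b) =
         (if b \<le> p then insert z (before xs (ss ! b)) else before xs (ss ! b))) \<Longrightarrow>
      t' \<le> t + 15 + 9 * int L \<Longrightarrow> Q V' A' t'"
  shows "vc insert_prog Q V A t"
proof -
  let ?H = "n + 2 * m"
  have ss: "distinct ss" "set ss \<subseteq> {..<n}" "ss \<noteq> []" "sorted_wrt (<) bs" "bs \<noteq> []" "hd bs = 0"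
    "\<forall>b\<in>set bs. b < length ss"
    using inv(1) p by (auto simp: stack_inv_def)
  have len: "length ss \<le> n" "length bs \<le> n" using length_ss[OF inv(1)] length_bs[OF inv(1)] by auto
  have xs: "distinct xs" "?H \<notin> set xs" using inv(2,3) by (auto simp: sep_inv_def)
  \<comment> \<open>Common to both cases: \<open>z\<close> is spliced in behind a node
    \<open>y\<close> of the list with its header in front. Since \<open>y\<close> may be the header
    itself, the header is stripped only afterwards, by \<open>tl\<close>.\<close>
  have fin: "Q V' (A(5 := (A 5)(int z := A 5 (int y), int y := int z))) t'"
    if V': "same_except {20..26} V V'" and t': "t' \<le> t + 15 + 9 * int L"
      and hs: "?H # xs = as @ y # cs" and tl: "xs' = tl (as @ y # z # cs)"
      and bf: "\<And>b. b \<in> set bs \<Longrightarrow> before xs' (ss ! b) =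
         (if b \<le> p then insert z (before xs (ss ! b)) else before xs (ss ! b))"
    for V' t' as y cs xs'
  proof -
    have hs': "?H # xs' = as @ y # z # cs" using hs tl by (cases as) auto
    have d: "distinct (as @ y # cs)" "z \<notin> set (as @ y # cs)"
      using xs z unfolding hs[symmetric] by auto
    have "set (?H # xs') = insert z (set (?H # xs))" "distinct (?H # xs')"
      unfolding hs hs' using d by auto
    moreover have "z \<noteq> ?H" using z(1) by simp
    ultimately have "set xs' = set (?H # xs') - {?H}" "distinct xs'"
      "set (?H # xs') - {?H} = insert z (set (?H # xs) - {?H})" by auto
    then have "set xs' = insert z (set xs)" "distinct xs'" using xs(2) by auto
    moreover have "linked ((A 5)(int z := A 5 (int y), int y := int z)) (?H # xs')"
      using linked_insert[of "A 5" as y cs z] d A(3) unfolding hs hs' list_arr_def by simp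
    ultimately show ?thesis using bf V' t' by (intro Q[of _ _ xs']) (auto simp: list_arr_def)
  qed
  show ?thesis
    unfolding insert_prog_def vc.simps(7)
  proof (rule find_cluster_spec[OF ctx(1,2) A(2) ctx(3,4) ss(4-6) len(2)])
    show "length bs \<le> 2 ^ L" using len L by simp
    fix V1 t1 c
    assume V1: "same_except {20..24} V V1" "V1 20 = int c" and c: "c < length bs" "bs ! c \<le> p"
      "Suc c < length bs \<Longrightarrow> p < bs ! Suc c" and t1: "t1 \<le> t + 3 + 9 * int L"
    have ctx1: "const_regs V1" using const_regs_same[OF V1(1) _ ctx(1)] by simp
    have V1': "V1 9 = int (length bs)" "V1 12 = int z" using V1(1) ctx by (simp_all add: same_except_def)
    have srt: "bs ! i < bs ! j" if "i < j" "j < length bs" for i j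
      using ss(4) that by (auto simp: sorted_wrt_iff_nth_less)
    show "vc (Ad 20 20 0) (vc (Ite 20 9 (Ld 24 10 20 ;; Ld 25 9 24) (Ad 25 4 1)) (vc (Ld 26 5 25)
        (vc (St 5 12 26) (vc (St 5 25 12) Q)))) V1 A t1"
    proof (cases "Suc c < length bs")
      case True
      define b' where "b' = bs ! Suc c"
      have b': "b' \<in> set bs" "p < b'" "b' < length ss" using True c(3) ss(7) by (auto simp: b'_def)
      \<comment> \<open>\<open>b'\<close> is the least base above \<open>p\<close>, and
        \<open>y\<close> is the node that closes its section.\<close>
      define y where "y = ss ! b'"
      have y: "y \<in> set xs" "y < n" using inv(2) b' ss(2) by (auto simp: y_def sep_inv_def dest: nth_mem)
      obtain as cs where as: "xs = as @ y # cs" using y(1) by (meson split_list)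
      have bA: "A 10 (int c + 1) = int b'" 
        using A(2)[unfolded base_arr_def, rule_format, of "Suc c"] True by (simp add: b'_def add.commute)
      have sA: "A 9 (int b') = int y" using A(1) b' by (simp add: stack_arr_def y_def)
      have bf: "before (as @ y # z # cs) (ss ! b) =
         (if b \<le> p then insert z (before xs (ss ! b)) else before xs (ss ! b))" if b: "b \<in> set bs" for b
      proof -
        have "ss ! b \<in> set xs" using inv(2) b by (auto simp: sep_inv_def)
        then have "before (as @ y # z # cs) (ss ! b) =
           (if y \<in> before xs (ss ! b) then insert z (before xs (ss ! b)) else before xs (ss ! b))"
          using before_insert[of as y cs "ss ! b" z] xs(1) z(2) unfolding as by metis
        \<comment> \<open>Base vertices are listed by decreasing base, so \<open>y\<close> precedes
          exactly those with a base below \<open>b'\<close>; no base lies strictly between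
          \<open>p\<close> and \<open>b'\<close>.\<close>
        moreover have "y \<in> before xs (ss ! b) \<longleftrightarrow> b \<le> p"
        proof
          assume "b \<le> p"
          then show "y \<in> before xs (ss ! b)" using inv(2) b b' by (auto simp: sep_inv_def y_def)
        next
          assume y: "y \<in> before xs (ss ! b)"
          show "b \<le> p"
          proof (rule ccontr)
            assume nb: "\<not> b \<le> p"
            obtain i where i: "i < length bs" "b = bs ! i" using b by (auto simp: in_set_conv_nth)
            have "\<not> i \<le> c" using srt[of i c] i c nb by (cases "i = c") auto
            then have "b' \<le> b" using srt[of "Suc c" i] i by (cases "i = Suc c") (auto simp: b'_def)
            then show False
            proof (cases "b = b'")
              case True
              then show False using y before_irrefl[of y xs] by (simp add: y_def)
            next
              case False
              then have "ss ! b \<in> before xs y" using inv(2) b b' \<open>b' \<le> b\<close> by (auto simp: sep_inv_def y_def)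
              then show False using y before_asym by metis
            qed
          qed
        qed
        ultimately show ?thesis by simp
      qed
      have "Q (V1(20 := int c + 1, 24 := int b', 25 := int y, 26 := A 5 (int y)))
          (A(5 := (A 5)(int z := A 5 (int y), int y := int z))) (12 + t1)"
        by (rule fin[where as = "?H # as" and cs = cs and xs' = "as @ y # z # cs", OF _ _ _ _ bf])
          (use V1 t1 as in \<open>auto simp: same_except_def\<close>)
      then show ?thesis
        using N_ge V1 V1' bA sA y(2) b'(3) len c(1) z(1) True
        apply (simp add: const_regsD[OF ctx1])
        apply (intro conjI wdI)
        apply simp_all
        done
    next
      case False
      have le: "b \<le> p" if b: "b \<in> set bs" for b
      proof -
        obtain i where i: "i < length bs" "b = bs ! i" using b by (auto simp: in_set_conv_nth)
        then show ?thesis using False c srt[of i c] by (cases "i = c") auto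
      qed
      have bf: "before (z # xs) (ss ! b) =
         (if b \<le> p then insert z (before xs (ss ! b)) else before xs (ss ! b))" if b: "b \<in> set bs" for b
      proof -
        have "ss ! b \<in> set xs" using inv(2) b by (auto simp: sep_inv_def)
        then show ?thesis using le[OF b] z(2) by (auto simp: before_Cons)
      qed
      have "Q (V1(20 := int c + 1, 25 := int n + 2 * int m, 26 := A 5 (int n + 2 * int m)))
          (A(5 := (A 5)(int z := A 5 (int ?H), int ?H := int z))) (9 + t1)"
        by (rule fin[where as = "[]" and cs = xs and xs' = "z # xs", OF _ _ _ _ bf])
          (use V1 t1 in \<open>auto simp: same_except_def\<close>)
      then show ?thesis
        using N_ge V1 V1' len c(1) z(1) False
        apply (simp add: const_regsD[OF ctx1])
        apply (intro conjI wdI)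
        apply simp_all
        done
    qed
  qed
qed

text \<open>As \<open>G\<close> itself is a k-core, the \<open>nat\<close> in \<open>slack\<close>
  truncates nothing.\<close>

lemma int_slack: "u < n \<Longrightarrow> int (slack u) = int (dg u) - k"
  using k_le_dg by (simp add: slack_def)

text \<open>With the new position stored at index \<open>l\<close>, the (slack + 1)-th largest one
  has index \<open>l - slack u\<close>; the program addresses it as
  \<open>offset u + l - (dg u - k)\<close>. Below that length \<open>u\<close> cannot be forced and
  no entry is made.\<close>

lemma push_edge_spec:
  assumes ctx: "const_regs V" "graph_arrs A" "V 9 = int (length bs)" "V 11 = int s" "V 12 = int z"
    and inv: "ghost_inv ss bs xs D Q E" "repr ss bs xs D Q A"
    and z: "z < n + 2 * m" "z \<notin> set xs" "target z = u"
    and s: "s < length ss" "ss ! s \<in> set (nb u)" "\<forall>p\<in>set (Q u). p < s" and L: "n \<le> 2 ^ L"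
    and P: "\<And>V' A' t' xs'. same_except {14..26} V V' \<Longrightarrow> same_except {5, 6, 7} A A' \<Longrightarrow>
      ghost_inv ss bs xs' D (Q(u := Q u @ [s])) E \<Longrightarrow> repr ss bs xs' D (Q(u := Q u @ [s])) A' \<Longrightarrow>
      length xs' \<le> Suc (length xs) \<Longrightarrow> set xs' \<subseteq> insert z (set xs) \<Longrightarrow>
      t' \<le> t + 35 + 9 * int L \<Longrightarrow> P V' A' t'"
  shows "vc push_edge P V A t"
proof -
  define q where "q = Q u @ [s]"
  define Q' where "Q' = Q(u := q)"
  define l where "l = length (Q u)"
  have inv1: "stack_inv ss bs D" "sep_inv ss bs xs" "sound_inv ss bs xs" "cover_inv ss bs xs Q E"
    "queue_inv ss Q" "set xs \<subseteq> {..<n + 2 * m}" using inv(1) by (auto simp: ghost_inv_def)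
  have rep: "stack_arr ss A" "pos_arr ss D A" "base_arr bs A" "queue_arr Q A" "list_arr xs A"
    using inv(2) by (auto simp: repr_def)
  have u: "u < n" using target_less z(1,3) by auto
  have qi: "queue_inv ss Q'" unfolding Q'_def q_def by (rule queue_inv_upd) (use inv1(5) s in auto)
  have ds: "distinct ss" using inv1(1) by (simp add: stack_inv_def)
  \<comment> \<open>The lengthened queue still satisfies \<open>queue_inv\<close>, so the cell about
    to be written belongs to the block of \<open>u\<close>.\<close>
  have l: "l < dg u" using length_queue[OF qi ds u] by (simp add: Q'_def q_def l_def)
  have lss: "length ss \<le> n" using length_ss[OF inv1(1)] by simp
  have Au: "A 1 (int u) = int (dg u)" "A 2 (int u) = int (offset u)" "A 4 (int z) = int u"
    using ctx(2) u z by (auto simp: graph_arrs_def)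
  have A6: "A 6 (int u) = int l" using rep(4) u by (simp add: queue_arr_def l_def)
  define A1 where "A1 = A(7 := (A 7)(int (offset u + l) := int s), 6 := (A 6)(int u := int l + 1))"
  have q1: "queue_arr Q' A1"
    unfolding queue_arr_def
  proof (intro allI impI conjI)
    fix v assume v: "v < n"
    show "A1 6 (int v) = int (length (Q' v))"
      using rep(4) v by (auto simp: A1_def Q'_def q_def l_def queue_arr_def)
    fix i assume i: "i < length (Q' v)"
    show "A1 7 (int (offset v + i)) = int (Q' v ! i)"
    proof (cases "v = u \<and> i = l")
      case True
      then show ?thesis by (simp add: A1_def Q'_def q_def l_def)
    next
      case False
      then have i': "i < length (Q v)" "Q' v ! i = Q v ! i"
        using i by (auto simp: Q'_def q_def l_def nth_append split: if_splits)
      have "offset v + i \<noteq> offset u + l"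
      proof
        assume "offset v + i = offset u + l"
        from offset_inj[OF this _ l] False length_queue[OF inv1(5) ds v] i' show False by auto
      qed
      then show ?thesis using rep(4) v i' by (simp add: A1_def queue_arr_def del: of_nat_add)
    qed
  qed
  have same1: "same_except {5, 6, 7} A A1" by (simp add: A1_def)
  have rep1: "stack_arr ss A1" "pos_arr ss D A1" "base_arr bs A1" "list_arr xs A1"
    using rep by (simp_all add: A1_def)
  define V1 where "V1 = V(14 := int u, 15 := int (offset u), 17 := int (offset u) + int l, 16 := int l + 1,
      18 := int (dg u) - k)"
  have short: "P V1 A1 (17 + t)" if "\<not> int (dg u) - k < int l + 1"
  proof (rule P)
    have "cover_inv ss bs xs Q' E" unfolding Q'_def
      by (rule cover_inv_short[OF inv1(4)]) (use that int_slack[OF u] in \<open>simp add: q_def l_def\<close>)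
    then show "ghost_inv ss bs xs D (Q(u := Q u @ [s])) E"
      using inv1 qi by (simp add: ghost_inv_def Q'_def q_def)
    show "repr ss bs xs D (Q(u := Q u @ [s])) A1"
      using rep1 q1 by (simp add: repr_def Q'_def q_def)
  qed (auto simp: same1 V1_def)
  define p where "p = q ! (length q - 1 - slack u)"
  have long: "vc insert_prog P (V1(17 := int (offset u) + int l - (int (dg u) - k), 19 := int p)) A1 (19 + t)"
    if lt: "int (dg u) - k < int l + 1"
  proof -
    have th: "slack u < length q" using lt int_slack[OF u] by (simp add: q_def l_def)
    then have "p \<in> set (Q' u)" by (simp add: p_def Q'_def)
    then have "p < length ss" using qi u by (auto simp: queue_inv_def)
    show ?thesis
    proof (rule insert_prog_spec[where bs = bs and ss = ss and xs = xs and p = p and z = z and L = L])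
      fix V' A' t' xs'
      assume V': "same_except {20..26} (V1(17 := int (offset u) + int l - (int (dg u) - k), 19 := int p)) V'"
        and A': "same_except {5} A1 A'" and la: "list_arr xs' A'" and xs': "distinct xs'" "set xs' = insert z (set xs)"
        and bf: "\<And>b. b \<in> set bs \<Longrightarrow> before xs' (ss ! b) =
           (if b \<le> p then insert z (before xs (ss ! b)) else before xs (ss ! b))"
        and t': "t' \<le> 19 + t + 15 + 9 * int L"
      show "P V' A' t'"
      proof (rule P)
        have "length xs' = card (set xs')" using xs'(1) by (simp add: distinct_card)
        also have "\<dots> \<le> Suc (length xs)" using xs'(2) z(2) card_length[of xs] by simp
        finally show "length xs' \<le> Suc (length xs)" .
        show "repr ss bs xs' D (Q(u := Q u @ [s])) A'"
          using rep1 q1 la arr_same[OF A'] by (simp add: repr_def Q'_def q_def)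
        show "ghost_inv ss bs xs' D (Q(u := Q u @ [s])) E"
          using insert_entry[OF inv1(1-4) qi[unfolded Q'_def] u th z(3,2) p_def xs' bf] inv1 qi z(1) xs'(2)
          by (auto simp: ghost_inv_def Q'_def q_def)
        show "same_except {14..26} V V'" using V' by (auto simp: same_except_def V1_def)
        show "same_except {5, 6, 7} A A'" using A' same1 by (auto simp: same_except_def)
      qed (use t' xs'(2) in auto)
    qed (use ctx rep1 inv1 z \<open>p < length ss\<close> L graph_arrs_same[OF same1 _ ctx(2)] in \<open>simp_all add: V1_def\<close>)
  qed
  have pA: "A1 7 (int (offset u) + int l - (int (dg u) - k)) = int p" if lt: "int (dg u) - k < int l + 1"
  proof -
    have th: "slack u < length q" using lt int_slack[OF u] by (simp add: q_def l_def)
    define i where "i = length q - 1 - slack u"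
    have "int (offset u) + int l - (int (dg u) - k) = int (offset u + i)" "i < length (Q' u)" "p = Q' u ! i"
      using th int_slack[OF u] by (simp_all add: q_def l_def i_def Q'_def p_def)
    moreover have "A1 7 (int (offset u + i)) = int (Q' u ! i)" if "i < length (Q' u)" for i
      using q1 u that unfolding queue_arr_def by blast
    ultimately show ?thesis by metis
  qed
  have kd: "k \<le> int (dg u)" using k_le_dg[OF u] .
  show ?thesis
    using N_ge ctx(3-5) z(1) u Au A6 l offset_le[OF u] s(1) lss long short pA kd
    apply (simp add: push_edge_def const_regsD[OF ctx(1)] A1_def)
    apply (intro conjI impI wdI)
    apply (simp_all add: V1_def)
    done
qed


definition half_edges :: "nat set \<Rightarrow> nat set" where
  "half_edges X = {x. \<exists>v\<in>X. offset v \<le> x \<and> x < offset v + dg v}"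

lemma push_prog_spec:
  assumes ctx: "const_regs V" "graph_arrs A" "V 8 = int (length ss)" "V 9 = int (length bs)" "V 10 = int v"
    and inv: "ghost_inv ss bs xs D (queue ss) {v}" "repr ss bs xs D (queue ss) A"
    and nodes: "set xs \<subseteq> set ss \<union> half_edges (set ss)"
    and v: "v < n" "v \<notin> D" "v \<notin> set ss" "\<And>i. i < length ss \<Longrightarrow> reach (ss ! i) v"
    and L: "n \<le> 2 ^ L"
    and P: "\<And>V' A' t' xs'. same_except {8..26} V V' \<Longrightarrow> same_except {5..10} A A' \<Longrightarrow>
      V' 8 = int (length (ss @ [v])) \<Longrightarrow> V' 9 = int (length (bs @ [length ss])) \<Longrightarrow>
      ghost_inv (ss @ [v]) (bs @ [length ss]) xs' D (queue (ss @ [v])) {} \<Longrightarrow>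
      repr (ss @ [v]) (bs @ [length ss]) xs' D (queue (ss @ [v])) A' \<Longrightarrow>
      set xs' \<subseteq> set (ss @ [v]) \<union> half_edges (set (ss @ [v])) \<Longrightarrow>
      length xs' \<le> length xs + 1 + dg v \<Longrightarrow>
      t' \<le> t + 20 + (37 + 9 * int L) * int (dg v) \<Longrightarrow> P V' A' t'"
  shows "vc push_prog P V A t"
proof -
  let ?ss = "ss @ [v]" and ?bs = "bs @ [length ss]"
  have inv1: "stack_inv ss bs D" "sep_inv ss bs xs" "sound_inv ss bs xs" "cover_inv ss bs xs (queue ss) {v}"
    "queue_inv ss (queue ss)" "set xs \<subseteq> {..<n + 2 * m}" using inv(1) by (auto simp: ghost_inv_def)
  have rep: "stack_arr ss A" "pos_arr ss D A" "base_arr bs A" "queue_arr (queue ss) A" "list_arr xs A"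
    using inv(2) by (auto simp: repr_def)
  have ssn: "set ss \<subseteq> {..<n}" "distinct ss" using inv1(1) by (auto simp: stack_inv_def)
  \<comment> \<open>Half-edge nodes start at \<open>n\<close>, so the node \<open>v\<close> could be
    in the list only if \<open>v\<close> were on the stack.\<close>
  have "v \<notin> half_edges (set ss)" using v(1) offset_ge by (auto simp: half_edges_def not_le) (meson le_trans not_le)
  then have vx: "v \<notin> set xs" using nodes v(3) by blast
  note pv = push_vertex[OF inv1(1-5) v(1-3) vx v(4)]
  have len: "length ss + card D < n" "length bs \<le> length ss"
    using length_ss[OF pv(1)] length_bs[OF inv1(1)] by auto
  \<comment> \<open>The intermediate queues in which only the first \<open>j\<close> neighbours of
    \<open>v\<close> have recorded the new position; they lead from \<open>queue ss\<close> to
    \<open>queue (ss @ [v])\<close>.\<close>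
  define Qj where "Qj = (\<lambda>j u. queue ss u @ (if u \<in> set (take j (nb v)) then [length ss] else []))"
  define I where "I = (\<lambda>V' A' t'. \<exists>j xs'. same_except {8..26} V V' \<and> same_except {5..10} A A' \<and>
      V' 8 = int (length ?ss) \<and> V' 9 = int (length ?bs) \<and> V' 11 = int (length ss) \<and>
      V' 12 = int (offset v + j) \<and> V' 13 = int (offset v + dg v) \<and> j \<le> dg v \<and>
      ghost_inv ?ss ?bs xs' D (Qj j) {} \<and> repr ?ss ?bs xs' D (Qj j) A' \<and>
      set xs' \<subseteq> set ?ss \<union> half_edges (set ss) \<union> {offset v..<offset v + j} \<and>
      length xs' \<le> length xs + 1 + j \<and> t' \<le> t + 19 + (37 + 9 * int L) * int j)"
  have loop: "vc (Whl 12 13 (push_edge ;; Ad 12 12 0)) P V' A' t'" if "I V' A' t'" for V' A' t'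
    using that
  proof (rule vc_while[where I = I and T = "t + 19 + (37 + 9 * int L) * int (dg v)"])
    fix V' A' t' assume "I V' A' t'"
    then obtain j where "t' \<le> t + 19 + (37 + 9 * int L) * int j" "j \<le> dg v" by (auto simp: I_def)
    moreover have "(37 + 9 * int L) * int j \<le> (37 + 9 * int L) * int (dg v)"
      using \<open>j \<le> dg v\<close> by (intro mult_left_mono) auto
    ultimately show "t' \<le> t + 19 + (37 + 9 * int L) * int (dg v)" by linarith
  next
    fix V' A' t' assume I: "I V' A' t'" and lt: "V' 12 < V' 13"
    then obtain j xs' where i: "same_except {8..26} V V'" "same_except {5..10} A A'"
      "V' 8 = int (length ?ss)" "V' 9 = int (length ?bs)" "V' 11 = int (length ss)"
      "V' 12 = int (offset v + j)" "V' 13 = int (offset v + dg v)" "j < dg v"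
      "ghost_inv ?ss ?bs xs' D (Qj j) {}" "repr ?ss ?bs xs' D (Qj j) A'"
      "set xs' \<subseteq> set ?ss \<union> half_edges (set ss) \<union> {offset v..<offset v + j}"
      "length xs' \<le> length xs + 1 + j" "t' \<le> t + 19 + (37 + 9 * int L) * int j"
      by (auto simp: I_def)
    have ctx': "const_regs V'" using const_regs_same[OF i(1) _ ctx(1)] by simp
    have g': "graph_arrs A'" using graph_arrs_same[OF i(2) _ ctx(2)] by simp
    let ?z = "offset v + j"
    define u where "u = nb v ! j"
    have u: "target ?z = u" "u \<in> set (nb v)" "u \<notin> set (take j (nb v))"
      using target_edge[OF v(1) i(8)] i(8) distinct_nb[of v]
      by (auto simp: u_def in_set_conv_nth nth_eq_iff_index_eq)
    have Qu: "Qj j u = queue ss u" using u(3) by (simp add: Qj_def)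
    have QS: "Qj (Suc j) = (Qj j)(u := Qj j u @ [length ss])"
      using i(8) u(3) by (auto simp: Qj_def take_Suc_conv_app_nth u_def[symmetric])
    have z: "?z < n + 2 * m" "?z \<notin> set xs'"
    proof -
      show "?z < n + 2 * m" using offset_le[OF v(1)] i(8) by simp
      have "?z \<notin> set ?ss" using offset_ge[of v] ssn v(1) by auto
      moreover have "?z \<notin> half_edges (set ss)"
      proof
        assume "?z \<in> half_edges (set ss)"
        then obtain w where w: "w \<in> set ss" "offset w \<le> ?z" "?z < offset w + dg w" by (auto simp: half_edges_def)
        then have "v = w" using offset_inj[of v j w "?z - offset w"] i(8) by simp
        then show False using w(1) v(3) by simp
      qed
      ultimately show "?z \<notin> set xs'" using i(11) by auto
    qed
    show "vc (push_edge ;; Ad 12 12 0) I V' A' (t' + 1)"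
      unfolding vc.simps
    proof (rule push_edge_spec[OF ctx' g' i(4-6,9,10) z u(1) _ _ _ L])
      show "length ss < length ?ss" by simp
      show "?ss ! length ss \<in> set (nb u)" using u(2) nb_sym by simp
      show "\<forall>p\<in>set (Qj j u). p < length ss" unfolding Qu by (auto simp: queue_def)
      fix V2 A2 t2 xs2
      assume 2: "same_except {14..26} V' V2" "same_except {5, 6, 7} A' A2"
        "ghost_inv ?ss ?bs xs2 D ((Qj j)(u := Qj j u @ [length ss])) {}"
        "repr ?ss ?bs xs2 D ((Qj j)(u := Qj j u @ [length ss])) A2"
        "length xs2 \<le> Suc (length xs')" "set xs2 \<subseteq> insert ?z (set xs')"
        "t2 \<le> t' + 1 + 35 + 9 * int L"
      have V2: "V2 8 = int (length ?ss)" "V2 9 = int (length ?bs)" "V2 11 = int (length ss)"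
        "V2 12 = int (offset v + j)" "V2 13 = int (offset v + dg v)" "V2 0 = 1"
        using 2(1) i(3-7) const_regsD(1)[OF ctx'] by (simp_all add: same_except_def)
      have "I (V2(12 := int (offset v + j) + 1)) A2 (t2 + 1)"
        unfolding I_def
      proof (rule exI[of _ "Suc j"], rule exI[of _ xs2], intro conjI)
        show "same_except {8..26} V (V2(12 := int (offset v + j) + 1))"
          using i(1) 2(1) by (auto simp: same_except_def)
        show "same_except {5..10} A A2" using i(2) 2(2) by (auto simp: same_except_def)
        show "set xs2 \<subseteq> set ?ss \<union> half_edges (set ss) \<union> {offset v..<offset v + Suc j}"
        proof -
          have "insert ?z {offset v..<offset v + j} = {offset v..<offset v + Suc j}" by auto
          then show ?thesis using 2(6) i(11) by blast
        qed
        show "ghost_inv ?ss ?bs xs2 D (Qj (Suc j)) {}" "repr ?ss ?bs xs2 D (Qj (Suc j)) A2"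
          using 2(3,4) QS by simp_all
        show "t2 + 1 \<le> t + 19 + (37 + 9 * int L) * int (Suc j)"
          using 2(7) i(13) by (simp add: algebra_simps)
      qed (use V2 2(5) i(8,12) in auto)
      then show "wd (V2 12 + V2 0) \<and> I (V2(12 := V2 12 + V2 0)) A2 (t2 + 1)"
        using N_ge z(1) by (simp add: V2) (intro wdI, auto)
    qed
  next
    fix V' A' t' assume I: "I V' A' t'" and ge: "\<not> V' 12 < V' 13"
    then obtain j xs' where i: "same_except {8..26} V V'" "same_except {5..10} A A'"
      "V' 8 = int (length ?ss)" "V' 9 = int (length ?bs)"
      "V' 12 = int (offset v + j)" "V' 13 = int (offset v + dg v)" "j \<le> dg v"
      "ghost_inv ?ss ?bs xs' D (Qj j) {}" "repr ?ss ?bs xs' D (Qj j) A'"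
      "set xs' \<subseteq> set ?ss \<union> half_edges (set ss) \<union> {offset v..<offset v + j}"
      "length xs' \<le> length xs + 1 + j" "t' \<le> t + 19 + (37 + 9 * int L) * int j"
      by (auto simp: I_def)
    have j: "j = dg v" using ge i(5-7) by simp
    have Q: "Qj (dg v) = queue ?ss" by (auto simp: Qj_def queue_snoc nb_sym fun_eq_iff)
    have "half_edges (set ss) \<union> {offset v..<offset v + j} \<subseteq> half_edges (set ?ss)"
      by (auto simp: half_edges_def j)
    then have "set xs' \<subseteq> set ?ss \<union> half_edges (set ?ss)" using i(10) by blast
    then show "P V' A' (t' + 1)"
      using i unfolding j Q by (intro P[of V' A' xs']) auto
  qed
  define A1 where "A1 = A(8 := (A 8)(int v := int (length ss)), 9 := (A 9)(int (length ss) := int v),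
      10 := (A 10)(int (length bs) := int (length ss)),
      5 := (A 5)(int v := A 5 (int (n + 2 * m)), int (n + 2 * m) := int v))"
  define V1 where "V1 = V(11 := int (length ss), 8 := int (length ss) + 1, 9 := int (length bs) + 1,
      26 := A 5 (int (n + 2 * m)), 12 := int (offset v), 13 := int (offset v) + int (dg v))"
  have "I V1 A1 (19 + t)"
    unfolding I_def
  proof (rule exI[of _ 0], rule exI[of _ "v # xs"], intro conjI)
    show "ghost_inv ?ss ?bs (v # xs) D (Qj 0) {}"
      using pv inv1(6) v(1) by (simp add: ghost_inv_def Qj_def)
    have "stack_arr ?ss A1" using rep(1) by (auto simp: A1_def stack_arr_def nth_append less_Suc_eq)
    moreover have "pos_arr ?ss D A1"
      unfolding pos_arr_def
    proof (intro conjI allI ballI impI)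
      fix i assume i: "i < length ?ss"
      show "A1 8 (int (?ss ! i)) = int i"
      proof (cases "i < length ss")
        case True
        then have "ss ! i \<noteq> v" using v(3) nth_mem by blast
        then show ?thesis using True rep(2) by (simp add: A1_def pos_arr_def nth_append)
      qed (use i in \<open>simp add: A1_def less_Suc_eq\<close>)
    qed (use rep(2) v in \<open>auto simp: A1_def pos_arr_def\<close>)
    moreover have "base_arr ?bs A1" using rep(3) by (auto simp: A1_def base_arr_def nth_append less_Suc_eq)
    moreover have "queue_arr (Qj 0) A1" using rep(4) by (simp add: A1_def Qj_def)
    moreover have "list_arr (v # xs) A1"
      using linked_insert[of "A 5" "[]" "n + 2 * m" xs v] rep(5) inv1(2,6) v(1) vx
      by (auto simp: list_arr_def A1_def sep_inv_def)
    ultimately show "repr ?ss ?bs (v # xs) D (Qj 0) A1" by (simp add: repr_def)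
    show "set (v # xs) \<subseteq> set ?ss \<union> half_edges (set ss) \<union> {offset v..<offset v + 0}" using nodes by auto
  qed (auto simp: A1_def V1_def)
  then have I1: "vc (Whl 12 13 (push_edge ;; Ad 12 12 0)) P V1 A1 (19 + t)" by (rule loop)
  have Av: "A 2 (int v) = int (offset v)" "A 3 (int v) = int (offset v) + int (dg v)"
    using ctx(2) v(1) by (auto simp: graph_arrs_def)
  show ?thesis
    using N_ge ctx(3-5) v(1) len Av I1
    apply (simp add: push_prog_def const_regsD[OF ctx(1)] A1_def V1_def)
    apply (intro conjI impI wdI)
    apply simp_all
    done
qed

end

section \<open>Merging, discarding and output\<close>

definition merge_prog :: cmd where
  "merge_prog = Su 14 9 0 ;; Ld 15 10 14 ;; Whl 12 15 (Su 9 9 0 ;; Su 14 9 0 ;; Ld 15 10 14)"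

definition clear_vertex :: cmd where
  "clear_vertex = Ld 13 9 12 ;; St 8 13 3 ;; Ld 14 2 13 ;; Ld 15 3 13 ;;
     Whl 14 15 (Ld 16 4 14 ;; St 6 16 1 ;; Ad 14 14 0)"

definition clear_prog :: cmd where
  "clear_prog = Con 12 0 ;; Whl 12 8 (clear_vertex ;; Ad 12 12 0) ;; Ad 8 1 1 ;; Ad 9 1 1"

definition emit_prog :: cmd where
  "emit_prog = Su 14 8 13 ;; St 12 6 14 ;; Ad 6 6 0 ;; Ad 12 13 1 ;;
     Whl 12 8 (Ld 14 9 12 ;; St 12 6 14 ;; Ad 6 6 0 ;; Ad 12 12 0) ;; Ad 7 7 0"

text \<open>The offset 1 leaves cell 0 for the number of sets, which is known only at the
  end.\<close>

definition out_arr :: "nat list \<Rightarrow> arrs \<Rightarrow> bool" where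
  "out_arr os A \<longleftrightarrow> (\<forall>i<length os. A 12 (1 + int i) = int (os ! i))"

lemma out_arr_upd [simp]: "a \<noteq> 12 \<Longrightarrow> out_arr os (A(a := f)) = out_arr os A"
  by (simp add: out_arr_def)

lemma out_arr_same: "same_except X A A' \<Longrightarrow> 12 \<notin> X \<Longrightarrow> out_arr os A' = out_arr os A"
  by (auto simp: out_arr_def same_except_def)

lemma out_arr_snoc: "out_arr os A \<Longrightarrow> out_arr (os @ [x]) (A(12 := (A 12)(1 + int (length os) := int x)))"
  by (auto simp: out_arr_def nth_append less_Suc_eq)

context ram_graph
begin

text \<open>Bases are dropped by \<open>merge_top\<close> while \<open>p\<close> is below the last
  one, at the latest until base 0 is left. Then \<open>ss ! p\<close> belongs to the top cluster and
  \<open>cover_inv_on_stack\<close> lifts its exemption. Each round takes 5 steps and drops one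
  base, hence the amortised form of the bound.\<close>

lemma merge_prog_spec:
  assumes ctx: "const_regs V" "V 9 = int (length bs)" "V 12 = int p"
    and inv: "ghost_inv ss bs xs D Q {ss ! p}" "repr ss bs xs D Q A"
    and p: "p < length ss" "\<And>i. i < length ss \<Longrightarrow> reach (ss ! i) (ss ! p)"
    and P: "\<And>V' t' bs'. same_except {9, 14, 15} V V' \<Longrightarrow> V' 9 = int (length bs') \<Longrightarrow>
      ghost_inv ss bs' xs D Q {} \<Longrightarrow> repr ss bs' xs D Q A \<Longrightarrow>
      t' + 5 * int (length bs') \<le> t + 4 + 5 * int (length bs) \<Longrightarrow> length bs' \<le> length bs \<Longrightarrow> P V' A t'"
  shows "vc merge_prog P V A t"
proof -
  define I where "I = (\<lambda>V' A' t'. \<exists>bs'. same_except {9, 14, 15} V V' \<and> A' = A \<and> V' 9 = int (length bs') \<and>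
    V' 15 = int (last bs') \<and> bs' \<noteq> [] \<and> length bs' \<le> n \<and> length bs' \<le> length bs \<and>
    ghost_inv ss bs' xs D Q {ss ! p} \<and> repr ss bs' xs D Q A \<and>
    t' + 5 * int (length bs') \<le> t + 3 + 5 * int (length bs))"
  have loop: "vc (Whl 12 15 (Su 9 9 0 ;; Su 14 9 0 ;; Ld 15 10 14)) P V' A' t'" if "I V' A' t'" for V' A' t'
    using that
  proof (rule vc_while[where I = I and T = "t + 3 + 5 * int (length bs)"])
    fix V' A' t' assume "I V' A' t'"
    then show "t' \<le> t + 3 + 5 * int (length bs)" by (auto simp: I_def)
  next
    fix V' A' t' assume I: "I V' A' t'" and lt: "V' 12 < V' 15"
    then obtain bs' where i: "same_except {9, 14, 15} V V'" "A' = A" "V' 9 = int (length bs')"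
      "V' 15 = int (last bs')" "length bs' \<le> n" "length bs' \<le> length bs"
      "ghost_inv ss bs' xs D Q {ss ! p}" "repr ss bs' xs D Q A"
      "t' + 5 * int (length bs') \<le> t + 3 + 5 * int (length bs)"
      by (auto simp: I_def)
    have ctx': "const_regs V'" using const_regs_same[OF i(1) _ ctx(1)] by simp
    have lt': "p < last bs'" using lt i(1,4) ctx(3) by (simp add: same_except_def)
    define cs where "cs = butlast bs'"
    have g: "ghost_inv ss cs xs D Q {ss ! p}" "cs \<noteq> []"
      using merge_top[of ss bs' D xs Q "{ss ! p}" p] i(7) lt' p by (auto simp: ghost_inv_def cs_def)
    have r: "repr ss cs xs D Q A" using i(8) by (auto simp: repr_def base_arr_def cs_def nth_butlast)
    have lc: "length cs = length bs' - 1" by (simp add: cs_def)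
    have "length bs' \<ge> 2" using g(2) lc by (cases cs) auto
    then have len: "int (length bs') - 1 = int (length cs)" "int (length cs) - 1 = int (length cs - 1)"
      "length cs \<ge> 1" using lc by auto
    have b: "A 10 (int (length cs) - 1) = int (last cs)"
      unfolding len(2) using r g(2) by (auto simp: repr_def base_arr_def last_conv_nth)
    have "I (V'(9 := int (length cs), 14 := int (length cs) - 1, 15 := int (last cs))) A (5 + t')"
      unfolding I_def by (rule exI[of _ cs]) (use i g r len in \<open>auto simp: same_except_def\<close>)
    then show "vc (Su 9 9 0 ;; Su 14 9 0 ;; Ld 15 10 14) I V' A' (t' + 1)"
      using N_ge i(2-5) len(1,3) b g(2)
      apply (simp add: const_regsD[OF ctx'])
      apply (intro conjI impI wdI)
      apply simp_all
      done
  next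
    fix V' A' t' assume I: "I V' A' t'" and ge: "\<not> V' 12 < V' 15"
    then obtain bs' where i: "same_except {9, 14, 15} V V'" "A' = A" "V' 9 = int (length bs')"
      "V' 15 = int (last bs')" "length bs' \<le> length bs"
      "ghost_inv ss bs' xs D Q {ss ! p}" "repr ss bs' xs D Q A"
      "t' + 5 * int (length bs') \<le> t + 3 + 5 * int (length bs)"
      by (auto simp: I_def)
    have "last bs' \<le> p" using ge i(1,4) ctx(3) by (simp add: same_except_def)
    then have "ghost_inv ss bs' xs D Q {}"
      using i(6) cover_inv_on_stack[of ss bs' xs Q p] p(1) by (auto simp: ghost_inv_def stack_inv_def)
    then show "P V' A' (t' + 1)" unfolding i(2) by (intro P[of _ bs']) (use i in auto)
  qed
  have bs: "bs \<noteq> []" "length bs \<le> n" using inv(1) p(1) length_ss[of ss bs D] length_bs[of ss bs D]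
    by (auto simp: ghost_inv_def stack_inv_def)
  have len: "int (length bs) - 1 = int (length bs - 1)" using bs by (cases bs) auto
  have b: "A 10 (int (length bs) - 1) = int (last bs)"
    unfolding len using inv(2) bs by (auto simp: repr_def base_arr_def last_conv_nth)
  have "I (V(14 := int (length bs) - 1, 15 := int (last bs))) A (3 + t)"
    unfolding I_def by (rule exI[of _ bs]) (use ctx inv bs in \<open>auto simp: same_except_def\<close>)
  from loop[OF this] show ?thesis
    using N_ge ctx(2,3) b bs
    apply (simp add: merge_prog_def const_regsD[OF ctx(1)])
    apply (intro conjI impI wdI)
    apply (simp_all add: Suc_le_eq)
    done
qed

text \<open>The number of list nodes owned by the vertices: each vertex itself and the half-edges
  leaving it.\<close>

definition list_weight :: "nat list \<Rightarrow> nat" where "list_weight vs = sum_list (map (\<lambda>v. Suc (dg v)) vs)"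

lemma list_weight_take: "i < length ss \<Longrightarrow> list_weight (take (Suc i) ss) = list_weight (take i ss) + Suc (dg (ss ! i))"
  by (simp add: list_weight_def take_Suc_conv_app_nth)

lemma list_weight_take_le: "list_weight (take i ss) \<le> list_weight ss"
proof -
  have "list_weight ss = list_weight (take i ss) + list_weight (drop i ss)"
    by (simp add: list_weight_def flip: sum_list_append map_append)
  then show ?thesis by simp
qed

lemma clear_vertex_spec:
  assumes ctx: "const_regs V" "graph_arrs A" "V 12 = int i"
    and A: "stack_arr ss A" "i < length ss" "length ss \<le> n" "ss ! i = v" "v < n"
    and P: "\<And>V' A' t'. same_except {13..16} V V' \<Longrightarrow> same_except {6, 8} A A' \<Longrightarrow>
      A' 8 = (A 8)(int v := int n) \<Longrightarrow> (\<forall>u\<in>set (nb v). A' 6 (int u) = 0) \<Longrightarrow>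
      (\<forall>u. A' 6 u = 0 \<or> A' 6 u = A 6 u) \<Longrightarrow> t' \<le> t + 9 + 6 * int (dg v) \<Longrightarrow> P V' A' t'"
  shows "vc clear_vertex P V A t"
proof -
  define I where "I = (\<lambda>V' A' t'. \<exists>j. same_except {13..16} V V' \<and> same_except {6, 8} A A' \<and> j \<le> dg v \<and>
    V' 14 = int (offset v + j) \<and> V' 15 = int (offset v + dg v) \<and>
    A' 8 = (A 8)(int v := int n) \<and> (\<forall>u\<in>set (take j (nb v)). A' 6 (int u) = 0) \<and>
    (\<forall>u. A' 6 u = 0 \<or> A' 6 u = A 6 u) \<and> t' \<le> t + 8 + 6 * int j)"
  have loop: "vc (Whl 14 15 (Ld 16 4 14 ;; St 6 16 1 ;; Ad 14 14 0)) P V' A' t'" if "I V' A' t'" for V' A' t'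
    using that
  proof (rule vc_while[where I = I and T = "t + 8 + 6 * int (dg v)"])
    fix V' A' t' assume "I V' A' t'"
    then show "t' \<le> t + 8 + 6 * int (dg v)" by (auto simp: I_def)
  next
    fix V' A' t' assume I: "I V' A' t'" and lt: "V' 14 < V' 15"
    then obtain j where j: "same_except {13..16} V V'" "same_except {6, 8} A A'" "j < dg v"
      "V' 14 = int (offset v + j)" "V' 15 = int (offset v + dg v)"
      "A' 8 = (A 8)(int v := int n)" "\<forall>u\<in>set (take j (nb v)). A' 6 (int u) = 0"
      "\<forall>u. A' 6 u = 0 \<or> A' 6 u = A 6 u" "t' \<le> t + 8 + 6 * int j"
      by (auto simp: I_def)
    have ctx': "const_regs V'" using const_regs_same[OF j(1) _ ctx(1)] by simp
    have g': "graph_arrs A'" using graph_arrs_same[OF j(2) _ ctx(2)] by simp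
    define u where "u = nb v ! j"
    have u: "A' 4 (int (offset v + j)) = int u"
      using g' offset_le[OF A(5)] j(3) target_edge[OF A(5) j(3)] by (simp add: graph_arrs_def u_def del: of_nat_add)
    have "u \<in> set (nb v)" using j(3) by (simp add: u_def)
    then have un: "u < n" using nb_props by blast
    have t1: "take (Suc j) (nb v) = take j (nb v) @ [u]" using j(3) by (simp add: u_def take_Suc_conv_app_nth)
    have "I (V'(16 := int u, 14 := int (offset v + j) + 1)) (A'(6 := (A' 6)(int u := 0))) (6 + t')"
      unfolding I_def by (rule exI[of _ "Suc j"]) (use j t1 in auto)
    then show "vc (Ld 16 4 14 ;; St 6 16 1 ;; Ad 14 14 0) I V' A' (t' + 1)"
      using N_ge j(3-5) u un offset_le[OF A(5)]
      apply (simp add: const_regsD[OF ctx'])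
      apply (intro conjI impI wdI)
      apply simp_all
      done
  next
    fix V' A' t' assume I: "I V' A' t'" and "\<not> V' 14 < V' 15"
    then obtain j where "same_except {13..16} V V'" "same_except {6, 8} A A'" "j = dg v"
      "A' 8 = (A 8)(int v := int n)" "\<forall>u\<in>set (take j (nb v)). A' 6 (int u) = 0"
      "\<forall>u. A' 6 u = 0 \<or> A' 6 u = A 6 u" "t' \<le> t + 8 + 6 * int j"
      by (auto simp: I_def)
    then show "P V' A' (t' + 1)" by (intro P) simp_all
  qed
  have s: "A 9 (int i) = int v" using A(1,2,4) by (simp add: stack_arr_def)
  have av: "A 2 (int v) = int (offset v)" "A 3 (int v) = int (offset v) + int (dg v)"
    using ctx(2) A(5) by (auto simp: graph_arrs_def)
  have "I (V(13 := int v, 14 := int (offset v), 15 := int (offset v) + int (dg v))) (A(8 := (A 8)(int v := int n))) (8 + t)"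
    unfolding I_def by (rule exI[of _ 0]) (use ctx in auto)
  from loop[OF this] show ?thesis
    using N_ge ctx(3) s A(2,3,5) av
    by (simp add: clear_vertex_def const_regsD[OF ctx(1)])
qed

text \<open>A queue is nonempty only if a neighbour is on the stack, so zeroing the queue lengths of
  all neighbours of stack vertices resets every queue in time proportional to the half-edges
  involved. Stack, bases and list need no cleaning: with the heights at zero nothing is claimed
  about their contents.\<close>

lemma clear_prog_spec:
  assumes ctx: "const_regs V" "graph_arrs A" "V 8 = int (length ss)"
    and inv: "stack_inv ss bs D" "repr ss bs xs D (queue ss) A"
    and P: "\<And>V' A' t'. same_except {8, 9, 12, 13, 14, 15, 16} V V' \<Longrightarrow> same_except {6, 8} A A' \<Longrightarrow>
      V' 8 = 0 \<Longrightarrow> V' 9 = 0 \<Longrightarrow> repr [] [] [] (D \<union> set ss) (queue []) A' \<Longrightarrow>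
      t' \<le> t + 4 + 11 * int (list_weight ss) \<Longrightarrow> P V' A' t'"
  shows "vc clear_prog P V A t"
proof -
  have rep: "stack_arr ss A" "pos_arr ss D A" "queue_arr (queue ss) A" using inv(2) by (auto simp: repr_def)
  have ss: "distinct ss" "set ss \<union> D \<subseteq> {..<n}" "set ss \<inter> D = {}" using inv(1) by (auto simp: stack_inv_def)
  have len: "length ss \<le> n" using length_ss[OF inv(1)] by simp
  define I where "I = (\<lambda>V' A' t'. \<exists>i. same_except {12..16} V V' \<and> same_except {6, 8} A A' \<and>
    i \<le> length ss \<and> V' 12 = int i \<and>
    (\<forall>u<n. A' 8 (int u) = (if u \<in> set (take i ss) then int n else A 8 (int u))) \<and>
    (\<forall>v\<in>set (take i ss). \<forall>u\<in>set (nb v). A' 6 (int u) = 0) \<and>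
    (\<forall>u. A' 6 u = 0 \<or> A' 6 u = A 6 u) \<and> t' \<le> t + 1 + 11 * int (list_weight (take i ss)))"
  have loop: "vc (Whl 12 8 (clear_vertex ;; Ad 12 12 0)) (vc (Ad 8 1 1 ;; Ad 9 1 1) P) V' A' t'"
    if "I V' A' t'" for V' A' t'
    using that
  proof (rule vc_while[where I = I and T = "t + 1 + 11 * int (list_weight ss)"])
    fix V' A' t' assume "I V' A' t'"
    then obtain i where "t' \<le> t + 1 + 11 * int (list_weight (take i ss))" by (auto simp: I_def)
    then show "t' \<le> t + 1 + 11 * int (list_weight ss)" using list_weight_take_le[of i ss] by linarith
  next
    fix V' A' t' assume I: "I V' A' t'" and lt: "V' 12 < V' 8"
    then obtain i where i: "same_except {12..16} V V'" "same_except {6, 8} A A'" "i < length ss"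
      "V' 12 = int i"
      "\<forall>u<n. A' 8 (int u) = (if u \<in> set (take i ss) then int n else A 8 (int u))"
      "\<forall>v\<in>set (take i ss). \<forall>u\<in>set (nb v). A' 6 (int u) = 0"
      "\<forall>u. A' 6 u = 0 \<or> A' 6 u = A 6 u" "t' \<le> t + 1 + 11 * int (list_weight (take i ss))"
      using ctx(3) by (auto simp: I_def same_except_def)
    have ctx': "const_regs V'" using const_regs_same[OF i(1) _ ctx(1)] by simp
    have g': "graph_arrs A'" using graph_arrs_same[OF i(2) _ ctx(2)] by simp
    have s': "stack_arr ss A'" using arr_same(1)[OF i(2)] rep(1) by simp
    define v where "v = ss ! i"
    have v: "v < n" using ss(2) i(3) by (auto simp: v_def dest: nth_mem)
    have t1: "take (Suc i) ss = take i ss @ [v]" using i(3) by (simp add: v_def take_Suc_conv_app_nth)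
    show "vc (clear_vertex ;; Ad 12 12 0) I V' A' (t' + 1)"
      unfolding vc.simps(7)
    proof (rule clear_vertex_spec[OF ctx' g' i(4) s' i(3) len v_def[symmetric] v])
      fix V2 A2 t2
      assume 2: "same_except {13..16} V' V2" "same_except {6, 8} A' A2" "A2 8 = (A' 8)(int v := int n)"
        "\<forall>u\<in>set (nb v). A2 6 (int u) = 0" "\<forall>u. A2 6 u = 0 \<or> A2 6 u = A' 6 u"
        "t2 \<le> t' + 1 + 9 + 6 * int (dg v)"
      have V2: "V2 12 = int i" "V2 0 = 1" using 2(1) i(4) const_regsD(1)[OF ctx']
        by (simp_all add: same_except_def)
      have "I (V2(12 := int i + 1)) A2 (t2 + 1)"
        unfolding I_def
      proof (rule exI[of _ "Suc i"], intro conjI)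
        show "same_except {12..16} V (V2(12 := int i + 1))"
          using i(1) 2(1) by (auto simp: same_except_def)
        show "same_except {6, 8} A A2" using i(2) 2(2) by (auto simp: same_except_def)
        show "\<forall>u<n. A2 8 (int u) = (if u \<in> set (take (Suc i) ss) then int n else A 8 (int u))"
          using i(5) 2(3) by (auto simp: t1)
        show "\<forall>w\<in>set (take (Suc i) ss). \<forall>u\<in>set (nb w). A2 6 (int u) = 0"
          using i(6) 2(4,5) unfolding t1 by (metis Un_iff empty_iff insert_iff list.set(1,2) set_append)
        show "\<forall>u. A2 6 u = 0 \<or> A2 6 u = A 6 u" using i(7) 2(5) by metis
        show "t2 + 1 \<le> t + 1 + 11 * int (list_weight (take (Suc i) ss))"
          using 2(6) i(8) by (simp add: list_weight_take[OF i(3)] v_def)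
      qed (use i in auto)
      then show "vc (Ad 12 12 0) I V2 A2 t2"
        using N_ge i(3) len by (auto simp: V2 intro!: wdI)
    qed
  next
    fix V' A' t' assume I: "I V' A' t'" and ge: "\<not> V' 12 < V' 8"
    then obtain i where i: "same_except {12..16} V V'" "same_except {6, 8} A A'" "i = length ss"
      "\<forall>u<n. A' 8 (int u) = (if u \<in> set ss then int n else A 8 (int u))"
      "\<forall>v\<in>set ss. \<forall>u\<in>set (nb v). A' 6 (int u) = 0"
      "\<forall>u. A' 6 u = 0 \<or> A' 6 u = A 6 u" "t' \<le> t + 1 + 11 * int (list_weight ss)"
      using ctx(3) by (fastforce simp: I_def same_except_def)
    have ctx': "const_regs V'" using const_regs_same[OF i(1) _ ctx(1)] by simp
    have q: "A' 6 (int u) = 0" if u: "u < n" for u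
    proof (cases "\<exists>v\<in>set ss. u \<in> set (nb v)")
      case True
      then show ?thesis using i(5) by blast
    next
      case False
      then have "queue ss u = []" using nb_sym by (auto simp: queue_def filter_empty_conv)
      then show ?thesis using i(6) rep(3) u by (metis queue_arr_def list.size(3) of_nat_0)
    qed
    have "pos_arr [] (D \<union> set ss) A'"
      using i(4) rep(2) ss(2,3) unfolding pos_arr_def by auto
    then have "repr [] [] [] (D \<union> set ss) (queue []) A'"
      using q by (auto simp: repr_def stack_arr_def base_arr_def queue_arr_def list_arr_def)
    then have "P (V'(8 := 0, 9 := 0)) A' (3 + t')"
      using i by (intro P) (auto simp: same_except_def)
    then show "vc (Ad 8 1 1 ;; Ad 9 1 1) P V' A' (t' + 1)"
      using N_ge by (simp add: const_regsD[OF ctx']) (intro wdI, auto)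
  qed
  have "I (V(12 := 0)) A (t + 1)"
    unfolding I_def by (rule exI[of _ 0]) (auto simp: list_weight_def)
  from loop[OF this] show ?thesis
    using N_ge by (simp add: clear_prog_def) (intro wdI, auto)
qed

lemma emit_prog_spec:
  assumes ctx: "const_regs V" "V 8 = int (length ss)" "V 13 = int b" "V 6 = 1 + int (length os)"
      "V 7 = int c"
    and A: "stack_arr ss A" "out_arr os A" and len: "b \<le> length ss" "length ss \<le> n"
      "length os + length ss \<le> 2 * n" "c \<le> n"
    and P: "\<And>V' A' t'. same_except {6, 7, 12, 14} V V' \<Longrightarrow> same_except {12} A A' \<Longrightarrow>
      V' 6 = 1 + int (length (os @ (length ss - b) # drop b ss)) \<Longrightarrow> V' 7 = int c + 1 \<Longrightarrow>
      out_arr (os @ (length ss - b) # drop b ss) A' \<Longrightarrow>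
      t' \<le> t + 7 + 7 * int (length ss) \<Longrightarrow> P V' A' t'"
  shows "vc emit_prog P V A t"
proof -
  define I where "I = (\<lambda>V' A' t'. \<exists>j. same_except {6, 12, 14} V V' \<and> same_except {12} A A' \<and>
    j \<le> length ss - b \<and> V' 12 = int (b + j) \<and> V' 6 = 1 + int (length os + 1 + j) \<and>
    out_arr (os @ (length ss - b) # take j (drop b ss)) A' \<and> t' \<le> t + 5 + 7 * int j)"
  have loop: "vc (Whl 12 8 (Ld 14 9 12 ;; St 12 6 14 ;; Ad 6 6 0 ;; Ad 12 12 0)) (vc (Ad 7 7 0) P) V' A' t'"
    if "I V' A' t'" for V' A' t'
    using that
  proof (rule vc_while[where I = I and T = "t + 5 + 7 * int (length ss)"])
    fix V' A' t' assume "I V' A' t'"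
    then show "t' \<le> t + 5 + 7 * int (length ss)" by (auto simp: I_def)
  next
    fix V' A' t' assume I: "I V' A' t'" and lt: "V' 12 < V' 8"
    then obtain j where j: "same_except {6, 12, 14} V V'" "same_except {12} A A'"
      "V' 12 = int (b + j)" "V' 6 = 1 + int (length os + 1 + j)"
      "out_arr (os @ (length ss - b) # take j (drop b ss)) A'" "t' \<le> t + 5 + 7 * int j"
      by (auto simp: I_def)
    have jl: "j < length ss - b" using lt j(1,3) ctx(2) by (simp add: same_except_def)
    have ctx': "const_regs V'" using const_regs_same[OF j(1) _ ctx(1)] by simp
    define v where "v = ss ! (b + j)"
    have v: "A' 9 (int (b + j)) = int v"
    proof -
      have "stack_arr ss A'" "b + j < length ss" using arr_same(1)[OF j(2)] A(1) jl by simp_all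
      then show ?thesis unfolding stack_arr_def v_def by blast
    qed
    have t1: "take (Suc j) (drop b ss) = take j (drop b ss) @ [v]"
      using jl by (simp add: take_Suc_conv_app_nth v_def)
    have "out_arr (os @ (length ss - b) # take (Suc j) (drop b ss))
      (A'(12 := (A' 12)(1 + int (length os + 1 + j) := int v)))"
      using out_arr_snoc[OF j(5), of v] jl by (simp add: t1 algebra_simps)
    then have "I (V'(14 := int v, 6 := 2 + int (length os + 1 + j), 12 := int (b + j) + 1))
      (A'(12 := (A' 12)(1 + int (length os + 1 + j) := int v))) (7 + t')"
      unfolding I_def by (intro exI[of _ "Suc j"]) (use j jl in \<open>auto simp: same_except_def\<close>)
    then show "vc (Ld 14 9 12 ;; St 12 6 14 ;; Ad 6 6 0 ;; Ad 12 12 0) I V' A' (t' + 1)"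
      using N_ge j(3,4) jl v len
      apply (simp add: const_regsD[OF ctx'])
      apply (intro conjI impI wdI)
      apply (simp_all add: algebra_simps)
      done
  next
    fix V' A' t' assume I: "I V' A' t'" and ge: "\<not> V' 12 < V' 8"
    then obtain j where j: "same_except {6, 12, 14} V V'" "same_except {12} A A'" "j = length ss - b"
      "V' 6 = 1 + int (length os + 1 + j)"
      "out_arr (os @ (length ss - b) # take j (drop b ss)) A'" "t' \<le> t + 5 + 7 * int j"
      using ctx(2) by (auto simp: I_def same_except_def)
    have ctx': "const_regs V'" using const_regs_same[OF j(1) _ ctx(1)] by simp
    have V7: "V' 7 = int c" using j(1) ctx(5) by (simp add: same_except_def)
    have "P (V'(7 := int c + 1)) A' (2 + t')"
      using j by (intro P) (auto simp: same_except_def)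
    then show "vc (Ad 7 7 0) P V' A' (t' + 1)"
      using N_ge len(4) by (simp add: const_regsD[OF ctx'] V7) (intro wdI, auto)
  qed
  have "I (V(14 := int (length ss) - int b, 6 := 2 + int (length os), 12 := int b))
      (A(12 := (A 12)(1 + int (length os) := int (length ss) - int b))) (5 + t)"
    unfolding I_def
    by (rule exI[of _ 0]) (use out_arr_snoc[OF A(2), of "length ss - b"] len(1) in \<open>auto simp: of_nat_diff\<close>)
  from loop[OF this] show ?thesis
    using N_ge ctx(2-5) len
    apply (simp add: emit_prog_def const_regsD[OF ctx(1)])
    apply (intro conjI impI wdI)
    apply (simp_all add: algebra_simps)
    done
qed

end

section \<open>The search\<close>

definition visit_prog :: cmd where
  "visit_prog = Ite 12 1 push_prog (Ite 12 3 merge_prog clear_prog)"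

definition close_prog :: cmd where
  "close_prog = emit_prog ;; clear_prog"

text \<open>The machine only tests for less-than, so two tests set variable 16 to tell whether the
  head of the list differs from the base vertex of the top cluster.\<close>

definition dfs_step :: cmd where
  "dfs_step = Su 12 9 0 ;; Ld 13 10 12 ;; Ld 14 9 13 ;; Ld 15 5 4 ;; Con 16 0 ;;
     Ite 15 14 (Con 16 1) Nop ;; Ite 14 15 (Con 16 1) Nop ;;
     Ite 1 16 (Ld 17 5 15 ;; St 5 4 17 ;; Ld 10 4 15 ;; Ld 12 8 10 ;; visit_prog)
     close_prog"

definition dfs_prog :: cmd where
  "dfs_prog = Whl 1 8 dfs_step"

definition search_prog :: cmd where
  "search_prog = Con 5 0 ;; Con 6 1 ;; Con 7 0 ;; Con 8 0 ;; Con 9 0 ;;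
     Whl 5 3 (Ad 10 5 1 ;; Ld 12 8 10 ;; Ite 12 1 (push_prog ;; dfs_prog) Nop ;; Ad 5 5 0) ;; St 12 1 7"

definition out_list :: "nat list list \<Rightarrow> nat list" where
  "out_list Ys = concat (map (\<lambda>Y. length Y # Y) Ys)"

lemma out_list_simps [simp]:
  "out_list [] = []" "out_list (Ys @ [Y]) = out_list Ys @ length Y # Y"
  by (simp_all add: out_list_def)

context ram_graph
begin

text \<open>An output set takes one word more than its size, at most twice its size as it is
  nonempty; its members are discarded along with it. This is where the length bound comes
  from.\<close>

definition done_inv :: "nat set \<Rightarrow> nat list list \<Rightarrow> bool" where
  "done_inv D Ys \<longleftrightarrow> D \<subseteq> {..<n} \<and> (\<forall>v\<in>D. \<exists>Y\<in>set Ys. \<forall>y\<in>set Y. reach v y) \<and>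
     (\<forall>Y\<in>set Ys. distinct Y \<and> set Y \<subseteq> D \<and> set Y \<in> MinRSs k G) \<and> distinct (map set Ys) \<and>
     length (out_list Ys) \<le> 2 * card D"

text \<open>Every stack vertex reaches \<open>u\<close>, which reaches a set already output;
  transitivity does the rest.\<close>

lemma done_inv_abort:
  assumes "done_inv D Ys" "stack_inv ss bs D" "u \<in> D" "\<And>i. i < length ss \<Longrightarrow> reach (ss ! i) u"
  shows "done_inv (D \<union> set ss) Ys"
  unfolding done_inv_def
proof (intro conjI ballI)
  have D: "finite D" "D \<subseteq> {..<n}" using assms(1) by (auto simp: done_inv_def finite_subset)
  obtain Y where Y: "Y \<in> set Ys" "\<forall>y\<in>set Y. reach u y" using assms(1,3) by (auto simp: done_inv_def)
  show "\<exists>Y\<in>set Ys. \<forall>y\<in>set Y. reach v y" if "v \<in> D \<union> set ss" for v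
  proof (cases "v \<in> D")
    case True
    then show ?thesis using assms(1) by (auto simp: done_inv_def)
  next
    case False
    then have "reach v u" using that assms(4) by (auto simp: in_set_conv_nth)
    then show ?thesis using Y reach_trans by blast
  qed
  show "D \<union> set ss \<subseteq> {..<n}" using assms(2) by (auto simp: stack_inv_def)
  show "length (out_list Ys) \<le> 2 * card (D \<union> set ss)"
    using assms(1) card_mono[of "D \<union> set ss" D] D by (auto simp: done_inv_def)
qed (use assms(1) in \<open>auto simp: done_inv_def\<close>)

text \<open>The whole stack reaches its top cluster, which is a MinRS by
  \<open>closed_MinRS\<close>. It is new because earlier sets lie inside \<open>D\<close>, which is
  disjoint from the stack.\<close>

lemma done_inv_emit:
  assumes d: "done_inv D Ys" and st: "stack_inv ss bs D" and ne: "ss \<noteq> []"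
    and cov: "cover_inv ss bs (ss ! last bs # xs) (queue ss) {}"
  shows "done_inv (D \<union> set ss) (Ys @ [drop (last bs) ss])"
proof -
  let ?Y = "drop (last bs) ss"
  have st': "distinct ss" "set ss \<union> D \<subseteq> {..<n}" "set ss \<inter> D = {}" "last bs < length ss"
    using st ne by (auto simp: stack_inv_def)
  have D: "finite D" using d by (auto simp: done_inv_def finite_subset)
  have M: "set ?Y \<in> MinRSs k G" by (rule closed_MinRS[OF st ne cov])
  have sub: "set ?Y \<subseteq> set ss" by (auto dest: in_set_dropD)
  show ?thesis
    unfolding done_inv_def
  proof (intro conjI ballI)
    fix v assume v: "v \<in> D \<union> set ss"
    show "\<exists>Y\<in>set (Ys @ [?Y]). \<forall>y\<in>set Y. reach v y"
    proof (cases "v \<in> D")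
      case True
      then show ?thesis using d by (auto simp: done_inv_def)
    next
      case False
      then obtain i where i: "i < length ss" "v = ss ! i" using v by (auto simp: in_set_conv_nth)
      have "\<forall>y\<in>set ?Y. reach v y"
      proof
        fix y assume "y \<in> set ?Y"
        then obtain j where "y = ss ! (last bs + j)" "last bs + j < length ss"
          by (auto simp: in_set_conv_nth less_diff_conv add.commute)
        then show "reach v y" using stack_inv_last_reach[OF st i(1)] i(2) by simp
      qed
      then show ?thesis by simp
    qed
  next
    have "set ?Y \<noteq> set Y" if "Y \<in> set Ys" for Y
    proof
      assume "set ?Y = set Y"
      then have "set ?Y \<subseteq> D" using d that by (auto simp: done_inv_def)
      then have "set ?Y \<subseteq> set ss \<inter> D" using sub by blast
      then have "set ?Y = {}" using st'(3) by simp
      then show False using st'(4) by simp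
    qed
    then show "distinct (map set (Ys @ [?Y]))" using d by (auto simp: done_inv_def)
    have "card (D \<union> set ss) = card D + length ss"
      using D st'(1,3) by (simp add: card_Un_disjoint Int_commute distinct_card)
    then show "length (out_list (Ys @ [?Y])) \<le> 2 * card (D \<union> set ss)"
    proof -
      have "length (out_list Ys) \<le> 2 * card D" using d by (simp add: done_inv_def)
      with \<open>card _ = _\<close> st'(4) show ?thesis by simp
    qed
  next
    fix Y assume Y: "Y \<in> set (Ys @ [?Y])"
    then show "distinct Y" "set Y \<in> MinRSs k G" using d M st'(1) by (auto simp: done_inv_def)
    show "set Y \<subseteq> D \<union> set ss"
    proof (cases "Y \<in> set Ys")
      case True
      then show ?thesis using d by (auto simp: done_inv_def)
    next
      case False
      then show ?thesis using Y sub by auto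
    qed
  qed (use st'(2) in auto)
qed

section \<open>Amortised running time of the search\<close>

definition set_weight :: "nat set \<Rightarrow> nat" where "set_weight X = (\<Sum>v\<in>X. Suc (dg v))"

lemma set_weight_Un:
  "finite D \<Longrightarrow> distinct ss \<Longrightarrow> set ss \<inter> D = {} \<Longrightarrow> set_weight (D \<union> set ss) = set_weight D + list_weight ss"
  by (subst Un_commute) (simp add: set_weight_def list_weight_def sum.union_disjoint sum_list_distinct_conv_sum_set)

lemma set_weight_le: "X \<subseteq> {..<n} \<Longrightarrow> set_weight X \<le> n + 2 * m"
proof -
  assume "X \<subseteq> {..<n}"
  then have "set_weight X \<le> set_weight {..<n}" unfolding set_weight_def by (intro sum_mono2) auto
  also have "set_weight {..<n} = n + 2 * m" by (simp add: set_weight_def sum_dg[symmetric] sum.distrib[symmetric] flip: sum.distrib) (simp add: sum_dg sum.distrib sum_Suc)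
  finally show ?thesis .
qed

lemma list_weight_snoc [simp]: "list_weight (ss @ [v]) = list_weight ss + Suc (dg v)"
  by (simp add: list_weight_def)

lemma length_le_list_weight: "length ss \<le> list_weight ss"
  by (induction ss) (auto simp: list_weight_def)

definition main_inv :: "nat list \<Rightarrow> nat list \<Rightarrow> nat list \<Rightarrow> nat set \<Rightarrow> nat list list \<Rightarrow> vars \<Rightarrow> arrs \<Rightarrow> bool" where
  "main_inv ss bs xs D Ys V A \<longleftrightarrow> const_regs V \<and> graph_arrs A \<and>
     V 8 = int (length ss) \<and> V 9 = int (length bs) \<and>
     ghost_inv ss bs xs D (queue ss) {} \<and> repr ss bs xs D (queue ss) A \<and>
     set xs \<subseteq> set ss \<union> half_edges (set ss) \<and> done_inv D Ys \<and>
     out_arr (out_list Ys) A \<and> V 6 = 1 + int (length (out_list Ys)) \<and> V 7 = int (length Ys)"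

text \<open>
  Pays for removing list entries, merging clusters and discarding the stack.
\<close>

definition potential :: "nat list \<Rightarrow> nat list \<Rightarrow> nat list \<Rightarrow> int" where
  "potential ss bs xs = 60 * int (length xs) + 60 * int (length bs) + 40 * int (list_weight ss)"

text \<open>The credited weight counts the nodes owned by all vertices pushed so far. Only a push
  raises it, by \<open>Suc (dg u)\<close>; this finances at most \<open>dg u\<close> binary searches
  and the potential of the new base, entries and stack vertex. A removed entry releases 60, a merged
  base 60, and discarding the stack 40 per node. The \<open>+ 1\<close> is the test of the
  surrounding loop.\<close>

lemma dfs_step_spec:
  assumes inv: "main_inv ss bs xs D Ys V A" and ne: "ss \<noteq> []" and L: "n \<le> 2 ^ L"
    and P: "\<And>V' A' t' ss' bs' xs' D' Ys'. main_inv ss' bs' xs' D' Ys' V' A' \<Longrightarrow> V' 5 = V 5 \<Longrightarrow>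
      D \<union> set ss \<subseteq> D' \<union> set ss' \<Longrightarrow>
      t' + potential ss' bs' xs' + (250 + 9 * int L) * int (set_weight D + list_weight ss) + 1 \<le>
        t + potential ss bs xs + (250 + 9 * int L) * int (set_weight D' + list_weight ss') \<Longrightarrow> P V' A' t'"
  shows "vc dfs_step P V A t"
proof -
  have ctx: "const_regs V" "graph_arrs A" "V 8 = int (length ss)" "V 9 = int (length bs)"
    and g: "ghost_inv ss bs xs D (queue ss) {}" and r: "repr ss bs xs D (queue ss) A"
    and nodes: "set xs \<subseteq> set ss \<union> half_edges (set ss)" and dn: "done_inv D Ys"
    and out: "out_arr (out_list Ys) A" "V 6 = 1 + int (length (out_list Ys))" "V 7 = int (length Ys)"
    using inv by (auto simp: main_inv_def)
  have g1: "stack_inv ss bs D" "sep_inv ss bs xs" "sound_inv ss bs xs"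
    "cover_inv ss bs xs (queue ss) {}" "queue_inv ss (queue ss)" "set xs \<subseteq> {..<n + 2 * m}"
    using g by (auto simp: ghost_inv_def)
  have rep: "stack_arr ss A" "pos_arr ss D A" "base_arr bs A" "queue_arr (queue ss) A" "list_arr xs A"
    using r by (auto simp: repr_def)
  have ss: "distinct ss" "set ss \<subseteq> {..<n}" "D \<subseteq> {..<n}" "set ss \<inter> D = {}" "bs \<noteq> []" "last bs < length ss"
    "last bs \<in> set bs" using g1(1) ne by (auto simp: stack_inv_def)
  have D: "finite D" using ss(3) finite_subset by blast
  have lss: "length ss + card D \<le> n" "length bs \<le> length ss"
    using length_ss[OF g1(1)] length_bs[OF g1(1)] by auto
  define d where "d = ss ! last bs"
  have d: "d < n" "d \<in> set xs" using ss g1(2) by (auto simp: d_def sep_inv_def dest: nth_mem)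
  then obtain x xs1 where xs: "xs = x # xs1" by (cases xs) auto
  have x: "x < n + 2 * m" using g1(6) xs by simp
  have lb: "int (length bs) - 1 = int (length bs - 1)" "1 \<le> length bs" using ss(5) by (cases bs; simp)+
  have A10: "A 10 (int (length bs) - 1) = int (last bs)"
    unfolding lb(1) using rep(3) ss(5) by (auto simp: base_arr_def last_conv_nth)
  have A9: "A 9 (int (last bs)) = int d" using rep(1) ss(6) by (simp add: stack_arr_def d_def)
  have A5: "A 5 (int n + 2 * int m) = int x" using rep(5) by (simp add: list_arr_def xs)
  define V1 where "V1 = V(12 := int (length bs) - 1, 13 := int (last bs), 14 := int d, 15 := int x)"
  have emit: "vc close_prog P (V1(16 := 0)) A t1"
    if xd: "x = d" and t1: "t1 \<le> t + 14" for t1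
  proof -
    have cov: "cover_inv ss bs (ss ! last bs # xs1) (queue ss) {}" using g1(4) xs xd by (simp add: d_def)
    note dn' = done_inv_emit[OF dn g1(1) ne cov]
    have lo: "length (out_list Ys) \<le> 2 * card D" using dn by (simp add: done_inv_def)
    \<comment> \<open>Each set is nonempty and so takes at least two output words; the counter of
      sets thereby stays within the word bound.\<close>
    have lY: "length Ys \<le> card D"
    proof -
      have "2 * length Ys \<le> length (out_list Ys)"
      proof -
        have "\<forall>Y\<in>set Ys. Y \<noteq> []"
          using dn MinRSs_nonempty by (fastforce simp: done_inv_def)
        then show ?thesis
        proof (induction Ys)
          case (Cons Y Ys)
          then have "1 \<le> length Y" by (cases Y) auto
          with Cons show ?case by (simp add: out_list_def)
        qed simp
      qed
      then show ?thesis using lo by simp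
    qed
    show ?thesis
      unfolding close_prog_def vc.simps(7)
    proof (rule emit_prog_spec[where ss = ss and b = "last bs" and os = "out_list Ys" and c = "length Ys"])
      fix V2 A2 t2
      assume 2: "same_except {6, 7, 12, 14} (V1(16 := 0)) V2" "same_except {12} A A2"
        "V2 6 = 1 + int (length (out_list Ys @ (length ss - last bs) # drop (last bs) ss))"
        "V2 7 = int (length Ys) + 1"
        "out_arr (out_list Ys @ (length ss - last bs) # drop (last bs) ss) A2"
        "t2 \<le> t1 + 7 + 7 * int (length ss)"
      have ctx2: "const_regs V2" using const_regs_same[OF 2(1)] ctx(1) by (simp add: V1_def)
      show "vc clear_prog P V2 A2 t2"
      proof (rule clear_prog_spec[OF ctx2 graph_arrs_same[OF 2(2) _ ctx(2)] _ g1(1)])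
        show "V2 8 = int (length ss)" using 2(1) ctx(3) by (simp add: same_except_def V1_def)
        show "repr ss bs xs D (queue ss) A2" using r arr_same[OF 2(2)] by (simp add: repr_def)
        fix V3 A3 t3
        assume 3: "same_except {8, 9, 12, 13, 14, 15, 16} V2 V3" "same_except {6, 8} A2 A3"
          "V3 8 = 0" "V3 9 = 0" "repr [] [] [] (D \<union> set ss) (queue []) A3"
          "t3 \<le> t2 + 4 + 11 * int (list_weight ss)"
        show "P V3 A3 t3"
        proof (rule P[where ss' = "[]" and bs' = "[]" and xs' = "[]" and D' = "D \<union> set ss"
              and Ys' = "Ys @ [drop (last bs) ss]"])
          have "const_regs V3" using const_regs_same[OF 3(1) _ ctx2] by simp
          moreover have "graph_arrs A3"
            using graph_arrs_same[OF 3(2) _ graph_arrs_same[OF 2(2) _ ctx(2)]] by simp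
          moreover have "ghost_inv [] [] [] (D \<union> set ss) (queue []) {}"
            using ss(2,3) queue_inv_queue[of "[]"]
            by (auto simp: ghost_inv_def stack_inv_def sep_inv_def sound_inv_def cover_inv_def)
          moreover have "out_arr (out_list (Ys @ [drop (last bs) ss])) A3"
            using 2(5) out_arr_same[OF 3(2)] by simp
          ultimately show "main_inv [] [] [] (D \<union> set ss) (Ys @ [drop (last bs) ss]) V3 A3"
            using 3 dn' 2(3,4) by (simp add: main_inv_def same_except_def)
          show "V3 5 = V 5" using 2(1) 3(1) by (simp add: same_except_def V1_def)
          have w: "1 \<le> length ss" "length ss \<le> list_weight ss" using ne length_le_list_weight[of ss] by (auto simp: Suc_le_eq)
          have "t3 \<le> t + 25 + 18 * int (list_weight ss)" using t1 2(6) 3(6) w(2) by linarith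
          moreover have "60 * int (length bs) \<ge> 60" using lb(2) by simp
          moreover have "set_weight (D \<union> set ss) = set_weight D + list_weight ss" using set_weight_Un[OF D ss(1,4)] .
          ultimately show "t3 + potential [] [] [] + (250 + 9 * int L) * int (set_weight D + list_weight ss) + 1 \<le>
            t + potential ss bs xs + (250 + 9 * int L) * int (set_weight (D \<union> set ss) + list_weight [])"
            by (simp add: potential_def list_weight_def[of "[]"])
        qed simp
      qed simp
    qed (use ctx out rep ss lss lo lY in \<open>simp_all add: V1_def\<close>)
  qed
  have pop: "vc visit_prog P
      (V1(16 := 1, 17 := A 5 (int x), 10 := int (target x), 12 := A 8 (int (target x))))
      (A(5 := (A 5)(int n + 2 * int m := A 5 (int x)))) t1"
    if xd: "x \<noteq> d" and t1: "t1 \<le> t + 24" for t1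
  proof -
    have u: "target x < n" using target_less[OF x] .
    define u where "u = target x"
    note pe = pop_entry[OF g1(1) ne g1(2-4)[unfolded xs] xd[unfolded d_def]]
    \<comment> \<open>\<open>d\<close> is still in the list, so \<open>x\<close> was not its last
      node and its successor link is meaningful.\<close>
    have xs1: "set xs1 \<subseteq> set xs" "xs1 \<noteq> []" using d xs xd by auto
    define A1 where "A1 = A(5 := (A 5)(int n + 2 * int m := A 5 (int x)))"
    define V2 where "V2 = V1(16 := 1, 17 := A 5 (int x), 10 := int u, 12 := A 8 (int u))"
    have ctx2: "const_regs V2" "graph_arrs A1" "V2 8 = int (length ss)" "V2 9 = int (length bs)" "V2 5 = V 5"
      "V2 6 = V 6" "V2 7 = V 7" "V2 10 = int u"
      using ctx by (simp_all add: V2_def V1_def A1_def)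
    have gi: "ghost_inv ss bs xs1 D (queue ss) {u}"
      using pe g1 xs1 by (auto simp: ghost_inv_def u_def)
    have "list_arr xs1 A1"
    proof -
      obtain y ys where ys: "xs1 = y # ys" using xs1(2) by (cases xs1) auto
      have l: "A 5 (int x) = int y" "linked (A 5) xs1" using rep(5) by (auto simp: list_arr_def xs ys)
      have "linked (A1 5) xs1"
      proof (rule linked_cong[OF l(2)])
        show "\<forall>z\<in>set (butlast xs1). A1 5 (int z) = A 5 (int z)"
        proof
          fix z assume "z \<in> set (butlast xs1)"
          then have "z < n + 2 * m" using g1(6) xs1(1) by (auto dest!: in_set_butlastD)
          then show "A1 5 (int z) = A 5 (int z)" by (simp add: A1_def)
        qed
      qed
      then show ?thesis using l(1) by (simp add: list_arr_def ys A1_def)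
    qed
    then have ri: "repr ss bs xs1 D (queue ss) A1" using rep by (simp add: repr_def A1_def)
    have out1: "out_arr (out_list Ys) A1" using out by (simp add: A1_def)
    have nodes1: "set xs1 \<subseteq> set ss \<union> half_edges (set ss)" using nodes xs1 by auto
    have V12: "V2 12 = A 8 (int u)" by (simp add: V2_def)
    have lx: "length xs = Suc (length xs1)" by (simp add: xs)
    consider (new) "u \<notin> D" "u \<notin> set ss" "V2 12 = -1"
      | (old) p where "p < length ss" "u = ss ! p" "V2 12 = int p"
      | (dead) "u \<in> D" "V2 12 = int n"
    proof (cases "u \<in> D")
      case True
      then show ?thesis using dead rep(2) V12 by (auto simp: pos_arr_def)
    next
      case False
      show ?thesis
      proof (cases "u \<in> set ss")
        case True
        then obtain p where "p < length ss" "u = ss ! p" by (auto simp: in_set_conv_nth)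
        then show ?thesis using old rep(2) V12 by (auto simp: pos_arr_def)
      next
        case False
        then show ?thesis using \<open>u \<notin> D\<close> new rep(2) V12 u unfolding pos_arr_def u_def by auto
      qed
    qed
    then have "vc visit_prog P V2 A1 t1"
    proof cases
      case new
      have "vc push_prog P V2 A1 (t1 + 1)"
      proof (rule push_prog_spec[OF ctx2(1-4,8) gi ri nodes1 _ new(1,2) pe(4)[folded u_def] L])
        show "u < n" using u by (simp add: u_def)
        fix V3 A3 t3 xs3
        assume 3: "same_except {8..26} V2 V3" "same_except {5..10} A1 A3"
          "V3 8 = int (length (ss @ [u]))" "V3 9 = int (length (bs @ [length ss]))"
          "ghost_inv (ss @ [u]) (bs @ [length ss]) xs3 D (queue (ss @ [u])) {}"
          "repr (ss @ [u]) (bs @ [length ss]) xs3 D (queue (ss @ [u])) A3"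
          "set xs3 \<subseteq> set (ss @ [u]) \<union> half_edges (set (ss @ [u]))"
          "length xs3 \<le> length xs1 + 1 + dg u"
          "t3 \<le> t1 + 1 + 20 + (37 + 9 * int L) * int (dg u)"
        show "P V3 A3 t3"
        proof (rule P)
          have "const_regs V3" using const_regs_same[OF 3(1) _ ctx2(1)] by simp
          moreover have "graph_arrs A3" using graph_arrs_same[OF 3(2) _ ctx2(2)] by simp
          moreover have "out_arr (out_list Ys) A3" using out1 out_arr_same[OF 3(2)] by simp
          moreover have "V3 6 = V 6" "V3 7 = V 7" using 3(1) ctx2(6,7) by (simp_all add: same_except_def)
          ultimately show "main_inv (ss @ [u]) (bs @ [length ss]) xs3 D Ys V3 A3"
            unfolding main_inv_def using 3(3-7) dn out(2,3) by simp
          show "V3 5 = V 5" using 3(1) ctx2(5) by (simp add: same_except_def)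
          show "t3 + potential (ss @ [u]) (bs @ [length ss]) xs3 + (250 + 9 * int L) * int (set_weight D + list_weight ss) + 1 \<le>
             t + potential ss bs xs + (250 + 9 * int L) * int (set_weight D + list_weight (ss @ [u]))"
            using 3(8,9) t1 lx by (simp add: potential_def algebra_simps)
        qed auto
      qed
      then show ?thesis using new(3) by (simp add: visit_prog_def const_regsD[OF ctx2(1)])
    next
      case (old p)
      have "vc merge_prog P V2 A1 (2 + t1)"
      proof (rule merge_prog_spec[OF ctx2(1,4) old(3) gi[unfolded old(2)] ri old(1) pe(4)[folded u_def, unfolded old(2)]])
        fix V3 t3 bs3
        assume 3: "same_except {9, 14, 15} V2 V3" "V3 9 = int (length bs3)"
          "ghost_inv ss bs3 xs1 D (queue ss) {}" "repr ss bs3 xs1 D (queue ss) A1"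
          "t3 + 5 * int (length bs3) \<le> 2 + t1 + 4 + 5 * int (length bs)" "length bs3 \<le> length bs"
        show "P V3 A1 t3"
        proof (rule P)
          have "const_regs V3" using const_regs_same[OF 3(1) _ ctx2(1)] by simp
          moreover have "V3 6 = V 6" "V3 7 = V 7" "V3 8 = int (length ss)"
            using 3(1) ctx2(3,6,7) by (simp_all add: same_except_def)
          ultimately show "main_inv ss bs3 xs1 D Ys V3 A1"
            unfolding main_inv_def using 3(2-4) nodes1 ctx2(2) out1 dn out(2,3) by simp
          show "V3 5 = V 5" using 3(1) ctx2(5) by (simp add: same_except_def)
          show "t3 + potential ss bs3 xs1 + (250 + 9 * int L) * int (set_weight D + list_weight ss) + 1 \<le>
             t + potential ss bs xs + (250 + 9 * int L) * int (set_weight D + list_weight ss)"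
            using 3(5,6) t1 lx by (simp add: potential_def)
        qed auto
      qed
      then show ?thesis using old lss by (simp add: visit_prog_def const_regsD[OF ctx2(1)])
    next
      case dead
      have "vc clear_prog P V2 A1 (2 + t1)"
      proof (rule clear_prog_spec[OF ctx2(1-3) g1(1) ri])
        fix V3 A3 t3
        assume 3: "same_except {8, 9, 12, 13, 14, 15, 16} V2 V3" "same_except {6, 8} A1 A3"
          "V3 8 = 0" "V3 9 = 0" "repr [] [] [] (D \<union> set ss) (queue []) A3"
          "t3 \<le> 2 + t1 + 4 + 11 * int (list_weight ss)"
        show "P V3 A3 t3"
        proof (rule P[where ss' = "[]" and bs' = "[]" and xs' = "[]" and D' = "D \<union> set ss" and Ys' = Ys])
          have "const_regs V3" using const_regs_same[OF 3(1) _ ctx2(1)] by simp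
          moreover have "graph_arrs A3" using graph_arrs_same[OF 3(2) _ ctx2(2)] by simp
          moreover have "ghost_inv [] [] [] (D \<union> set ss) (queue []) {}"
            using ss(2,3) queue_inv_queue[of "[]"]
            by (auto simp: ghost_inv_def stack_inv_def sep_inv_def sound_inv_def cover_inv_def)
          moreover have "out_arr (out_list Ys) A3" using out1 out_arr_same[OF 3(2)] by simp
          moreover have "V3 6 = V 6" "V3 7 = V 7" using 3(1) ctx2(6,7) by (simp_all add: same_except_def)
          moreover have "done_inv (D \<union> set ss) Ys"
            using done_inv_abort[OF dn g1(1) dead(1)] pe(4) by (simp add: u_def)
          ultimately show "main_inv [] [] [] (D \<union> set ss) Ys V3 A3"
            unfolding main_inv_def using 3(3-5) out(2,3) by simp
          show "V3 5 = V 5" using 3(1) ctx2(5) by (simp add: same_except_def)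
          have "set_weight (D \<union> set ss) = set_weight D + list_weight ss" using set_weight_Un[OF D ss(1,4)] .
          moreover have "60 * int (length bs) \<ge> 60" using lb(2) by simp
          ultimately show "t3 + potential [] [] [] + (250 + 9 * int L) * int (set_weight D + list_weight ss) + 1 \<le>
            t + potential ss bs xs + (250 + 9 * int L) * int (set_weight (D \<union> set ss) + list_weight [])"
            using 3(6) t1 lx by (simp add: potential_def list_weight_def[of "[]"])
        qed simp
      qed
      then show ?thesis using dead lss by (simp add: visit_prog_def const_regsD[OF ctx2(1)])
    qed
    then show ?thesis by (simp add: V2_def A1_def u_def)
  qed
  have A4: "A 4 (int x) = int (target x)" using ctx(2) x by (simp add: graph_arrs_def)
  show ?thesis
    using N_ge ctx(3,4) lss lb ss(6) d(1) x A10 A9 A5 A4 target_less[OF x] emit pop ss(5)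
    apply (simp add: dfs_step_def const_regsD[OF ctx(1)])
    apply (intro conjI impI wdI)
    apply (simp_all add: V1_def)
    done
qed

text \<open>The potential is nonnegative and the credited weight is at most
  \<open>n + 2 * m\<close>, which bounds the clock. Once the stack is empty the potential is zero,
  and only the credit of the discarded vertices remains in the bound.\<close>

lemma dfs_prog_spec:
  assumes inv: "main_inv ss bs xs D Ys V A" and L: "n \<le> 2 ^ L"
    and t: "t + potential ss bs xs \<le> T + (250 + 9 * int L) * int (set_weight D + list_weight ss)"
    and P: "\<And>V' A' t' D' Ys'. main_inv [] [] [] D' Ys' V' A' \<Longrightarrow> V' 5 = V 5 \<Longrightarrow>
      D \<union> set ss \<subseteq> D' \<Longrightarrow> t' \<le> T + 1 + (250 + 9 * int L) * int (set_weight D') \<Longrightarrow> P V' A' t'"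
  shows "vc dfs_prog P V A t"
proof -
  let ?C = "250 + 9 * int L"
  define I where "I = (\<lambda>V' A' t'. \<exists>ss' bs' xs' D' Ys'. main_inv ss' bs' xs' D' Ys' V' A' \<and> V' 5 = V 5 \<and>
     D \<union> set ss \<subseteq> D' \<union> set ss' \<and> t' + potential ss' bs' xs' \<le> T + ?C * int (set_weight D' + list_weight ss'))"
  have I0: "I V A t" unfolding I_def using inv t by blast
  show ?thesis
    unfolding dfs_prog_def
  proof (rule vc_while[where I = I and T = "T + ?C * int (n + 2 * m)"])
    show "I V A t" by (fact I0)
  next
    fix V' A' t' assume "I V' A' t'"
    then obtain ss' bs' xs' D' Ys' where i: "main_inv ss' bs' xs' D' Ys' V' A'"
      "t' + potential ss' bs' xs' \<le> T + ?C * int (set_weight D' + list_weight ss')" by (auto simp: I_def)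
    have s: "distinct ss'" "set ss' \<union> D' \<subseteq> {..<n}" "set ss' \<inter> D' = {}"
      using i(1) by (auto simp: main_inv_def ghost_inv_def stack_inv_def)
    then have "finite D'" using finite_subset by auto
    then have "set_weight D' + list_weight ss' \<le> n + 2 * m" using set_weight_Un[of D' ss'] s set_weight_le[of "D' \<union> set ss'"] by auto
    then have "?C * int (set_weight D' + list_weight ss') \<le> ?C * int (n + 2 * m)" by (intro mult_left_mono) auto
    moreover have "0 \<le> potential ss' bs' xs'" by (simp add: potential_def)
    ultimately show "t' \<le> T + ?C * int (n + 2 * m)" using i(2) by linarith
  next
    fix V' A' t' assume "I V' A' t'" and lt: "V' 1 < V' 8"
    then obtain ss' bs' xs' D' Ys' where i: "main_inv ss' bs' xs' D' Ys' V' A'" "V' 5 = V 5"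
      "D \<union> set ss \<subseteq> D' \<union> set ss'" "t' + potential ss' bs' xs' \<le> T + ?C * int (set_weight D' + list_weight ss')"
      by (auto simp: I_def)
    have "ss' \<noteq> []" using lt i(1) by (auto simp: main_inv_def const_regs_def)
    then show "vc dfs_step I V' A' (t' + 1)"
    proof (rule dfs_step_spec[OF i(1) _ L])
      fix V2 A2 t2 ss2 bs2 xs2 D2 Ys2
      assume 2: "main_inv ss2 bs2 xs2 D2 Ys2 V2 A2" "V2 5 = V' 5" "D' \<union> set ss' \<subseteq> D2 \<union> set ss2"
        "t2 + potential ss2 bs2 xs2 + ?C * int (set_weight D' + list_weight ss') + 1 \<le>
          t' + 1 + potential ss' bs' xs' + ?C * int (set_weight D2 + list_weight ss2)"
      have "t2 + potential ss2 bs2 xs2 \<le> T + ?C * int (set_weight D2 + list_weight ss2)" using 2(4) i(4) by linarith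
      moreover have "V2 5 = V 5" "D \<union> set ss \<subseteq> D2 \<union> set ss2" using 2(2,3) i(2,3) by auto
      ultimately show "I V2 A2 t2" unfolding I_def using 2(1) by blast
    qed
  next
    fix V' A' t' assume "I V' A' t'" and ge: "\<not> V' 1 < V' 8"
    then obtain ss' bs' xs' D' Ys' where i: "main_inv ss' bs' xs' D' Ys' V' A'" "V' 5 = V 5"
      "D \<union> set ss \<subseteq> D' \<union> set ss'" "t' + potential ss' bs' xs' \<le> T + ?C * int (set_weight D' + list_weight ss')"
      by (auto simp: I_def)
    have ss': "ss' = []" using ge i(1) by (auto simp: main_inv_def const_regs_def)
    \<comment> \<open>Bases are stack positions and list nodes belong to stack vertices, so both
      lists vanish with the stack.\<close>
    have bs': "bs' = []" using i(1) unfolding ss' by (cases bs') (auto simp: main_inv_def ghost_inv_def stack_inv_def)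
    have xs': "xs' = []" using i(1) unfolding ss' by (auto simp: main_inv_def half_edges_def)
    show "P V' A' (t' + 1)"
      using i unfolding ss' bs' xs' by (intro P[of D' Ys']) (auto simp: potential_def list_weight_def)
  qed
qed

lemma search_prog_spec:
  assumes ctx: "const_regs V" "graph_arrs A" and A: "A 6 = (\<lambda>_. 0)" "\<forall>u<n. A 8 (int u) = -1"
    and L: "n \<le> 2 ^ L"
    and P: "\<And>V' A' t' Ys. done_inv {..<n} Ys \<Longrightarrow> out_arr (out_list Ys) A' \<Longrightarrow>
      A' 12 0 = int (length Ys) \<Longrightarrow> t' \<le> t + 10 + 10 * int n + (250 + 9 * int L) * int (n + 2 * m) \<Longrightarrow>
      P V' A' t'"
  shows "vc search_prog P V A t"
proof -
  let ?C = "250 + 9 * int L"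
  define I where "I = (\<lambda>V' A' t'. \<exists>i D Ys. main_inv [] [] [] D Ys V' A' \<and> i \<le> n \<and> V' 5 = int i \<and>
     {..<i} \<subseteq> D \<and> t' \<le> t + 5 + 10 * int i + ?C * int (set_weight D))"
  let ?body = "Ad 10 5 1 ;; Ld 12 8 10 ;; Ite 12 1 (push_prog ;; dfs_prog) Nop ;; Ad 5 5 0"
  have Dn: "D \<subseteq> {..<n}" "finite D" if "main_inv [] [] [] D Ys V' A'" for D Ys V' A'
    using that finite_subset[of D "{..<n}"] by (auto simp: main_inv_def done_inv_def)
  have loop: "vc (Whl 5 3 ?body) (vc (St 12 1 7) P) V' A' t'" if "I V' A' t'" for V' A' t'
    using that
  proof (rule vc_while[where I = I and T = "t + 5 + 10 * int n + ?C * int (n + 2 * m)"])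
    fix V' A' t' assume "I V' A' t'"
    then obtain i D Ys where i: "main_inv [] [] [] D Ys V' A'" "i \<le> n"
      "t' \<le> t + 5 + 10 * int i + ?C * int (set_weight D)" by (auto simp: I_def)
    have "?C * int (set_weight D) \<le> ?C * int (n + 2 * m)"
      using set_weight_le[OF Dn(1)[OF i(1)]] by (intro mult_left_mono) auto
    then show "t' \<le> t + 5 + 10 * int n + ?C * int (n + 2 * m)" using i(2,3) by linarith
  next
    fix V' A' t' assume "I V' A' t'" and lt: "V' 5 < V' 3"
    then obtain i D Ys where i: "main_inv [] [] [] D Ys V' A'" "V' 5 = int i" "{..<i} \<subseteq> D"
      "t' \<le> t + 5 + 10 * int i + ?C * int (set_weight D)" by (auto simp: I_def)
    have ctx': "const_regs V'" "graph_arrs A'" "V' 8 = 0" "V' 9 = 0"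
      "ghost_inv [] [] [] D (queue []) {}" "repr [] [] [] D (queue []) A'" "done_inv D Ys"
      "out_arr (out_list Ys) A'" "V' 6 = 1 + int (length (out_list Ys))" "V' 7 = int (length Ys)"
      using i(1) by (auto simp: main_inv_def)
    have il: "i < n" using lt i(2) const_regsD[OF ctx'(1)] by simp
    have fin: "vc (Ad 5 5 0) I V3 A3 t3"
      if 3: "main_inv [] [] [] D3 Ys3 V3 A3" "V3 5 = int i" "{..<Suc i} \<subseteq> D3"
        "t3 \<le> t + 14 + 10 * int i + ?C * int (set_weight D3)" for V3 A3 t3 D3 Ys3
    proof -
      have "main_inv [] [] [] D3 Ys3 (V3(5 := int (Suc i))) A3" using 3(1) by (simp add: main_inv_def)
      then have "I (V3(5 := int i + 1)) A3 (t3 + 1)"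
        unfolding I_def by (intro exI[of _ "Suc i"] exI[of _ D3] exI[of _ Ys3]) (use il 3 in \<open>auto simp: algebra_simps\<close>)
      then show ?thesis using N_ge il 3(1,2)
        by (auto simp: const_regs_def main_inv_def intro!: wdI)
    qed
    define V2 where "V2 = V'(10 := int i, 12 := A' 8 (int i))"
    have c2: "const_regs V2" "V2 8 = int (length ([] :: nat list))" "V2 9 = int (length ([] :: nat list))" "V2 10 = int i"
      "V2 6 = V' 6" "V2 7 = V' 7" "V2 5 = int i"
      using ctx' i(2) by (simp_all add: V2_def)
    define c where "c = Ite 12 1 (push_prog ;; dfs_prog) Nop"
    have main: "vc c (vc (Ad 5 5 0) I) V2 A' (4 + t')"
    proof (cases "i \<in> D")
      case True
      then have a: "V2 12 = int n" using ctx'(6) by (simp add: V2_def repr_def pos_arr_def)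
      have "main_inv [] [] [] D Ys V2 A'" using i(1) by (simp add: main_inv_def V2_def)
      then have "vc (Ad 5 5 0) I V2 A' (t' + 6)"
        by (rule fin) (use c2 i True in \<open>auto simp: lessThan_Suc\<close>)
      then show ?thesis using a by (simp add: c_def const_regsD[OF c2(1)])
    next
      case False
      then have a: "V2 12 = -1" using ctx'(6) il by (simp add: V2_def repr_def pos_arr_def)
      \<comment> \<open>Without bases \<open>cover_inv\<close> is vacuous, so any start vertex may
        be exempted.\<close>
      have gi: "ghost_inv [] [] [] D (queue []) {i}" using ctx'(5) by (simp add: ghost_inv_def cover_inv_def)
      have "vc push_prog (vc dfs_prog (vc (Ad 5 5 0) I)) V2 A' (5 + t')"
      proof (rule push_prog_spec[OF c2(1) ctx'(2) c2(2-4) gi ctx'(6) _ il False _ _ L])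
        fix V3 A3 t3 xs3
        assume 3: "same_except {8..26} V2 V3" "same_except {5..10} A' A3"
          "V3 8 = int (length ([] @ [i]))" "V3 9 = int (length ([] @ [length ([] :: nat list)]))"
          "ghost_inv ([] @ [i]) ([] @ [length ([] :: nat list)]) xs3 D (queue ([] @ [i])) {}"
          "repr ([] @ [i]) ([] @ [length ([] :: nat list)]) xs3 D (queue ([] @ [i])) A3"
          "set xs3 \<subseteq> set ([] @ [i]) \<union> half_edges (set ([] @ [i]))"
          "length xs3 \<le> length ([] :: nat list) + 1 + dg i"
          "t3 \<le> 5 + t' + 20 + (37 + 9 * int L) * int (dg i)"
        have "const_regs V3" using const_regs_same[OF 3(1) _ c2(1)] by simp
        moreover have "graph_arrs A3" using graph_arrs_same[OF 3(2) _ ctx'(2)] by simp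
        moreover have "out_arr (out_list Ys) A3" using ctx'(8) out_arr_same[OF 3(2)] by simp
        moreover have v3: "V3 6 = V' 6" "V3 7 = V' 7" "V3 5 = int i"
          using 3(1) c2(5-7) by (simp_all add: same_except_def)
        ultimately have mi: "main_inv [i] [0] xs3 D Ys V3 A3"
          unfolding main_inv_def using 3(3-7) ctx'(7,9,10) by simp
        show "vc dfs_prog (vc (Ad 5 5 0) I) V3 A3 t3"
        proof (rule dfs_prog_spec[OF mi L])
          show "t3 + potential [i] [0] xs3 \<le> (t + 13 + 10 * int i) + ?C * int (set_weight D + list_weight [i])"
            using 3(8,9) i(4) by (simp add: potential_def list_weight_def algebra_simps)
          fix V4 A4 t4 D4 Ys4
          assume 4: "main_inv [] [] [] D4 Ys4 V4 A4" "V4 5 = V3 5" "D \<union> set [i] \<subseteq> D4"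
            "t4 \<le> t + 13 + 10 * int i + 1 + ?C * int (set_weight D4)"
          show "vc (Ad 5 5 0) I V4 A4 t4"
            by (rule fin[OF 4(1)]) (use 4 v3 i(3) in \<open>auto simp: lessThan_Suc\<close>)
        qed
      qed auto
      then show ?thesis using a by (simp add: c_def const_regsD[OF c2(1)])
    qed
    then show "vc ?body I V' A' (t' + 1)"
      unfolding c_def[symmetric]
      using N_ge il i(2) by (simp add: const_regsD[OF ctx'(1)] V2_def) (intro wdI, auto)
  next
    fix V' A' t' assume "I V' A' t'" and ge: "\<not> V' 5 < V' 3"
    then obtain i D Ys where i: "main_inv [] [] [] D Ys V' A'" "i \<le> n" "V' 5 = int i" "{..<i} \<subseteq> D"
      "t' \<le> t + 5 + 10 * int i + ?C * int (set_weight D)" by (auto simp: I_def)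
    have ctx': "const_regs V'" "done_inv D Ys" "out_arr (out_list Ys) A'" "V' 7 = int (length Ys)"
      using i(1) by (auto simp: main_inv_def)
    have "i = n" using ge i(2,3) const_regsD[OF ctx'(1)] by simp
    then have D: "D = {..<n}" using i(4) Dn(1)[OF i(1)] by auto
    have "?C * int (set_weight D) \<le> ?C * int (n + 2 * m)"
      using set_weight_le[OF Dn(1)[OF i(1)]] by (intro mult_left_mono) auto
    then have "t' \<le> t + 5 + 10 * int n + ?C * int (n + 2 * m)" using i(5) \<open>i = n\<close> by linarith
    then have "P V' (A'(12 := (A' 12)(0 := int (length Ys)))) (3 + t')"
      using ctx' unfolding D by (intro P[of Ys]) (auto simp: out_arr_def)
    then show "vc (St 12 1 7) P V' A' (t' + 1)"
      using N_ge by (simp add: const_regsD[OF ctx'(1)] ctx'(4))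
  qed
  define V1 where "V1 = V(5 := 0, 6 := 1, 7 := 0, 8 := 0, 9 := 0)"
  have "ghost_inv [] [] [] {} (queue []) {}"
    using queue_inv_queue[of "[]"]
    by (auto simp: ghost_inv_def stack_inv_def sep_inv_def sound_inv_def cover_inv_def)
  moreover have "repr [] [] [] {} (queue []) A"
    using A by (auto simp: repr_def stack_arr_def base_arr_def queue_arr_def list_arr_def pos_arr_def)
  moreover have "done_inv {} []" by (simp add: done_inv_def)
  ultimately have "main_inv [] [] [] {} [] V1 A"
    using ctx by (simp add: main_inv_def V1_def out_arr_def)
  then have "I V1 A (5 + t)"
    unfolding I_def by (intro exI[of _ 0] exI[of _ "{}"] exI[of _ "[]"]) (auto simp: V1_def set_weight_def)
  from loop[OF this] show ?thesis
    using N_ge by (simp add: search_prog_def V1_def) (intro conjI wdI, auto)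
qed

end

section \<open>The complete program\<close>

text \<open>Registers 1 to 3 are scratch until \<open>N = 2 * (n + m) + 4\<close> stands in register
  1; then registers 2 to 12 receive the further multiples of \<open>N\<close>. Register 0 is zero
  from the start.\<close>

definition base_prog :: prog where
  "base_prog = Seq (Const 1 1) (Seq (Load 2 1) (Seq (Const 1 2) (Seq (Load 3 1) (Seq (Add 2 2 3)
     (Seq (Add 2 2 2) (Seq (Const 1 4) (Seq (Add 1 2 1) (Seq (Add 2 1 1) (Seq (Add 3 2 1)
     (Seq (Add 4 3 1) (Seq (Add 5 4 1) (Seq (Add 6 5 1) (Seq (Add 7 6 1) (Seq (Add 8 7 1)
     (Seq (Add 9 8 1) (Seq (Add 10 9 1) (Seq (Add 11 10 1) (Add 12 11 1))))))))))))))))))"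

definition MinRS_prog :: prog where
  "MinRS_prog = Seq base_prog (Seq (compile (setup_prog ;; search_prog)) (Add 0 12 0))"

section \<open>Input and output words, and the logarithm\<close>

lemma nth_concat_pairs:
  "i < length es \<Longrightarrow> concat (map (\<lambda>(u, v). [int u, int v]) es) ! (2 * i) = int (fst (es ! i))"
  "i < length es \<Longrightarrow> concat (map (\<lambda>(u, v). [int u, int v]) es) ! Suc (2 * i) = int (snd (es ! i))"
proof (induction es arbitrary: i)
  case (Cons e es)
  { case 1 then show ?case using Cons by (cases i) (auto simp: case_prod_beta) }
  { case 2 then show ?case using Cons by (cases i) (auto simp: case_prod_beta) }
qed auto

lemma length_concat_pairs: "length (concat (map (\<lambda>(u, v). [int u, int v]) es)) = 2 * length es"
  by (induction es) auto

lemma output_words_eq: "output_words Ys = map int (length Ys # out_list Ys)"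
  by (simp add: output_words_def out_list_def map_concat comp_def)

text \<open>The factor 2 absorbs the rounding: from \<open>2 \<le> n\<close> on the logarithm is at
  least 1.\<close>

lemma exists_log_bound:
  assumes "2 \<le> n"
  shows "\<exists>L. n \<le> 2 ^ L \<and> real L \<le> 2 * log 2 (real n)"
proof -
  define L where "L = nat \<lceil>log 2 (real n)\<rceil>"
  have lg: "1 \<le> log 2 (real n)" using assms by (simp add: le_log_iff)
  have "real n = 2 powr log 2 (real n)" using assms by simp
  also have "\<dots> \<le> 2 powr real L" unfolding L_def using lg by (intro powr_mono) linarith+
  also have "\<dots> = real (2 ^ L)" by (simp add: powr_realpow)
  finally have "n \<le> 2 ^ L" by (simp only: of_nat_le_iff)
  moreover have "real L \<le> 2 * log 2 (real n)" unfolding L_def using lg by linarith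
  ultimately show ?thesis by blast
qed

context ram_graph
begin

section \<open>Running the complete program on the initial state\<close>

lemma exec_Seq_Suc:
  "exec w S p s 1 s' \<Longrightarrow> exec w S q s' t s'' \<Longrightarrow> exec w S (Seq p q) s (Suc t) s''"
  using exec.Seq[of w S p s 1 s' q t s''] by simp

lemma exec_Const_Seq:
  "is_word w i \<Longrightarrow> exec w S q (R(r := i), M) t s \<Longrightarrow> exec w S (Seq (Const r i) q) (R, M) (Suc t) s"
  using exec.Const exec_Seq_Suc by blast

lemma exec_Load_Seq:
  "M (nat (R a)) = x \<Longrightarrow> 0 \<le> R a \<Longrightarrow> R a < int S \<Longrightarrow> exec w S q (R(r := x), M) t s \<Longrightarrow>
    exec w S (Seq (Load r a) q) (R, M) (Suc t) s"
  using exec.Load[of R a S w r M] exec_Seq_Suc by fastforce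

lemma exec_Add:
  "R a + R b = x \<Longrightarrow> is_word w x \<Longrightarrow> exec w S (Add r a b) (R, M) 1 (R(r := x), M)"
  using exec.Add by blast

lemma exec_Add_Seq:
  "R a + R b = x \<Longrightarrow> is_word w x \<Longrightarrow> exec w S q (R(r := x), M) t s \<Longrightarrow>
    exec w S (Seq (Add r a b) q) (R, M) (Suc t) s"
  using exec_Add exec_Seq_Suc by blast

lemma base_prog_exec:
  assumes "M 1 = int n" "M 2 = int m"
  shows "\<exists>R t. exec w S base_prog ((\<lambda>_. 0), M) t (R, M) \<and> t = 19 \<and>
    (\<forall>a<13. R a = int a * N) \<and> (\<forall>r. R (r + 14) = 0)"
proof -
  have S: "3 < int S" using N_space N_ge by linarith
  have word: "is_word w x" if "0 \<le> x" "x \<le> 13 * N" for x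
    using that by (intro wd_word wdI) auto
  have less13: "a = 0 \<or> a = 1 \<or> a = 2 \<or> a = 3 \<or> a = 4 \<or> a = 5 \<or> a = 6 \<or> a = 7 \<or> a = 8 \<or>
    a = 9 \<or> a = 10 \<or> a = 11 \<or> a = 12" if "a < 13" for a :: nat
    using that by presburger
  show ?thesis
    unfolding base_prog_def
    apply (rule exI)
    apply (rule exI)
    apply (rule conjI)
    apply (rule exec_Const_Seq, rule word, use N_ge in simp, use N_ge in simp)
    apply (rule exec_Load_Seq[where x = "int n"], use assms S in simp, use S in simp, use S in simp)
    apply (rule exec_Const_Seq, rule word, use N_ge in simp, use N_ge in simp)
    apply (rule exec_Load_Seq[where x = "int m"], use assms S in simp, use S in simp, use S in simp)
    apply (rule exec_Add_Seq[where x = "int n + int m"], simp add: N_eq, rule word, use N_ge in simp, use N_ge in simp)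
    apply (rule exec_Add_Seq[where x = "2 * int n + 2 * int m"], simp add: N_eq, rule word, use N_ge in simp, use N_ge in simp)
    apply (rule exec_Const_Seq, rule word, use N_ge in simp, use N_ge in simp)
    apply (rule exec_Add_Seq[where x = "N"], simp add: N_eq, rule word, use N_ge in simp, use N_ge in simp)
    apply (rule exec_Add_Seq[where x = "2 * N"], simp add: N_eq, rule word, use N_ge in simp, use N_ge in simp)
    apply (rule exec_Add_Seq[where x = "3 * N"], simp add: N_eq, rule word, use N_ge in simp, use N_ge in simp)
    apply (rule exec_Add_Seq[where x = "4 * N"], simp add: N_eq, rule word, use N_ge in simp, use N_ge in simp)
    apply (rule exec_Add_Seq[where x = "5 * N"], simp add: N_eq, rule word, use N_ge in simp, use N_ge in simp)
    apply (rule exec_Add_Seq[where x = "6 * N"], simp add: N_eq, rule word, use N_ge in simp, use N_ge in simp)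
    apply (rule exec_Add_Seq[where x = "7 * N"], simp add: N_eq, rule word, use N_ge in simp, use N_ge in simp)
    apply (rule exec_Add_Seq[where x = "8 * N"], simp add: N_eq, rule word, use N_ge in simp, use N_ge in simp)
    apply (rule exec_Add_Seq[where x = "9 * N"], simp add: N_eq, rule word, use N_ge in simp, use N_ge in simp)
    apply (rule exec_Add_Seq[where x = "10 * N"], simp add: N_eq, rule word, use N_ge in simp, use N_ge in simp)
    apply (rule exec_Add_Seq[where x = "11 * N"], simp add: N_eq, rule word, use N_ge in simp, use N_ge in simp)
    apply (rule exec_Add[where x = "12 * N"], simp, rule word, use N_ge in simp, use N_ge in simp)
    apply (intro conjI allI impI)
      apply simp
     apply (drule less13, elim disjE; simp)
    apply simp
    done
qed

text \<open>The input has \<open>3 + 2 * m \<le> N\<close> words, so it fits into array 0 and every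
  other array starts out zero.\<close>

lemma initial_arrs:
  assumes "M = snd (initial_state (input_words k n es))"
  shows "input (view M)" "0 < a \<Longrightarrow> view M a = (\<lambda>_. 0)"
proof -
  let ?xs = "input_words k n es"
  have len: "length ?xs = 3 + 2 * m"
    by (simp add: input_words_def length_concat_pairs length_es)
  have M: "M a = (if a < 3 + 2 * m then ?xs ! a else 0)" for a
    using assms len by (simp add: initial_state_def)
  have v: "view M 0 (int j) = ?xs ! j" if "j < 3 + 2 * m" for j
    using that N_ge by (simp add: view_def M)
  show "input (view M)"
    unfolding input_def
  proof (intro conjI allI impI)
    show "view M 0 0 = k" using v[of 0] by (simp add: input_words_def)
    show "view M 0 1 = int n" using v[of 1] by (simp add: input_words_def)
    show "view M 0 2 = int m" using v[of 2] by (simp add: input_words_def length_es)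
    fix i assume i: "i < m"
    show "view M 0 (3 + 2 * int i) = int (fst (es ! i))"
      using v[of "3 + 2 * i"] i nth_concat_pairs(1)[of i es] length_es
      by (simp add: input_words_def nth_append)
    show "view M 0 (4 + 2 * int i) = int (snd (es ! i))"
      using v[of "4 + 2 * i"] i nth_concat_pairs(2)[of i es] length_es
      by (simp add: input_words_def nth_append)
  qed
  show "view M a = (\<lambda>_. 0)" if "0 < a"
  proof
    fix i
    show "view M a i = 0"
    proof (cases "a < 13 \<and> 0 \<le> i \<and> i < N")
      case True
      have "1 * N \<le> int a * N" using that N_nonneg by (intro mult_right_mono) auto
      moreover have "int (3 + 2 * m) \<le> N" using N_ge by simp
      ultimately have "int (3 + 2 * m) \<le> int a * N + i" using True by linarith
      then have "3 + 2 * m \<le> nat (int a * N + i)" by linarith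
      then show ?thesis using True by (simp add: view_def M)
    next
      case False
      then show ?thesis unfolding view_def by (rule if_not_P)
    qed
  qed
qed

text \<open>The constant 55 consists of 19 for the base addresses, 25 for the setup, 10 for the
  search and 1 for the output pointer; likewise \<open>31 = 21 + 10\<close>.\<close>

lemma MinRS_prog_run:
  assumes L: "n \<le> 2 ^ L"
  shows "\<exists>t s. exec w S MinRS_prog (initial_state (input_words k n es)) t s \<and>
    int t \<le> 55 + 40 * int m + 31 * int n + (250 + 9 * int L) * int (n + 2 * m) \<and>
    outputs S s (MinRSs k G)"
proof -
  define M where "M = snd (initial_state (input_words k n es))"
  have st: "initial_state (input_words k n es) = ((\<lambda>_. 0), M)"
    by (simp add: M_def initial_state_def)
  note ini = initial_arrs[OF M_def]
  have "M 1 = int n" "M 2 = int m"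
    by (simp_all add: M_def initial_state_def input_words_def length_concat_pairs length_es)
  then obtain R where R: "exec w S base_prog ((\<lambda>_. 0), M) 19 (R, M)"
    "\<forall>a<13. R a = int a * N" "\<forall>r. R (r + 14) = 0"
    using base_prog_exec by blast
  have rel: "rel (R, M) (\<lambda>_. 0) (view M)" using R by (simp add: rel_def)
  let ?T = "54 + 40 * int m + 31 * int n + (250 + 9 * int L) * int (n + 2 * m)"
  let ?Q = "\<lambda>V A t. \<exists>Ys. done_inv {..<n} Ys \<and> out_arr (out_list Ys) A \<and> A 12 0 = int (length Ys) \<and> t \<le> ?T"
  have "vc (setup_prog ;; search_prog) ?Q (\<lambda>_. 0) (view M) 19"
    unfolding vc.simps(7)
  proof (rule setup_prog_spec[OF ini])
    fix V A t'
    assume 1: "const_regs V" "graph_arrs A" "A 6 = (\<lambda>_. 0)" "\<forall>u<n. A 8 (int u) = - 1"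
      "t' \<le> 19 + 25 + 40 * int m + 21 * int n"
    show "vc search_prog ?Q V A t'"
      by (rule search_prog_spec[OF 1(1-4) L]) (use 1(5) in auto)
  qed auto
  from vc_sound[OF this rel] obtain u s V A Ys where u: "exec w S (compile (setup_prog ;; search_prog)) (R, M) u s"
    "rel s V A" and Ys: "done_inv {..<n} Ys" "out_arr (out_list Ys) A" "A 12 0 = int (length Ys)" "19 + int u \<le> ?T"
    by blast
  obtain R' M' where s: "s = (R', M')" by force
  have R': "R' 12 = 12 * N" "R' 0 = 0" "view M' = A" using u(2) by (auto simp: s rel_def)
  have "is_word w (R' 12 + R' 0)" using R' N_ge by (auto intro!: wd_word wdI)
  \<comment> \<open>Register 0 still holds the zero base address of array 0, so this addition copies
    the address of the output array into it.\<close>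
  from exec.Add[OF this, of S 0 M'] have "exec w S (Add 0 12 0) s 1 (R'(0 := R' 12 + R' 0), M')"
    by (simp add: s)
  from exec.Seq[OF R(1) exec.Seq[OF u(1) this]]
  have run: "exec w S MinRS_prog (initial_state (input_words k n es)) (19 + (u + 1)) (R'(0 := R' 12 + R' 0), M')"
    by (simp add: MinRS_prog_def st)
  have out: "outputs S (R'(0 := R' 12 + R' 0), M') (MinRSs k G)"
    unfolding outputs_def
  proof (intro exI conjI)
    show "distinct (map set Ys)" "\<forall>Y\<in>set Ys. distinct Y" using Ys(1) by (auto simp: done_inv_def)
    show "set (map set Ys) = MinRSs k G"
      by (rule MinRSs_eqI[symmetric]) (use Ys(1) in \<open>auto simp: done_inv_def\<close>)
    show "fst (R'(0 := R' 12 + R' 0), M') 0 = int (nat (12 * N))" using R' N_ge by simp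
    have len: "length (output_words Ys) \<le> 1 + 2 * n" using Ys(1) by (simp add: output_words_eq done_inv_def)
    then show "nat (12 * N) + length (output_words Ys) \<le> S" using N_ge N_space by linarith
    show "\<forall>i<length (output_words Ys). snd (R'(0 := R' 12 + R' 0), M') (nat (12 * N) + i) = output_words Ys ! i"
    proof (intro allI impI)
      fix i assume i: "i < length (output_words Ys)"
      have "M' (nat (12 * N) + i) = view M' 12 (int i)"
        using i len N_ge by (simp add: view_def nat_add_distrib)
      also have "\<dots> = output_words Ys ! i"
        using i Ys(2,3) by (cases i) (auto simp: R' output_words_eq out_arr_def)
      finally show "snd (R'(0 := R' 12 + R' 0), M') (nat (12 * N) + i) = output_words Ys ! i" by simp
    qed
  qed
  show ?thesis
    by (intro exI conjI, rule run) (use Ys(4) out in auto)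
qed

lemma no_edges: "n \<le> 1 \<Longrightarrow> m = 0"
  using edge_props length_es by (cases es; cases "hd es") force+

lemma MinRS_prog_time:
  "\<exists>t s. exec w S MinRS_prog (initial_state (input_words k n es)) t s \<and>
    real t \<le> 1000 * (1 + (real n + real m) * log 2 (real n)) \<and> outputs S s (MinRSs k G)"
proof (cases "n \<le> 1")
  case True
  then have "n \<le> 2 ^ 0" by simp
  from MinRS_prog_run[OF this] obtain t s where
    1: "exec w S MinRS_prog (initial_state (input_words k n es)) t s" "outputs S s (MinRSs k G)"
    "int t \<le> 55 + 40 * int m + 31 * int n + (250 + 9 * int 0) * int (n + 2 * m)" by blast
  \<comment> \<open>For \<open>n = 0\<close> this rests on the convention \<open>ln 0 = 0\<close>.
    The allowed time is then constant, which suffices since there are no edges.\<close>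
  have "log 2 (real n) = 0" using True by (cases n) (auto simp: log_def)
  then show ?thesis using 1 no_edges[OF True] True by (intro exI[of _ t] exI[of _ s]) auto
next
  case False
  then obtain L where L: "n \<le> 2 ^ L" "real L \<le> 2 * log 2 (real n)" using exists_log_bound[of n] by auto
  define l where "l = log 2 (real n)"
  have l: "1 \<le> l" using False by (simp add: l_def le_log_iff)
  from MinRS_prog_run[OF L(1)] obtain t s where
    1: "exec w S MinRS_prog (initial_state (input_words k n es)) t s" "outputs S s (MinRSs k G)"
    "int t \<le> 55 + 40 * int m + 31 * int n + (250 + 9 * int L) * int (n + 2 * m)" by blast
  define x where "x = real n + real m"
  have "real t = real_of_int (int t)" by simp
  also have "\<dots> \<le> real_of_int (55 + 40 * int m + 31 * int n + (250 + 9 * int L) * int (n + 2 * m))"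
    using 1(3) by (simp only: of_int_le_iff)
  also have "\<dots> = 55 + 40 * real m + 31 * real n + (250 + 9 * real L) * (real n + 2 * real m)" by simp
  \<comment> \<open>From \<open>L \<le> 2 * l\<close> and \<open>1 \<le> l\<close> one gets
    \<open>250 + 9 * L \<le> (250 + 18) * l\<close>.\<close>
  also have "\<dots> \<le> 55 + 40 * x + (268 * l) * (2 * x)"
  proof -
    have "(250 + 9 * real L) * (real n + 2 * real m) \<le> (268 * l) * (2 * x)"
      using L(2) l by (intro mult_mono) (auto simp: x_def l_def)
    moreover have "40 * real m + 31 * real n \<le> 40 * x" by (simp add: x_def)
    ultimately show ?thesis by linarith
  qed
  also have "\<dots> \<le> 1000 * (1 + x * l)"
    using mult_left_mono[OF l, of x] by (simp add: x_def algebra_simps)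
  finally have "real t \<le> 1000 * (1 + x * l)" .
  then show ?thesis using 1(1,2) unfolding x_def l_def by blast
qed

end

theorem theorem3:
  "\<exists>(p :: prog) (c :: nat).
     \<forall>(k :: int) (G :: nat ugraph) (n :: nat) (m :: nat) (es :: (nat \<times> nat) list) (w :: nat).
       simple_graph G \<longrightarrow> k_core k G \<longrightarrow>
       verts G = {0..<n} \<longrightarrow> m = card (edges G) \<longrightarrow> edge_list G es \<longrightarrow>
       int c * (1 + int n + int m + \<bar>k\<bar>) \<le> 2 ^ w \<longrightarrow>
       (\<exists>t s. exec w (c * (1 + n + m)) p (initial_state (input_words k n es)) t s \<and>
          real t \<le> real c * (1 + (real n + real m) * log 2 (real n)) \<and>
          outputs (c * (1 + n + m)) s (MinRSs k G))"
proof (rule exI[of _ MinRS_prog], rule exI[of _ 1000], intro allI impI)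
  fix k :: int and G :: "nat ugraph" and n m w :: nat and es :: "(nat \<times> nat) list"
  assume a: "simple_graph G" "k_core k G" "verts G = {0..<n}" "m = card (edges G)" "edge_list G es"
    and w: "int 1000 * (1 + int n + int m + \<bar>k\<bar>) \<le> 2 ^ w"
  \<comment> \<open>The factor 1000 is a round number large enough for time, space and words at
    once: the arrays take only \<open>13 * N = 26 * n + 26 * m + 52\<close> cells, and adding
    \<open>\<bar>k\<bar>\<close> to this stays strictly below
    \<open>1000 * (1 + n + m + \<bar>k\<bar>)\<close>.\<close>
  interpret ram_graph k G n m es "2 * int n + 2 * int m + 4" "13 * (2 * int n + 2 * int m + 4) + \<bar>k\<bar>"
    w "1000 * (1 + n + m)"
    by unfold_locales (use a w in auto)
  show "\<exists>t s. exec w (1000 * (1 + n + m)) MinRS_prog (initial_state (input_words k n es)) t s \<and>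
          real t \<le> real 1000 * (1 + (real n + real m) * log 2 (real n)) \<and>
          outputs (1000 * (1 + n + m)) s (MinRSs k G)"
    using MinRS_prog_time by simp
qed

end
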